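(* Let $d\ge1$. If $\mathscr T$ is a dimensionally absolutely stable T-mesh (for $\mathbf S_d$), then $\mathscr T$ is a dimensionally stable T-mesh (for $\mathbf S_d$).
   Context: **T-mesh.** A T-mesh $\mathscr{T}=(\mathcal T_0,\mathcal T_1,\mathcal T_2)$ of $\mathbb R^2$ consists of a finite set $\mathcal T_2$ of closed axis-aligned rectangles (cells), a finite set $\mathcal T_1$ of closed horizontal and vertical segments (edges) contained in $\bigcup_{f\in\mathcal T_2}\partial f$, and the finite set $\mathcal T_0=\bigcup_{l\in\mathcal T_1}\partial l$ of vertices ($\partial l$ = endpoints of $l$), such that: each $\partial f$, $f\in\mathcal T_2$, is a finite union of edges; for distinct cells $f,f'$, $f\cap f'=\partial f\cap\partial f'$ is a finite union of elements of $\mathcal T_0\cup\mathcal T_1$; for distinct edges $l,l'$, $l\cap l'=\partial l\cap\partial l'\subseteq\mathcal T_0$; each vertex is the intersection of a horizontal and a vertical edge. The domain is $\Omega=\bigcup_{f\in\mathcal T_2}f$; it is assumed simply connected with connected interior $\Omega^0$. Vertices in $\Omega^0$ are interior vertices, the others boundary vertices; edges not contained in $\partial\Omega$ are interior edges. **$l$-edges.** A segment of $\mathscr T$ is a connected union of collinear mesh edges; an $l$-edge is a maximal such segment. An $l$-edge made of interior edges is an interior $l$-edge; a maximal segment contained in $\partial\Omega$ is a boundary $l$-edge. An interior $l$-edge is a cross-cut if both endpoints are boundary vertices, a ray if exactly one is, and a T $l$-edge if both are interior vertices. $B(\mathscr T),C(\mathscr T),R(\mathscr T)$ denote the sets of boundary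 $l$-edges, cross-cuts and rays. The T-connected component $T(\mathscr T)$ is the edge–vertex configuration formed by all T $l$-edges and all vertices on them; it is assumed connected; $L(T(\mathscr T))$ is the set of T $l$-edges. It is also assumed that no T $l$-edge is vanishable, i.e. every T $l$-edge carries at least $d+2$ vertices. **Spline space and dimensional stability.** $\mathbf S_d(\mathscr T)$ is the space of functions $s$ on $\Omega$ whose restriction to each cell is a polynomial of bi-degree $(d,d)$ and which are continuous of order $d-1$ along the $x$-direction and of order $d-1$ along the $y$-direction. Let $L(\mathscr T)$ be the set of all $l$-edges (boundary ones included), $L_1(\mathscr T)$, $L_2(\mathscr T)$ the horizontal and vertical ones, and $\operatorname{cor}(l)$ the constant $y$-coordinate (horizontal $l$) or $x$-coordinate (vertical $l$). $\mathscr T_1,\mathscr T_2$ are structurally isomorphic if there is a bijection $\alpha:L(\mathscr T_1)\to L(\mathscr T_2)$ with: (i) $\alpha(B(\mathscr T_1))=B(\mathscr T_2)$, $\alpha(C(\mathscr T_1))=C(\mathscr T_2)$, $\alpha(R(\mathscr T_1))=R(\mathscr T_2)$, $\alpha(L(T(\mathscr T_1)))=L(T(\mathscr T_2))$; (ii) $l_i\cap l_j\neq\varnothing\iff\alpha(l_i)\cap\alpha(l_j)\ne\varnothing$; (iii) for $k=1,2$ and $l_i,l_j\in L_k(\mathscr T_1)$, $\operatorname{cor}(l_i)<\operatorname{cor}(l_j)\Rightarrow\operatorname{cor}(\alpha(l_i))<\operatorname{cor}(\alpha(l_j))$. This is an equivalence relation; $[\mathscr T]_{\mathrm I}$ is the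 class of $\mathscr T$. $\mathscr T$ is dimensionally stable for $\mathbf S_d$ if $\dim\mathbf S_d(\mathscr T_1)=\dim\mathbf S_d(\mathscr T_2)$ for all $\mathscr T_1,\mathscr T_2\in[\mathscr T]_{\mathrm I}$. **Generalized T-connected components.** A generalized T-connected component $\mathrm{GT}=(L_h,L_v,V)$ is a finite connected edge–vertex configuration: $L_h,L_v$ are finite sets of closed horizontal, resp. vertical, segments; distinct parallel segments are disjoint and two perpendicular segments meet in at most one point; the elements of $L(\mathrm{GT})=L_h\cup L_v$ are its $l$-edges. Each $l\in L(\mathrm{GT})$ carries a finite set $V(l)\subset l$ of marked vertices containing both endpoints of $l$; whenever $l_i\cap l_j\ne\varnothing$ the intersection point belongs to both $V(l_i)$ and $V(l_j)$; $V=\bigcup_l V(l)$. Connected means any two $l$-edges are joined by a finite chain of successively intersecting $l$-edges. Write $n(l)=|V(l)|$. It need not come from any T-mesh; every $T(\mathscr T)$ is one. **Structural similarity.** A structurally similar map is a bijection $\beta:L(\mathrm{GT}_1)\to L(\mathrm{GT}_2)$ with $n(l)=n(\beta(l))$ for all $l$ and $l_i\cap l_j\ne\varnothing\iff\beta(l_i)\cap\beta(l_j)\neq\varnothing$ for all $l_i,l_j$ (no condition on orientation or relative coordinates). This is an equivalence relation; $[T(\mathscr T)]_{\mathrm S}$ is the class of $T(\mathscr T)$. **Conformality vector space and absolute stability.** For $\mathrm{GT}$, $\mathsf{CVS}[\mathrm{GT}]$ is the space of vectors $(\delta_v)_{v\in V}$ of real numbers such that for each $l\in L(\mathrm{GT})$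 with $V(l)=\{v_1,\dots,v_r\}$ having coordinates $x_1,\dots,x_r$ along $l$ ($x$-coordinates if $l$ is horizontal, $y$-coordinates if vertical), $\sum_{i=1}^r x_i^k\delta_{v_i}=0$ for $k=0,\dots,d$. $\mathscr T$ is dimensionally absolutely stable for $\mathbf S_d$ if $\dim\mathsf{CVS}[\mathrm{GT}_1]=\dim\mathsf{CVS}[\mathrm{GT}_2]$ for all $\mathrm{GT}_1,\mathrm{GT}_2\in[T(\mathscr T)]_{\mathrm S}$. *)

theory Defs
  imports "HOL-Analysis.Analysis" "HOL-Library.Function_Algebras"
begin

text \<open>The pointwise real vector space structure on functions, so that \<^const>\<open>dim\<close> applies to
  spaces of functions.\<close>

instantiation "fun" :: (type, real_vector) real_vector
begin

definition scaleR_fun :: "real \<Rightarrow> ('a \<Rightarrow> 'b) \<Rightarrow> 'a \<Rightarrow> 'b"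
  where "scaleR_fun r f = (\<lambda>x. r *\<^sub>R f x)"

instance
  by standard (simp_all add: scaleR_fun_def fun_eq_iff scaleR_add_right scaleR_add_left)

end


section \<open>Segments and rectangles\<close>

type_synonym point = "real \<times> real"

definition rectangle :: "point set \<Rightarrow> bool" where
  "rectangle f \<longleftrightarrow> (\<exists>a b c e. a < b \<and> c < e \<and> f = {a..b} \<times> {c..e})"

definition horizontal :: "point set \<Rightarrow> bool" where
  "horizontal l \<longleftrightarrow> (\<exists>a b y. a < b \<and> l = closed_segment (a, y) (b, y))"

definition vertical :: "point set \<Rightarrow> bool" where
  "vertical l \<longleftrightarrow> (\<exists>a b x. a < b \<and> l = closed_segment (x, a) (x, b))"

definition endpoints :: "point set \<Rightarrow> point set" where
  "endpoints l = {p. p extreme_point_of l}"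

definition cor :: "point set \<Rightarrow> real" where
  "cor l = (if horizontal l then THE y. \<forall>p\<in>l. snd p = y else THE x. \<forall>p\<in>l. fst p = x)"


section \<open>T-meshes\<close>

record mesh =
  verts :: "point set"
  edges :: "point set set"
  cells :: "point set set"

definition domain :: "mesh \<Rightarrow> point set" where
  "domain M = \<Union>(cells M)"

definition tmesh :: "mesh \<Rightarrow> bool" where
  "tmesh M \<longleftrightarrow>
     finite (cells M) \<and> (\<forall>f\<in>cells M. rectangle f) \<and>
     finite (edges M) \<and> (\<forall>l\<in>edges M. horizontal l \<or> vertical l) \<and>
     (\<forall>l\<in>edges M. l \<subseteq> (\<Union>f\<in>cells M. frontier f)) \<and>
     verts M = (\<Union>l\<in>edges M. endpoints l) \<and>
     (\<forall>f\<in>cells M. \<exists>E\<subseteq>edges M. frontier f = \<Union>E) \<and>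
     (\<forall>f\<in>cells M. \<forall>f'\<in>cells M. f \<noteq> f' \<longrightarrow>
        f \<inter> f' = frontier f \<inter> frontier f' \<and>
        (\<exists>P\<subseteq>verts M. \<exists>E\<subseteq>edges M. f \<inter> f' = P \<union> \<Union>E)) \<and>
     (\<forall>l\<in>edges M. \<forall>l'\<in>edges M. l \<noteq> l' \<longrightarrow>
        l \<inter> l' = endpoints l \<inter> endpoints l' \<and> l \<inter> l' \<subseteq> verts M) \<and>
     (\<forall>p\<in>verts M. \<exists>h\<in>edges M. \<exists>v\<in>edges M. horizontal h \<and> vertical v \<and> h \<inter> v = {p}) \<and>
     simply_connected (domain M) \<and> connected (interior (domain M))"

definition interior_verts :: "mesh \<Rightarrow> point set" where
  "interior_verts M = verts M \<inter> interior (domain M)"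

definition boundary_verts :: "mesh \<Rightarrow> point set" where
  "boundary_verts M = verts M - interior (domain M)"

definition boundary_edges :: "mesh \<Rightarrow> point set set" where
  "boundary_edges M = {l \<in> edges M. l \<subseteq> frontier (domain M)}"

definition interior_edges :: "mesh \<Rightarrow> point set set" where
  "interior_edges M = edges M - boundary_edges M"


section \<open>l-edges\<close>

definition segment_of :: "point set set \<Rightarrow> point set \<Rightarrow> bool" where
  "segment_of E l \<longleftrightarrow> (\<exists>E'\<subseteq>E. E' \<noteq> {} \<and> l = \<Union>E' \<and> connected l \<and> collinear l)"

definition maximal_segments :: "point set set \<Rightarrow> point set set" where
  "maximal_segments E = {l. segment_of E l \<and> (\<forall>l'. segment_of E l' \<and> l \<subseteq> l' \<longrightarrow> l' = l)}"

text \<open>Maximality is taken separately among the interior and among the boundary edges. This matters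
  only at a reentrant corner of the domain, where a boundary edge may be continued by a collinear
  interior edge: there the boundary l-edge and the interior l-edge both end, so every edge lies on
  exactly one l-edge and every l-edge is a boundary l-edge, a cross-cut, a ray or a T l-edge.\<close>

definition interior_ledges :: "mesh \<Rightarrow> point set set" where
  "interior_ledges M = maximal_segments (interior_edges M)"

definition boundary_ledges :: "mesh \<Rightarrow> point set set" where
  "boundary_ledges M = maximal_segments (boundary_edges M)"

definition ledges :: "mesh \<Rightarrow> point set set" where
  "ledges M = interior_ledges M \<union> boundary_ledges M"

definition cross_cuts :: "mesh \<Rightarrow> point set set" where
  "cross_cuts M = {l \<in> interior_ledges M. endpoints l \<subseteq> boundary_verts M}"

definition rays :: "mesh \<Rightarrow> point set set" where
  "rays M = {l \<in> interior_ledges M. card (endpoints l \<inter> boundary_verts M) = 1}"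

definition T_ledges :: "mesh \<Rightarrow> point set set" where
  "T_ledges M = {l \<in> interior_ledges M. endpoints l \<subseteq> interior_verts M}"

definition no_vanishable :: "nat \<Rightarrow> mesh \<Rightarrow> bool" where
  "no_vanishable d M \<longleftrightarrow> (\<forall>l\<in>T_ledges M. card (verts M \<inter> l) \<ge> d + 2)"


section \<open>Spline spaces and dimensional stability\<close>

definition bidegree_poly_on :: "nat \<Rightarrow> point set \<Rightarrow> (point \<Rightarrow> real) \<Rightarrow> bool" where
  "bidegree_poly_on d f s \<longleftrightarrow>
     (\<exists>c. \<forall>x y. (x, y) \<in> f \<longrightarrow> s (x, y) = (\<Sum>i\<le>d. \<Sum>j\<le>d. c i j * x ^ i * y ^ j))"

text \<open>Continuity of order \<open>k\<close> on the closed set \<open>S\<close> along the direction \<open>e\<close>: the iterated directional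
  derivatives up to order \<open>k\<close> exist in the interior of \<open>S\<close> and extend continuously to \<open>S\<close>.\<close>

primrec cont_order :: "nat \<Rightarrow> point \<Rightarrow> point set \<Rightarrow> (point \<Rightarrow> real) \<Rightarrow> bool" where
  "cont_order 0 e S s \<longleftrightarrow> continuous_on S s"
| "cont_order (Suc k) e S s \<longleftrightarrow> continuous_on S s \<and>
     (\<exists>g. (\<forall>p\<in>interior S. ((\<lambda>t. s (p + t *\<^sub>R e)) has_real_derivative g p) (at 0)) \<and>
          cont_order k e S g)"

text \<open>A function on the domain is represented by its extension by zero to the plane.\<close>

definition spline_space :: "nat \<Rightarrow> mesh \<Rightarrow> (point \<Rightarrow> real) set" where
  "spline_space d M =
     {s. (\<forall>p. p \<notin> domain M \<longrightarrow> s p = 0) \<and>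
         (\<forall>f\<in>cells M. bidegree_poly_on d f s) \<and>
         cont_order (d - 1) (1, 0) (domain M) s \<and>
         cont_order (d - 1) (0, 1) (domain M) s}"

definition struct_iso :: "mesh \<Rightarrow> mesh \<Rightarrow> bool" where
  "struct_iso M1 M2 \<longleftrightarrow>
     (\<exists>\<alpha>. bij_betw \<alpha> (ledges M1) (ledges M2) \<and>
          \<alpha> ` boundary_ledges M1 = boundary_ledges M2 \<and>
          \<alpha> ` cross_cuts M1 = cross_cuts M2 \<and>
          \<alpha> ` rays M1 = rays M2 \<and>
          \<alpha> ` T_ledges M1 = T_ledges M2 \<and>
          (\<forall>l\<in>ledges M1. \<forall>l'\<in>ledges M1. l \<inter> l' \<noteq> {} \<longleftrightarrow> \<alpha> l \<inter> \<alpha> l' \<noteq> {}) \<and>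
          (\<forall>l\<in>ledges M1. \<forall>l'\<in>ledges M1.
             (horizontal l \<and> horizontal l' \<or> vertical l \<and> vertical l') \<longrightarrow>
             cor l < cor l' \<longrightarrow> cor (\<alpha> l) < cor (\<alpha> l')))"

definition iso_class :: "mesh \<Rightarrow> mesh set" where
  "iso_class M = {M'. tmesh M' \<and> struct_iso M M'}"

definition dim_stable :: "nat \<Rightarrow> mesh \<Rightarrow> bool" where
  "dim_stable d M \<longleftrightarrow>
     (\<forall>M1\<in>iso_class M. \<forall>M2\<in>iso_class M. dim (spline_space d M1) = dim (spline_space d M2))"


section \<open>Generalized T-connected components\<close>

record gtc =
  hsegs :: "point set set"
  vsegs :: "point set set"
  marks :: "point set \<Rightarrow> point set"

definition gt_ledges :: "gtc \<Rightarrow> point set set" where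
  "gt_ledges G = hsegs G \<union> vsegs G"

definition gt_verts :: "gtc \<Rightarrow> point set" where
  "gt_verts G = (\<Union>l\<in>gt_ledges G. marks G l)"

definition gt_connected :: "gtc \<Rightarrow> bool" where
  "gt_connected G \<longleftrightarrow>
     (\<forall>l\<in>gt_ledges G. \<forall>l'\<in>gt_ledges G.
        (l, l') \<in> {(a, b). a \<in> gt_ledges G \<and> b \<in> gt_ledges G \<and> a \<inter> b \<noteq> {}}\<^sup>*)"

text \<open>That perpendicular segments meet in at most one point is automatic.\<close>

definition gen_T_component :: "gtc \<Rightarrow> bool" where
  "gen_T_component G \<longleftrightarrow>
     finite (hsegs G) \<and> (\<forall>l\<in>hsegs G. horizontal l) \<and>
     finite (vsegs G) \<and> (\<forall>l\<in>vsegs G. vertical l) \<and>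
     disjoint (hsegs G) \<and> disjoint (vsegs G) \<and>
     (\<forall>l\<in>gt_ledges G. finite (marks G l) \<and> marks G l \<subseteq> l \<and> endpoints l \<subseteq> marks G l) \<and>
     (\<forall>l\<in>gt_ledges G. \<forall>l'\<in>gt_ledges G. l \<noteq> l' \<longrightarrow> l \<inter> l' \<subseteq> marks G l \<inter> marks G l') \<and>
     gt_connected G"

definition T_component :: "mesh \<Rightarrow> gtc" where
  "T_component M = \<lparr>hsegs = {l \<in> T_ledges M. horizontal l}, vsegs = {l \<in> T_ledges M. vertical l},
     marks = (\<lambda>l. verts M \<inter> l)\<rparr>"

definition struct_similar :: "gtc \<Rightarrow> gtc \<Rightarrow> bool" where
  "struct_similar G1 G2 \<longleftrightarrow>
     (\<exists>\<beta>. bij_betw \<beta> (gt_ledges G1) (gt_ledges G2) \<and>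
          (\<forall>l\<in>gt_ledges G1. card (marks G1 l) = card (marks G2 (\<beta> l))) \<and>
          (\<forall>l\<in>gt_ledges G1. \<forall>l'\<in>gt_ledges G1. l \<inter> l' \<noteq> {} \<longleftrightarrow> \<beta> l \<inter> \<beta> l' \<noteq> {}))"

definition similarity_class :: "gtc \<Rightarrow> gtc set" where
  "similarity_class G = {G'. gen_T_component G' \<and> struct_similar G G'}"

text \<open>Vectors indexed by the vertices are represented by functions vanishing elsewhere.\<close>

definition CVS :: "nat \<Rightarrow> gtc \<Rightarrow> (point \<Rightarrow> real) set" where
  "CVS d G =
     {\<delta>. (\<forall>p. p \<notin> gt_verts G \<longrightarrow> \<delta> p = 0) \<and>
         (\<forall>l\<in>hsegs G. \<forall>k\<le>d. (\<Sum>p\<in>marks G l. fst p ^ k * \<delta> p) = 0) \<and>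
         (\<forall>l\<in>vsegs G. \<forall>k\<le>d. (\<Sum>p\<in>marks G l. snd p ^ k * \<delta> p) = 0)}"

definition abs_dim_stable :: "nat \<Rightarrow> mesh \<Rightarrow> bool" where
  "abs_dim_stable d M \<longleftrightarrow>
     (\<forall>G1\<in>similarity_class (T_component M). \<forall>G2\<in>similarity_class (T_component M).
        dim (CVS d G1) = dim (CVS d G2))"

end

theory Submission
  imports Defs
begin

text \<open>The dimension of the spline space splits into a part that depends only on how the l-edges of the mesh
meet, and the dimension of the conformality vector space of the T-connected component:
if the mesh has a cell, it is \<open>(d + 1)^2 + (d + 1) * c + v\<close> plus the latter dimension,
where \<open>c\<close> is the number of cross-cuts and \<open>v\<close> the number of interior vertices on no T l-edge
(\<open>dim_spline_space_formula\<close>).  A structural isomorphism preserves \<open>c\<close> and \<open>v\<close> and makes the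
T-connected components structurally similar (\<open>struct_iso_invariants\<close>), so absolute stability, which
fixes the last summand on a similarity class, makes the whole dimension constant on an isomorphism class.

The formula comes from smoothing cofactors.  Two polynomial pieces that meet along a vertical edge at
abscissa \<open>t\<close> join with smoothness of order \<open>d - 1\<close> exactly when their difference is
\<open>(x - t)^d\<close> times a polynomial in \<open>y\<close>, the cofactor of the edge (\<open>spline_space_eq_assemble\<close>).
Going once around an interior vertex at height \<open>y0\<close> shows that the cofactors of the two vertical edges
there differ by a real multiple of \<open>(y - y0)^d\<close>, and that the same real number governs the two
horizontal edges (\<open>cofactor_jump\<close>).  So along an l-edge the cofactor is its starting value plus a sum of
such powers over the vertices passed.  It vanishes beyond an end in the interior of the domain.  Hence a
T l-edge imposes on its vertex numbers the vanishing of the moments of order up to \<open>d\<close>, which is the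
conformality condition, a ray imposes nothing, and the starting value of a cross-cut is free.

A spline is determined by one of its pieces, the starting cofactors of the cross-cuts and the numbers at
the interior vertices (\<open>cofactor_data_zero\<close>).  Conversely every choice of these data that satisfies the
conformality conditions occurs (\<open>prescribed_cofactors\<close>).  The differences of the pieces are then known
near each point, and the question is whether they can be integrated to a family of pieces over the whole
domain.  This is where simple connectedness enters: a cocycle on a finite cover of a simply connected set
by compact convex sets is a coboundary (\<open>cech_real\<close>).  The same lemma shows that two cells cannot touch
in a corner at which the domain is pinched (\<open>no_pinch\<close>), so that cells at a common point are always
connected around it through common sides.

For the invariants, the vertices on a T l-edge correspond to the other l-edges meeting it.  An interior
vertex off the T l-edges is the crossing of two cross-cuts or rays; two such l-edges may also meet at a
reentrant corner of the domain, but then some boundary l-edge meets both, which never happens for a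
crossing at an interior vertex (\<open>boundary_ledge_not_both\<close>, \<open>card_crossing_pairs\<close>).  Both
descriptions are in terms of incidences, which a structural isomorphism preserves.\<close>

section \<open>Cocycles on a simply connected union of convex sets\<close>

text \<open>By compactness, sets without a common point stay a positive distance apart.  A partition of unity
subordinate to slightly enlarged sets therefore sees only sets that really meet.\<close>

lemma cech_cover_gap:
  fixes C :: "'a::euclidean_space set set"
  assumes fin: "finite C" and cpt: "\<And>f. f \<in> C \<Longrightarrow> compact f"
  shows "\<exists>e>0. \<forall>f\<in>C. \<forall>g\<in>C. \<forall>h\<in>C. f \<inter> g \<inter> h = {} \<longrightarrow> (\<forall>p\<in>f \<inter> g. \<forall>q\<in>h. e \<le> dist p q)"
proof -
  have "\<exists>e>0. f \<inter> g \<inter> h = {} \<longrightarrow> (\<forall>p\<in>f \<inter> g. \<forall>q\<in>h. e \<le> dist p q)"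
    if "f \<in> C" "g \<in> C" "h \<in> C" for f g h
  proof (cases "f \<inter> g \<inter> h = {}")
    case True
    have "compact (f \<inter> g)" "closed h" using that cpt by (auto intro: compact_Int compact_imp_closed)
    then show ?thesis using separate_compact_closed[of "f \<inter> g" h] True by (metis)
  qed (auto intro: exI[of _ 1])
  then obtain D where Dpos: "\<And>f g h. f \<in> C \<Longrightarrow> g \<in> C \<Longrightarrow> h \<in> C \<Longrightarrow> D f g h > (0::real)"
    and D: "\<And>f g h p q. f \<in> C \<Longrightarrow> g \<in> C \<Longrightarrow> h \<in> C \<Longrightarrow> f \<inter> g \<inter> h = {} \<Longrightarrow>
      p \<in> f \<inter> g \<Longrightarrow> q \<in> h \<Longrightarrow> D f g h \<le> dist p q"
    by metis
  define e where "e = Min (insert 1 ((\<lambda>(f, g, h). D f g h) ` (C \<times> C \<times> C)))"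
  have finD: "finite (insert 1 ((\<lambda>(f, g, h). D f g h) ` (C \<times> C \<times> C)))" using fin by auto
  have "e > 0" unfolding e_def using finD Dpos by (subst Min_gr_iff) auto
  moreover have "e \<le> dist p q"
    if "f \<in> C" "g \<in> C" "h \<in> C" "f \<inter> g \<inter> h = {}" "p \<in> f \<inter> g" "q \<in> h" for f g h p q
  proof -
    have "e \<le> D f g h" unfolding e_def using finD that by (intro Min_le) (auto intro!: image_eqI[of _ _ "(f, g, h)"])
    then show ?thesis using D[OF that(1-6)] by linarith
  qed
  ultimately show ?thesis by blast
qed

text \<open>Averaging \<open>J g\<close> with a partition of unity gives a real function \<open>\<Phi> g\<close> on each \<open>g\<close>; on an overlap
two of them differ by the integer \<open>J f g\<close>, so the functions \<open>exp (2 pi i \<Phi> g)\<close> agree there and define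
a nowhere vanishing continuous function on the union.  Since the union is simply connected, this function
has a continuous logarithm, which up to the factor \<open>2 pi i\<close> differs from \<open>\<Phi> g\<close> by an integer
constant on each connected set \<open>g\<close>.  These constants form the potential.\<close>

lemma cech_integer:
  fixes C :: "'a::euclidean_space set set" and J :: "'a set \<Rightarrow> 'a set \<Rightarrow> int"
  assumes fin: "finite C" and cpt: "\<And>f. f \<in> C \<Longrightarrow> compact f"
    and cvx: "\<And>f. f \<in> C \<Longrightarrow> convex f" and ne: "\<And>f. f \<in> C \<Longrightarrow> f \<noteq> {}"
    and sc: "simply_connected (\<Union>C)"
    and coc: "\<And>f g h. f \<in> C \<Longrightarrow> g \<in> C \<Longrightarrow> h \<in> C \<Longrightarrow> f \<inter> g \<inter> h \<noteq> {} \<Longrightarrow> J f g + J g h = J f h"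
  shows "\<exists>u. \<forall>f\<in>C. \<forall>g\<in>C. f \<inter> g \<noteq> {} \<longrightarrow> u f - u g = J f g"
proof -
  obtain e where e: "e > 0" and gap: "\<And>f g h p q. f \<in> C \<Longrightarrow> g \<in> C \<Longrightarrow> h \<in> C \<Longrightarrow> f \<inter> g \<inter> h = {} \<Longrightarrow>
      p \<in> f \<inter> g \<Longrightarrow> q \<in> h \<Longrightarrow> e \<le> dist p q"
    using cech_cover_gap[OF fin cpt] by metis
  define \<psi> where "\<psi> h q = max 0 (e - infdist q h)" for h :: "'a set" and q
  have \<psi>0: "\<psi> h q \<ge> 0" for h q unfolding \<psi>_def by simp
  have \<psi>cont: "continuous_on S (\<psi> h)" for S h unfolding \<psi>_def by (intro continuous_intros)
  have \<psi>pos: "f \<inter> g \<inter> h \<noteq> {}" if fgh: "f \<in> C" "g \<in> C" "h \<in> C" "q \<in> f \<inter> g" "\<psi> h q \<noteq> 0" for f g h q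
  proof
    assume E: "f \<inter> g \<inter> h = {}"
    obtain y where "y \<in> h" "infdist q h = dist q y"
      using infdist_attains_inf[of h q] cpt[OF fgh(3)] ne[OF fgh(3)] compact_imp_closed by blast
    then have "e \<le> infdist q h" using gap[OF fgh(1-3) E fgh(4)] by auto
    then show False using fgh(5) unfolding \<psi>_def by auto
  qed
  define \<sigma> where "\<sigma> q = (\<Sum>h\<in>C. \<psi> h q)" for q
  have \<sigma>pos: "\<sigma> q > 0" if q: "q \<in> \<Union>C" for q
  proof -
    obtain f where f: "f \<in> C" "q \<in> f" using q by auto
    then have "\<psi> f q > 0" unfolding \<psi>_def using e by simp
    moreover have "\<psi> f q \<le> \<sigma> q" unfolding \<sigma>_def using f fin \<psi>0 by (intro member_le_sum) auto
    ultimately show ?thesis by linarith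
  qed
  have \<sigma>cont: "continuous_on S \<sigma>" for S unfolding \<sigma>_def by (intro continuous_on_sum \<psi>cont)
  define \<Phi> where "\<Phi> g q = (\<Sum>h\<in>C. \<psi> h q * of_int (J g h)) / \<sigma> q" for g q
  have \<Phi>cont: "continuous_on g (\<Phi> g)" if "g \<in> C" for g
    unfolding \<Phi>_def using \<sigma>pos that
    by (intro continuous_on_divide continuous_on_sum continuous_on_mult \<psi>cont \<sigma>cont continuous_on_const)
      (metis UnionI less_irrefl)
  have \<Phi>diff: "\<Phi> f q - \<Phi> g q = of_int (J f g)" if "f \<in> C" "g \<in> C" "q \<in> f" "q \<in> g" for f g q
  proof -
    have "(\<Sum>h\<in>C. \<psi> h q * of_int (J f h)) - (\<Sum>h\<in>C. \<psi> h q * of_int (J g h))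
        = (\<Sum>h\<in>C. \<psi> h q * of_int (J f g))"
      unfolding sum_subtractf[symmetric]
    proof (rule sum.cong[OF refl])
      fix h assume h: "h \<in> C"
      show "\<psi> h q * of_int (J f h) - \<psi> h q * of_int (J g h) = \<psi> h q * of_int (J f g)"
      proof (cases "\<psi> h q = 0")
        case False
        then have "J f g + J g h = J f h" using coc[of f g h] \<psi>pos[of f g h q] that h by blast
        then have "real_of_int (J f h) = of_int (J f g) + of_int (J g h)" by (metis of_int_add)
        then show ?thesis by (simp add: algebra_simps)
      qed simp
    qed
    also have "\<dots> = \<sigma> q * of_int (J f g)" unfolding \<sigma>_def by (simp add: sum_distrib_right)
    finally show ?thesis using \<sigma>pos[of q] that unfolding \<Phi>_def
      by (simp add: diff_divide_distrib[symmetric]) (metis UnionI less_irrefl)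
  qed
  define ch where "ch q = (SOME f. f \<in> C \<and> q \<in> f)" for q
  have ch: "ch q \<in> C \<and> q \<in> ch q" if "q \<in> \<Union>C" for q
    unfolding ch_def by (rule someI_ex) (use that in auto)
  define F where "F q = exp (2 * of_real pi * \<i> * of_real (\<Phi> (ch q) q))" for q
  have Feq: "F q = exp (2 * of_real pi * \<i> * of_real (\<Phi> g q))" if "g \<in> C" "q \<in> g" for g q
  proof -
    have "\<Phi> (ch q) q = \<Phi> g q + of_int (J (ch q) g)" using \<Phi>diff[of "ch q" g q] ch[of q] UnionI[OF that] that by fastforce
    then have "2 * of_real pi * \<i> * of_real (\<Phi> (ch q) q)
      = 2 * of_real pi * \<i> * of_real (\<Phi> g q) + of_real (real_of_int (2 * J (ch q) g) * pi) * \<i>"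
      by (simp add: algebra_simps)
    then show ?thesis unfolding F_def exp_eq by blast
  qed
  have "continuous_on (\<Union>f\<in>C. f) F"
  proof (rule continuous_on_closed_Union[OF fin])
    fix g assume g: "g \<in> C"
    then show "closed g" using cpt compact_imp_closed by blast
    have "continuous_on g (\<lambda>q. exp (2 * of_real pi * \<i> * of_real (\<Phi> g q)))"
      by (intro continuous_intros \<Phi>cont g)
    then show "continuous_on g F" using Feq[OF g] by (metis (no_types, lifting) continuous_on_cong)
  qed
  then have Fc: "continuous_on (\<Union>C) F" by simp
  have lpc: "locally path_connected (\<Union>C)"
    using ANR_imp_locally_path_connected ANR_finite_Union_convex_closed[OF fin] cpt cvx compact_imp_closed
    by blast
  obtain G where Gc: "continuous_on (\<Union>C) G" and G: "\<And>x. x \<in> \<Union>C \<Longrightarrow> F x = exp (G x)"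
    using continuous_logarithm_on_simply_connected[OF Fc sc lpc] unfolding F_def by auto
  define k where "k g q = Im (G q) / (2 * pi) - \<Phi> g q" for g q
  have kint: "\<exists>n. k g q = of_int n" if gq: "g \<in> C" "q \<in> g" for g q
  proof -
    have "exp (G q) = exp (2 * of_real pi * \<i> * of_real (\<Phi> g q))" using Feq[OF gq] G[OF UnionI[OF gq]] by simp
    then obtain n :: int where "G q = 2 * of_real pi * \<i> * of_real (\<Phi> g q) + of_real (real_of_int (2 * n) * pi) * \<i>"
      unfolding exp_eq by auto
    then have "Im (G q) = 2 * pi * \<Phi> g q + 2 * of_int n * pi" by simp
    then have "k g q = of_int n" unfolding k_def by (simp add: field_simps)
    then show ?thesis by blast
  qed
  have kconst: "k g constant_on g" if g: "g \<in> C" for g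
  proof (rule continuous_discrete_range_constant)
    show "connected g" using cvx g convex_connected by blast
    have "continuous_on g G" using Gc g by (meson Union_upper continuous_on_subset)
    then show "continuous_on g (k g)" unfolding k_def
      by (intro continuous_on_diff continuous_on_divide continuous_on_const continuous_on_Im \<Phi>cont g) auto
    fix x assume x: "x \<in> g"
    show "\<exists>e>0. \<forall>y. y \<in> g \<and> k g y \<noteq> k g x \<longrightarrow> e \<le> norm (k g y - k g x)"
    proof (intro exI[of _ 1] conjI allI impI)
      fix y assume y: "y \<in> g \<and> k g y \<noteq> k g x"
      obtain m n :: int where "k g x = m" "k g y = n" using kint[OF g] x y by blast
      then show "1 \<le> norm (k g y - k g x)" using y
        by (simp only: real_norm_def of_int_diff[symmetric] of_int_abs[symmetric]) auto
    qed simp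
  qed
  \<comment> \<open>By \<open>\<Phi>diff\<close> the constants \<open>k\<close> have the opposite differences.\<close>
  define u where "u g = - \<lfloor>k g (SOME q. q \<in> g)\<rfloor>" for g
  have uk: "k g q = - of_int (u g)" if "g \<in> C" "q \<in> g" for g q
  proof -
    have s: "(SOME q. q \<in> g) \<in> g" using that by (meson someI)
    have "k g q = k g (SOME q. q \<in> g)" using kconst[OF that(1)] s that(2) unfolding constant_on_def by metis
    then show ?thesis unfolding u_def using kint[OF that(1) s] by auto
  qed
  have "u f - u g = J f g" if fg: "f \<in> C" "g \<in> C" "f \<inter> g \<noteq> {}" for f g
  proof -
    obtain q where q: "q \<in> f" "q \<in> g" using fg by auto
    have "real_of_int (u f - u g) = k g q - k f q" using uk fg q by simp
    also have "\<dots> = of_int (J f g)" unfolding k_def using \<Phi>diff[OF fg(1,2) q] by simp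
    finally show ?thesis by (simp only: of_int_eq_iff)
  qed
  then show ?thesis by blast
qed

text \<open>Linear functionals over the rationals separate real numbers.  They reduce real cocycles to rational ones.\<close>

lemma additive_functional_rational:
  assumes "w \<noteq> (0::real)"
  shows "\<exists>\<phi>::real \<Rightarrow> rat. (\<forall>x y. \<phi> (x + y) = \<phi> x + \<phi> y) \<and> \<phi> w \<noteq> 0"
proof -
  interpret R: vector_space "\<lambda>(q::rat) (x::real). of_rat q * x"
    by unfold_locales (auto simp: algebra_simps of_rat_add of_rat_mult)
  interpret Q: vector_space "\<lambda>(q::rat) (x::rat). q * x"
    by unfold_locales (auto simp: algebra_simps)
  interpret P: vector_space_pair "\<lambda>(q::rat) (x::real). of_rat q * x" "\<lambda>(q::rat) (x::rat). q * x" ..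
  have "R.independent {w}" using assms R.independent_insert[of w "{}"] by simp
  then obtain \<phi> where \<phi>: "Vector_Spaces.linear (\<lambda>q x. of_rat q * x) (*) \<phi>" "\<forall>x\<in>{w}. \<phi> x = 1"
    using P.linear_independent_extend[of "{w}" "\<lambda>_. 1"] by blast
  interpret L: Vector_Spaces.linear "\<lambda>q x. of_rat q * x" "(*)" \<phi> by (fact \<phi>(1))
  show ?thesis using \<phi>(2) L.add by (intro exI[of _ \<phi>]) auto
qed

lemma closed_cover_all_related:
  fixes C :: "'a::euclidean_space set set"
  assumes fin: "finite C" and clo: "\<And>f. f \<in> C \<Longrightarrow> closed f" and ne: "\<And>f. f \<in> C \<Longrightarrow> f \<noteq> {}"
    and conn: "connected (\<Union>C)"
    and R: "\<And>f g. f \<in> C \<Longrightarrow> g \<in> C \<Longrightarrow> f \<inter> g \<noteq> {} \<Longrightarrow> R g \<Longrightarrow> R f"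
    and "f0 \<in> C" "R f0" "f \<in> C"
  shows "R f"
proof (rule ccontr)
  assume nR: "\<not> R f"
  define A where "A = \<Union>{f\<in>C. R f}"
  define B where "B = \<Union>{f\<in>C. \<not> R f}"
  have cl: "closed A" "closed B" unfolding A_def B_def using fin clo by (auto intro!: closed_Union)
  have "A \<inter> B = {}" unfolding A_def B_def using R by blast
  moreover have "\<Union>C \<subseteq> A \<union> B" unfolding A_def B_def by blast
  moreover have "A \<inter> \<Union>C \<noteq> {}" unfolding A_def using assms(6,7) ne by blast
  moreover have "B \<inter> \<Union>C \<noteq> {}" unfolding B_def using assms(8) nR ne by blast
  ultimately show False using conn cl unfolding connected_closed by blast
qed

text \<open>The values that a potential of \<open>J\<close> normalised at \<open>f0\<close> is forced to have, one for each chain.\<close>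

inductive chain_sum :: "'b set \<Rightarrow> ('b \<Rightarrow> 'b \<Rightarrow> bool) \<Rightarrow> ('b \<Rightarrow> 'b \<Rightarrow> real) \<Rightarrow> 'b \<Rightarrow> 'b \<Rightarrow> real \<Rightarrow> bool"
  for C meets J f0 where
  start: "chain_sum C meets J f0 f0 0"
| step: "chain_sum C meets J f0 g r \<Longrightarrow> g \<in> C \<Longrightarrow> f \<in> C \<Longrightarrow> meets f g \<Longrightarrow> chain_sum C meets J f0 f (r + J f g)"

text \<open>Summing along chains of meeting sets defines a potential unless two chains to the same set have
different sums.  A rational functional \<open>\<phi>\<close> separating the two sums would turn \<open>J\<close> into a
rational cocycle, hence after clearing denominators into an integer cocycle whose chain sums are not
determined by their end, although it has a potential.\<close>

lemma cech_real:
  fixes C :: "'a::euclidean_space set set" and J :: "'a set \<Rightarrow> 'a set \<Rightarrow> real"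
  assumes fin: "finite C" and cpt: "\<And>f. f \<in> C \<Longrightarrow> compact f"
    and cvx: "\<And>f. f \<in> C \<Longrightarrow> convex f" and ne: "\<And>f. f \<in> C \<Longrightarrow> f \<noteq> {}"
    and sc: "simply_connected (\<Union>C)"
    and coc: "\<And>f g h. f \<in> C \<Longrightarrow> g \<in> C \<Longrightarrow> h \<in> C \<Longrightarrow> f \<inter> g \<inter> h \<noteq> {} \<Longrightarrow> J f g + J g h = J f h"
  shows "\<exists>u. \<forall>f\<in>C. \<forall>g\<in>C. f \<inter> g \<noteq> {} \<longrightarrow> u f - u g = J f g"
proof (cases "C = {}")
  case False
  then obtain f0 where f0: "f0 \<in> C" by auto
  define meets where "meets = (\<lambda>f g :: 'a set. f \<inter> g \<noteq> {})"
  have clo: "closed f" if "f \<in> C" for f using cpt that compact_imp_closed by blast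
  have reach: "\<exists>r. chain_sum C meets J f0 f r" if "f \<in> C" for f
  proof (rule closed_cover_all_related[where R = "\<lambda>f. \<exists>r. chain_sum C meets J f0 f r" and C = C and ?f0.0 = f0])
    show "connected (\<Union>C)" using sc simply_connected_imp_connected by blast
    show "\<exists>r. chain_sum C meets J f0 f r"
      if "f \<in> C" "g \<in> C" "f \<inter> g \<noteq> {}" "\<exists>r. chain_sum C meets J f0 g r" for f g
      using chain_sum.step[of C meets J f0 g _ f] that unfolding meets_def by blast
    show "\<exists>r. chain_sum C meets J f0 f0 r" by (intro exI[of _ 0] chain_sum.start)
  qed (use fin clo ne f0 that in auto)
  have potential: "\<exists>v. \<forall>f r. chain_sum C meets J f0 f r \<longrightarrow> v f = \<phi> r"
    if add: "\<And>x y. \<phi> (x + y) = \<phi> x + \<phi> y" for \<phi> :: "real \<Rightarrow> rat"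
  proof -
    define S where "S = (\<lambda>t. \<phi> (J (fst t) (snd t))) ` (C \<times> C)"
    have "finite S" unfolding S_def using fin by auto
    then have "\<exists>N::int. N > 0 \<and> (\<forall>x\<in>S. of_int N * x \<in> \<int>)"
    proof (induction S)
      case empty then show ?case by (auto intro: exI[of _ 1])
    next
      case (insert x S)
      then obtain N :: int where N: "N > 0" "\<forall>x\<in>S. of_int N * x \<in> \<int>" by auto
      obtain a b :: int where ab: "x = of_int a / of_int b" "b > 0"
        by (metis quotient_of_denom_pos quotient_of_div surj_pair)
      have "of_int (N * b) * y \<in> \<int>" if "y \<in> insert x S" for y
      proof (cases "y = x")
        case True
        then have "of_int (N * b) * y = of_int (N * a)" using ab by simp
        then show ?thesis by (metis Ints_of_int)
      next
        case False
        then have "of_int N * y \<in> \<int>" using N that by auto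
        then have "of_int b * (of_int N * y) \<in> \<int>" using Ints_mult[OF Ints_of_int] by blast
        moreover have "of_int (N * b) * y = of_int b * (of_int N * y)" by simp
        ultimately show ?thesis by metis
      qed
      moreover have "N * b > 0" using N ab by simp
      ultimately show ?case by blast
    qed
    then obtain N :: int where N: "N > 0" "\<forall>x\<in>S. of_int N * x \<in> \<int>" by auto
    define I where "I f g = \<lfloor>of_int N * \<phi> (J f g)\<rfloor>" for f g
    have I: "of_int (I f g) = of_int N * \<phi> (J f g)" if "f \<in> C" "g \<in> C" for f g
    proof -
      have "\<phi> (J f g) \<in> S" unfolding S_def using that by force
      then have "of_int N * \<phi> (J f g) \<in> \<int>" using N by blast
      then show ?thesis unfolding I_def by (metis Ints_cases floor_of_int)
    qed
    have "\<exists>u. \<forall>f\<in>C. \<forall>g\<in>C. f \<inter> g \<noteq> {} \<longrightarrow> u f - u g = I f g"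
    proof (rule cech_integer[OF fin cpt cvx ne sc])
      fix f g h assume fgh: "f \<in> C" "g \<in> C" "h \<in> C" "f \<inter> g \<inter> h \<noteq> {}"
      have "(of_int (I f g + I g h) :: rat) = of_int (I f h)"
        using I fgh coc[OF fgh] add[of "J f g" "J g h"] by (simp add: distrib_left[symmetric])
      then show "I f g + I g h = I f h" by (simp only: of_int_eq_iff)
    qed
    then obtain u where u: "\<And>f g. f \<in> C \<Longrightarrow> g \<in> C \<Longrightarrow> f \<inter> g \<noteq> {} \<Longrightarrow> u f - u g = I f g" by blast
    have \<phi>0: "\<phi> 0 = 0" using add[of 0 0] by simp
    have "of_int (u f - u f0) = of_int N * \<phi> r" if "chain_sum C meets J f0 f r" for f r
      using that
    proof induction
      case start show ?case using \<phi>0 by simp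
    next
      case (step g r f)
      have "(of_int (u f - u f0) :: rat) = of_int (u f - u g) + of_int (u g - u f0)" by simp
      also have "\<dots> = of_int N * \<phi> (r + J f g)"
        using step u[of f g] I[of f g] by (simp add: meets_def add algebra_simps del: of_int_diff)
      finally show ?case .
    qed
    then have "of_int (u f - u f0) / of_int N = \<phi> r" if "chain_sum C meets J f0 f r" for f r
      using that N by (simp add: field_simps)
    then show ?thesis by (intro exI[of _ "\<lambda>f. of_int (u f - u f0) / of_int N"]) blast
  qed
  have unique: "r = r'" if "chain_sum C meets J f0 f r" "chain_sum C meets J f0 f r'" for f r r'
  proof (rule ccontr)
    assume "r \<noteq> r'"
    then obtain \<phi> :: "real \<Rightarrow> rat" where \<phi>: "\<And>x y. \<phi> (x + y) = \<phi> x + \<phi> y" "\<phi> (r - r') \<noteq> 0"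
      using additive_functional_rational[of "r - r'"] by auto
    have "\<phi> r = \<phi> r'" using potential[OF \<phi>(1)] that by metis
    then show False using \<phi>(1)[of "r - r'" r'] \<phi>(2) by simp
  qed
  obtain u where u: "\<And>f. f \<in> C \<Longrightarrow> chain_sum C meets J f0 f (u f)" using reach by metis
  have "u f - u g = J f g" if "f \<in> C" "g \<in> C" "f \<inter> g \<noteq> {}" for f g
    using unique[OF u[OF that(1)] chain_sum.step[OF u[OF that(2)] that(2,1)]] that(3)
    unfolding meets_def by simp
  then show ?thesis by blast
qed auto

section \<open>Dimensions of spaces of real functions\<close>

lemma scaleR_fun_apply [simp]: "(r *\<^sub>R f) x = r *\<^sub>R f x" for f :: "'a \<Rightarrow> 'b::real_vector"
  by (simp add: scaleR_fun_def)

lemma sum_fun_apply: "(\<Sum>i\<in>A. f i) x = (\<Sum>i\<in>A. f i x)" for f :: "'i \<Rightarrow> 'a \<Rightarrow> real"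
  by (induction A rule: infinite_finite_induct) auto

lemma dim_image_inj_on:
  fixes f :: "'a::real_vector \<Rightarrow> 'b::real_vector"
  assumes lin: "linear f" and sub: "subspace S" and inj: "inj_on f S"
  shows "dim (f ` S) = dim S"
proof -
  obtain B where B: "B \<subseteq> S" "independent B" "S \<subseteq> span B" "card B = dim S"
    using basis_exists[of S] by blast
  have sp: "span B = S" using B sub span_minimal by blast
  have "independent (f ` B)"
    using linear_independent_injective_image[OF lin B(2)] inj sp by simp
  moreover have "span (f ` B) = span (f ` S)"
    using span_linear_image[OF lin] sp sub by (metis span_eq_iff)
  ultimately have "dim (f ` S) = card (f ` B)" using dim_eq_card by blast
  also have "\<dots> = card B" using inj B(1) by (meson card_image inj_on_subset)
  finally show ?thesis using B by simp
qed

lemma finite_basis_of_finite_support: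
  fixes K :: "('a \<Rightarrow> real) set"
  assumes "finite A" and supp: "\<And>f x. f \<in> K \<Longrightarrow> x \<notin> A \<Longrightarrow> f x = 0" and "independent B" "B \<subseteq> K"
  shows "finite B"
proof -
  define T where "T = (\<lambda>a x. if x = a then 1 else 0 :: real) ` A"
  have "f \<in> span T" if "f \<in> K" for f
  proof -
    have "f = (\<Sum>a\<in>A. f a *\<^sub>R (\<lambda>x. if x = a then 1 else 0))"
    proof
      fix x
      show "f x = (\<Sum>a\<in>A. f a *\<^sub>R (\<lambda>x. if x = a then 1 else 0)) x"
        using assms(1) supp[OF that, of x] by (cases "x \<in> A") (auto simp: sum_fun_apply if_distrib cong: if_cong)
    qed
    also have "\<dots> \<in> span T" by (intro span_sum span_scale span_base) (auto simp: T_def)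
    finally show ?thesis .
  qed
  then show ?thesis using independent_span_bound[of T B] assms T_def by auto
qed

text \<open>The shape of the space of data that determines a spline: finitely many independent coordinates next to
a space \<open>K\<close> that is left unspecified.\<close>

definition free_sum :: "'a set \<Rightarrow> ('b \<Rightarrow> real) set \<Rightarrow> ('a + 'b \<Rightarrow> real) set" where
  "free_sum I K = {y. (\<forall>i. i \<notin> I \<longrightarrow> y (Inl i) = 0) \<and> y \<circ> Inr \<in> K}"

lemma subspace_free_sum:
  fixes I :: "'a set" and K :: "('b \<Rightarrow> real) set"
  assumes "subspace K"
  shows "subspace (free_sum I K)"
proof -
  have c: "(x + y) \<circ> Inr = (x \<circ> Inr) + (y \<circ> Inr)" "(r *\<^sub>R x) \<circ> Inr = r *\<^sub>R (x \<circ> Inr)" "(0 :: 'a + 'b \<Rightarrow> real) \<circ> Inr = 0"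
    for x y :: "'a + 'b \<Rightarrow> real" and r by (auto simp: fun_eq_iff)
  show ?thesis unfolding subspace_def free_sum_def
    using assms by (auto simp: c subspace_0 subspace_add subspace_scale)
qed

lemma dim_free_sum:
  fixes K :: "('b \<Rightarrow> real) set"
  assumes "finite I" "subspace K" and fin: "\<And>B. independent B \<Longrightarrow> B \<subseteq> K \<Longrightarrow> finite B"
  shows "dim (free_sum (I :: 'a set) K) = card I + dim K"
proof -
  have "\<exists>B. finite B \<and> independent B \<and> span B = free_sum (I :: 'a set) K \<and> card B = card I + dim K"
    using assms(1)
  proof induction
    case empty
    define e :: "('b \<Rightarrow> real) \<Rightarrow> 'a + 'b \<Rightarrow> real" where "e f = case_sum (\<lambda>_. 0) f" for f
    have lin: "linear e" by (rule linearI) (auto simp: e_def fun_eq_iff split: sum.splits)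
    have inj: "inj e" by (auto simp: inj_on_def e_def fun_eq_iff split: sum.splits)
    obtain B where B: "B \<subseteq> K" "independent B" "K \<subseteq> span B" "card B = dim K"
      using basis_exists[of K] by blast
    have sp: "span B = K" using B assms(2) span_minimal by blast
    have "free_sum {} K = e ` K"
    proof
      show "free_sum {} K \<subseteq> e ` K"
      proof
        fix y :: "'a + 'b \<Rightarrow> real" assume "y \<in> free_sum {} K"
        then have "y = e (y \<circ> Inr)" "y \<circ> Inr \<in> K" unfolding free_sum_def e_def
          by (auto simp: fun_eq_iff split: sum.splits)
        then show "y \<in> e ` K" by blast
      qed
      have "e f \<circ> Inr = f" for f by (auto simp: e_def fun_eq_iff)
      then show "e ` K \<subseteq> free_sum {} K" unfolding free_sum_def by (auto simp: e_def)
    qed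
    moreover have "span (e ` B) = e ` K" using span_linear_image[OF lin] sp by metis
    moreover have "independent (e ` B)"
      using linear_independent_injective_image[OF lin B(2)] inj inj_on_subset by blast
    moreover have "card (e ` B) = dim K" using B inj by (metis card_image inj_on_subset subset_UNIV)
    ultimately show ?case using fin[OF B(2,1)] by (intro exI[of _ "e ` B"]) auto
  next
    case (insert i I)
    then obtain B where B: "finite B" "independent B" "span B = free_sum I K" "card B = card I + dim K"
      by blast
    define u :: "'a + 'b \<Rightarrow> real" where "u = (\<lambda>z. if z = Inl i then 1 else 0)"
    have un: "u \<notin> span B" using insert(2) unfolding B(3) free_sum_def u_def by auto
    then have "u \<notin> B" using span_base by blast
    have res: "(y - k *\<^sub>R u) \<circ> Inr = y \<circ> Inr" for y k by (auto simp: u_def fun_eq_iff)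
    have "span (insert u B) = free_sum (insert i I) K"
    proof
      show "span (insert u B) \<subseteq> free_sum (insert i I) K"
      proof (rule span_minimal)
        have "0 \<in> K" using assms(2) subspace_0 by blast
        moreover have "u \<circ> Inr = 0" by (auto simp: u_def fun_eq_iff)
        ultimately have "u \<in> free_sum (insert i I) K" unfolding free_sum_def by (auto simp: u_def)
        moreover have "free_sum I K \<subseteq> free_sum (insert i I) K" unfolding free_sum_def by auto
        ultimately show "insert u B \<subseteq> free_sum (insert i I) K" using B(3) span_superset by blast
      qed (rule subspace_free_sum[OF assms(2)])
      show "free_sum (insert i I) K \<subseteq> span (insert u B)"
      proof
        fix y assume y: "y \<in> free_sum (insert i I) K"
        have "y - y (Inl i) *\<^sub>R u \<in> free_sum I K"
          using y unfolding free_sum_def by (simp add: res) (auto simp: u_def)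
        then show "y \<in> span (insert u B)" using B(3) by (auto simp: span_insert)
      qed
    qed
    moreover have "independent (insert u B)" using independent_insert un \<open>u \<notin> B\<close> B(2) by metis
    ultimately show ?case using B insert(1,2) \<open>u \<notin> B\<close> by (intro exI[of _ "insert u B"]) auto
  qed
  then show ?thesis using dim_eq_card by (metis span_span)
qed

section \<open>Coordinates on the plane\<close>

text \<open>Horizontal and vertical directions are treated simultaneously by a Boolean \<open>ax\<close>, which is \<open>True\<close> for
the horizontal axis: \<open>pt ax s t\<close> has coordinate \<open>s\<close> along the axis and \<open>t\<close> across it.\<close>

definition pt :: "bool \<Rightarrow> real \<Rightarrow> real \<Rightarrow> point" where
  "pt ax s t = (if ax then (s, t) else (t, s))"

definition along :: "bool \<Rightarrow> point \<Rightarrow> real" where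
  "along ax p = (if ax then fst p else snd p)"

lemma along_pt [simp]: "along ax (pt ax s t) = s" "along (\<not> ax) (pt ax s t) = t"
    "along ax (pt (\<not> ax) s t) = t"
  by (auto simp: along_def pt_def)

lemma pt_along [simp]: "pt ax (along ax p) (along (\<not> ax) p) = p"
  by (auto simp: along_def pt_def)

lemma point_eq_iff: "p = q \<longleftrightarrow> along ax p = along ax q \<and> along (\<not> ax) p = along (\<not> ax) q"
  by (auto simp: along_def prod_eq_iff)

lemma pt_eq_iff [simp]: "pt ax s t = pt ax s' t' \<longleftrightarrow> s = s' \<and> t = t'"
  by (auto simp: pt_def)

lemma along_add_scaleR [simp]:
  "along ax (p + u *\<^sub>R pt ax 1 0) = along ax p + u" "along (\<not> ax) (p + u *\<^sub>R pt ax 1 0) = along (\<not> ax) p"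
  by (auto simp: along_def pt_def)

lemma continuous_on_along [continuous_intros]: "continuous_on S (along ax)"
  unfolding along_def by (cases ax) (auto intro: continuous_intros)

lemma abs_along_le_dist: "\<bar>along ax p - along ax q\<bar> \<le> dist p q"
  unfolding along_def using dist_fst_le[of p q] dist_snd_le[of p q] by (auto simp: dist_real_def)

lemma dist_pt_same [simp]: "dist (pt ax s t) (pt ax s' t) = \<bar>s - s'\<bar>" "dist (pt ax s t) (pt ax s t') = \<bar>t - t'\<bar>"
  by (auto simp: pt_def dist_Pair_Pair dist_real_def)

section \<open>Smoothness of piecewise defined functions\<close>

lemma continuous_on_glued:
  assumes "finite C" "\<And>f. f \<in> C \<Longrightarrow> closed f" "\<And>f. f \<in> C \<Longrightarrow> continuous_on UNIV (Q f)"
    and "\<And>f p. f \<in> C \<Longrightarrow> p \<in> f \<Longrightarrow> s p = Q f p"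
  shows "continuous_on (\<Union>C) s"
proof -
  have "continuous_on (\<Union>f\<in>C. f) s"
  proof (rule continuous_on_closed_Union[OF assms(1,2)])
    fix f assume f: "f \<in> C"
    have "continuous_on f (Q f)" using assms(3)[OF f] continuous_on_subset by blast
    then show "continuous_on f s" using assms(4)[OF f] by (metis (no_types, lifting) continuous_on_cong)
  qed
  then show ?thesis by simp
qed

text \<open>The cells are closed and finitely many, so points of the ray arbitrarily close to \<open>p\<close> lie in one cell
through \<open>p\<close>, and by convexity a whole initial segment does.\<close>

lemma ray_in_closed_convex_cell:
  fixes C :: "point set set"
  assumes "finite C" "\<And>f. f \<in> C \<Longrightarrow> closed f" "\<And>f. f \<in> C \<Longrightarrow> convex f" and p: "p \<in> interior (\<Union>C)"
  shows "\<exists>f\<in>C. p \<in> f \<and> (\<exists>\<epsilon>>0. \<forall>t. 0 \<le> t \<and> t \<le> \<epsilon> \<longrightarrow> p + t *\<^sub>R e \<in> f)"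
proof -
  have closD: "closed (\<Union>{f\<in>C. p \<notin> f})" using assms(1,2) by (intro closed_Union) auto
  define U where "U = interior (\<Union>C) - \<Union>{f\<in>C. p \<notin> f}"
  have "open U" unfolding U_def using closD by (intro open_Diff) auto
  moreover have "p \<in> U" unfolding U_def using p by auto
  ultimately have "\<forall>\<^sub>F q in nhds p. q \<in> U" by (simp add: eventually_nhds_in_open)
  moreover have "((\<lambda>t. p + t *\<^sub>R e) \<longlongrightarrow> p) (at_right 0)"
    by (rule tendsto_eq_intros refl | simp)+
  ultimately have "\<forall>\<^sub>F t in at_right 0. p + t *\<^sub>R e \<in> U" by (rule eventually_compose_filterlim)
  then obtain \<epsilon> where \<epsilon>: "\<epsilon> > 0" "\<And>t. 0 < t \<Longrightarrow> t < \<epsilon> \<Longrightarrow> p + t *\<^sub>R e \<in> U"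
    by (auto simp: eventually_at_right_field)
  then have "p + (\<epsilon> / 2) *\<^sub>R e \<in> U" by simp
  then obtain f where f: "f \<in> C" "p + (\<epsilon> / 2) *\<^sub>R e \<in> f" "p \<in> f"
    unfolding U_def using interior_subset by blast
  have "p + t *\<^sub>R e \<in> f" if "0 \<le> t" "t \<le> \<epsilon> / 2" for t
  proof -
    have "(1 - 2 * t / \<epsilon>) *\<^sub>R p + (2 * t / \<epsilon>) *\<^sub>R (p + (\<epsilon> / 2) *\<^sub>R e) \<in> f"
      using that \<epsilon>(1) f assms(3) by (intro convexD) (auto simp: field_simps)
    moreover have "(1 - 2 * t / \<epsilon>) *\<^sub>R p + (2 * t / \<epsilon>) *\<^sub>R (p + (\<epsilon> / 2) *\<^sub>R e) = p + t *\<^sub>R e"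
      using \<epsilon>(1) by (simp add: algebra_simps)
    ultimately show ?thesis by simp
  qed
  then show ?thesis using f \<epsilon>(1) by (intro bexI[of _ f] conjI exI[of _ "\<epsilon> / 2"]) auto
qed

text \<open>Both rays from \<open>p\<close>, in directions \<open>e\<close> and \<open>- e\<close>, start inside single cells, so each one-sided
derivative is that of a piece; both equal \<open>g p\<close>.\<close>

lemma has_real_derivative_glued:
  fixes C :: "point set set"
  assumes fin: "finite C" and clo: "\<And>f. f \<in> C \<Longrightarrow> closed f" and cvx: "\<And>f. f \<in> C \<Longrightarrow> convex f"
    and D: "\<And>f p. f \<in> C \<Longrightarrow> ((\<lambda>t. Q f (p + t *\<^sub>R e)) has_real_derivative Q' f p) (at 0)"
    and s: "\<And>f p. f \<in> C \<Longrightarrow> p \<in> f \<Longrightarrow> s p = Q f p"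
    and g: "\<And>f p. f \<in> C \<Longrightarrow> p \<in> f \<Longrightarrow> g p = Q' f p"
    and p: "p \<in> interior (\<Union>C)"
  shows "((\<lambda>t. s (p + t *\<^sub>R e)) has_real_derivative g p) (at 0)"
proof -
  obtain f \<epsilon> where f: "f \<in> C" "p \<in> f" "\<epsilon> > 0" "\<And>t. 0 \<le> t \<Longrightarrow> t \<le> \<epsilon> \<Longrightarrow> p + t *\<^sub>R e \<in> f"
    using ray_in_closed_convex_cell[OF fin clo cvx p, of e] by blast
  obtain f' \<epsilon>' where f': "f' \<in> C" "p \<in> f'" "\<epsilon>' > 0" "\<And>t. 0 \<le> t \<Longrightarrow> t \<le> \<epsilon>' \<Longrightarrow> p + t *\<^sub>R (- e) \<in> f'"
    using ray_in_closed_convex_cell[OF fin clo cvx p, of "- e"] by blast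
  have "((\<lambda>t. s (p + t *\<^sub>R e)) has_real_derivative g p) (at 0 within {0..})"
  proof (rule has_field_derivative_transform_within[of "\<lambda>t. Q f (p + t *\<^sub>R e)" _ _ _ \<epsilon>])
    show "((\<lambda>t. Q f (p + t *\<^sub>R e)) has_real_derivative g p) (at 0 within {0..})"
      using D[OF f(1), of p] g[OF f(1,2)] by (simp add: has_field_derivative_at_within)
  qed (use f s p in \<open>auto simp: dist_real_def\<close>)
  moreover have "((\<lambda>t. s (p + t *\<^sub>R e)) has_real_derivative g p) (at 0 within {..0})"
  proof (rule has_field_derivative_transform_within[of "\<lambda>t. Q f' (p + t *\<^sub>R e)" _ _ _ \<epsilon>'])
    show "((\<lambda>t. Q f' (p + t *\<^sub>R e)) has_real_derivative g p) (at 0 within {..0})"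
      using D[OF f'(1), of p] g[OF f'(1,2)] by (simp add: has_field_derivative_at_within)
    fix t :: real assume t: "t \<in> {..0}" "dist t 0 < \<epsilon>'"
    then have "p + (- t) *\<^sub>R (- e) \<in> f'" by (intro f') (auto simp: dist_real_def)
    then show "Q f' (p + t *\<^sub>R e) = s (p + t *\<^sub>R e)" using s[OF f'(1)] by simp
  qed (use f' s in \<open>auto simp: dist_real_def\<close>)
  ultimately show ?thesis
    unfolding has_field_derivative_iff
    unfolding filterlim_at_split
    by (auto intro: tendsto_within_subset[of _ _ _ "{0..}"] tendsto_within_subset[of _ _ _ "{..0}"])
qed

lemma cont_order_imp_continuous_on: "cont_order k e S s \<Longrightarrow> continuous_on S s"
  by (cases k) auto

text \<open>Inside a cell the derivative of the glued function is that of the piece, and continuity of the extension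
carries this to the whole closed cell; so the derivatives of the pieces agree at common points.
Conversely, agreeing derivatives glue to a continuous function that is the derivative.\<close>

lemma cont_order_glued_iff:
  fixes C :: "point set set"
  assumes fin: "finite C" and clo: "\<And>f. f \<in> C \<Longrightarrow> closed f" and cvx: "\<And>f. f \<in> C \<Longrightarrow> convex f"
    and reg: "\<And>f. f \<in> C \<Longrightarrow> f \<subseteq> closure (interior f)"
    and "\<And>j f. f \<in> C \<Longrightarrow> continuous_on UNIV (Q j f)"
    and "\<And>j f p. f \<in> C \<Longrightarrow> ((\<lambda>t. Q j f (p + t *\<^sub>R e)) has_real_derivative Q (Suc j) f p) (at 0)"
    and "\<And>f p. f \<in> C \<Longrightarrow> p \<in> f \<Longrightarrow> s p = Q 0 f p"
  shows "cont_order k e (\<Union>C) s \<longleftrightarrow> (\<forall>j\<le>k. \<forall>f\<in>C. \<forall>g\<in>C. \<forall>p\<in>f \<inter> g. Q j f p = Q j g p)"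
  using assms(5-7)
proof (induction k arbitrary: s Q)
  case 0
  have "continuous_on (\<Union>C) s" using 0 by (intro continuous_on_glued[OF fin clo, of "Q 0"]) auto
  moreover have "Q 0 f p = Q 0 g p" if "f \<in> C" "g \<in> C" "p \<in> f" "p \<in> g" for f g p
    using 0(3)[of f p] 0(3)[of g p] that by simp
  ultimately show ?case unfolding cont_order.simps le_zero_eq by blast
next
  case (Suc k)
  have cont: "continuous_on (\<Union>C) s" using Suc.prems by (intro continuous_on_glued[OF fin clo, of "Q 0"]) auto
  have Q0: "Q 0 f p = Q 0 g p" if "f \<in> C" "g \<in> C" "p \<in> f" "p \<in> g" for f g p
    using Suc.prems(3)[of f p] Suc.prems(3)[of g p] that by simp
  have IH: "cont_order k e (\<Union>C) g \<longleftrightarrow> (\<forall>j\<le>k. \<forall>f\<in>C. \<forall>h\<in>C. \<forall>p\<in>f \<inter> h. Q (Suc j) f p = Q (Suc j) h p)"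
    if "\<And>f p. f \<in> C \<Longrightarrow> p \<in> f \<Longrightarrow> g p = Q (Suc 0) f p" for g
    using Suc.IH[of "\<lambda>j. Q (Suc j)" g, OF Suc.prems(1) Suc.prems(2) that] by simp
  show ?case
  proof
    assume "cont_order (Suc k) e (\<Union>C) s"
    then obtain g where g: "\<And>p. p \<in> interior (\<Union>C) \<Longrightarrow> ((\<lambda>t. s (p + t *\<^sub>R e)) has_real_derivative g p) (at 0)"
      and gk: "cont_order k e (\<Union>C) g" by auto
    have int: "g p = Q (Suc 0) f p" if fp: "f \<in> C" "p \<in> interior f" for f p
    proof -
      have "p \<in> interior (\<Union>C)" using fp by (meson Union_upper interior_mono subsetD)
      then have "((\<lambda>t. s (p + t *\<^sub>R e)) has_real_derivative g p) (at 0)" using g by blast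
      moreover have "((\<lambda>t. s (p + t *\<^sub>R e)) has_real_derivative Q (Suc 0) f p) (at 0)"
      proof (rule has_field_derivative_transform_within_open[of "\<lambda>t. Q 0 f (p + t *\<^sub>R e)" _ _ "(\<lambda>t. p + t *\<^sub>R e) -` interior f"])
        show "open ((\<lambda>t. p + t *\<^sub>R e) -` interior f)" by (intro open_vimage open_interior continuous_intros)
        show "((\<lambda>t. Q 0 f (p + t *\<^sub>R e)) has_real_derivative Q (Suc 0) f p) (at 0)"
          using Suc.prems(2)[OF fp(1)] by blast
        show "Q 0 f (p + t *\<^sub>R e) = s (p + t *\<^sub>R e)" if "t \<in> (\<lambda>t. p + t *\<^sub>R e) -` interior f" for t
          using Suc.prems(3)[OF fp(1), of "p + t *\<^sub>R e"] that interior_subset[of f] by auto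
      qed (use fp in simp)
      ultimately show ?thesis by (rule DERIV_unique)
    qed
    have all: "g p = Q (Suc 0) f p" if fp: "f \<in> C" "p \<in> f" for f p
    proof -
      have sub: "closure (interior f) \<subseteq> f" using clo[OF fp(1)] by (simp add: closure_minimal interior_subset)
      have "continuous_on f g" using cont_order_imp_continuous_on[OF gk] fp(1) continuous_on_subset by blast
      then have "continuous_on (closure (interior f)) (\<lambda>p. g p - Q (Suc 0) f p)"
        using Suc.prems(1)[OF fp(1), of "Suc 0"] sub
        by (intro continuous_on_diff) (auto intro: continuous_on_subset)
      then have "g p - Q (Suc 0) f p = 0"
        by (rule continuous_constant_on_closure) (use int[OF fp(1)] fp(2) reg[OF fp(1)] in auto)
      then show ?thesis by simp
    qed
    show "\<forall>j\<le>Suc k. \<forall>f\<in>C. \<forall>g\<in>C. \<forall>p\<in>f \<inter> g. Q j f p = Q j g p"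
    proof (intro allI impI ballI)
      fix j f h p assume *: "j \<le> Suc k" "f \<in> C" "h \<in> C" "p \<in> f \<inter> h"
      show "Q j f p = Q j h p"
      proof (cases j)
        case 0
        then show ?thesis using * Q0[of f h p] by simp
      next
        case (Suc i)
        then show ?thesis using * gk IH[of g] all by blast
      qed
    qed
  next
    assume R: "\<forall>j\<le>Suc k. \<forall>f\<in>C. \<forall>g\<in>C. \<forall>p\<in>f \<inter> g. Q j f p = Q j g p"
    define g where "g p = Q (Suc 0) (SOME f. f \<in> C \<and> p \<in> f) p" for p
    have g: "g p = Q (Suc 0) f p" if "f \<in> C" "p \<in> f" for f p
    proof -
      have "(SOME f. f \<in> C \<and> p \<in> f) \<in> C \<and> p \<in> (SOME f. f \<in> C \<and> p \<in> f)"
        by (rule someI_ex) (use that in auto)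
      then show ?thesis unfolding g_def using R that by (intro R[rule_format]) auto
    qed
    have "((\<lambda>t. s (p + t *\<^sub>R e)) has_real_derivative g p) (at 0)" if p: "p \<in> interior (\<Union>C)" for p
      by (rule has_real_derivative_glued[OF fin clo cvx _ _ _ p, of "Q 0" e "Q (Suc 0)" s g])
        (assumption | rule Suc.prems(2) Suc.prems(3) g)+
    moreover have "cont_order k e (\<Union>C) g"
    proof (rule iffD2[OF IH[of g, OF g]])
      show "\<forall>j\<le>k. \<forall>f\<in>C. \<forall>h\<in>C. \<forall>p\<in>f \<inter> h. Q (Suc j) f p = Q (Suc j) h p"
        using R Suc_le_mono by blast
    qed
    ultimately show "cont_order (Suc k) e (\<Union>C) s" using cont unfolding cont_order.simps by blast
  qed
qed

section \<open>Polynomials with a root of maximal order\<close>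

text \<open>The \<open>j\<close>-th derivative of the \<open>n\<close>-th power.\<close>

primrec power_deriv :: "nat \<Rightarrow> nat \<Rightarrow> real \<Rightarrow> real" where
  "power_deriv 0 n x = x ^ n"
| "power_deriv (Suc j) n x = real n * power_deriv j (n - 1) x"

lemma DERIV_power_deriv [derivative_intros]:
  assumes "(g has_real_derivative g') (at x within S)"
  shows "((\<lambda>x. power_deriv j n (g x)) has_real_derivative power_deriv (Suc j) n (g x) * g') (at x within S)"
proof -
  have "(power_deriv j n has_real_derivative power_deriv (Suc j) n x) (at x)" for x
  proof (induction j arbitrary: n)
    case 0
    have "power_deriv 0 n = (\<lambda>x. x ^ n)" by auto
    then show ?case by (auto intro!: derivative_eq_intros)
  next
    case (Suc j)
    have "power_deriv (Suc j) n = (\<lambda>x. real n * power_deriv j (n - 1) x)" by auto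
    then show ?case using DERIV_cmult[OF Suc[of "n - 1"], of "real n"] by simp
  qed
  then show ?thesis using DERIV_chain2 assms by blast
qed

lemma continuous_on_power_deriv [continuous_intros]:
  assumes "continuous_on S g" shows "continuous_on S (\<lambda>x. power_deriv j n (g x))"
proof -
  have "continuous_on UNIV (power_deriv j n)"
    using DERIV_power_deriv[OF DERIV_ident] by (metis DERIV_continuous_on UNIV_I DERIV_isCont continuous_at_imp_continuous_on)
  then show ?thesis using assms continuous_on_compose2[of UNIV "power_deriv j n"] by blast
qed

lemma power_deriv_top: "n \<le> d \<Longrightarrow> power_deriv d n x = (if n = d then fact d else 0)"
proof (induction d arbitrary: n)
  case (Suc d)
  show ?case
  proof (cases n)
    case (Suc m)
    then show ?thesis using Suc.IH[of m] Suc.prems by auto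
  qed auto
qed auto

lemma power_deriv_zero: "j < n \<Longrightarrow> power_deriv j n 0 = 0"
  by (induction j arbitrary: n) auto

text \<open>The coefficient of \<open>x ^ n\<close> in \<open>(x - t) ^ d\<close>.\<close>

definition beta :: "nat \<Rightarrow> real \<Rightarrow> nat \<Rightarrow> real" where
  "beta d t n = real (d choose n) * (- t) ^ (d - n)"

lemma beta_top [simp]: "beta d t d = 1"
  by (simp add: beta_def)

lemma sum_beta: "(\<Sum>n\<le>d. beta d t n * x ^ n) = (x - t) ^ d"
  using binomial_ring[of x "- t" d] by (simp add: beta_def mult_ac)

lemma sum_beta_power_deriv: "(\<Sum>n\<le>d. beta d t n * power_deriv j n x) = power_deriv j d (x - t)"
proof (induction j arbitrary: x)
  case 0
  then show ?case by (simp add: sum_beta)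
next
  case (Suc j)
  have "((\<lambda>x. \<Sum>n\<le>d. beta d t n * power_deriv j n x) has_real_derivative (\<Sum>n\<le>d. beta d t n * power_deriv (Suc j) n x)) (at x)"
    by (auto intro!: derivative_eq_intros sum.cong simp del: power_deriv.simps)
  moreover have "((\<lambda>x. \<Sum>n\<le>d. beta d t n * power_deriv j n x) has_real_derivative power_deriv (Suc j) d (x - t)) (at x)"
    unfolding Suc by (auto intro!: derivative_eq_intros simp del: power_deriv.simps)
  ultimately show ?case by (rule DERIV_unique)
qed

text \<open>A polynomial of degree at most \<open>d\<close> with a root of order \<open>d\<close> at \<open>t\<close> is a multiple of \<open>(x - t) ^ d\<close>:
in its Taylor formula at \<open>t\<close> with remainder of order \<open>d\<close> only the remainder is left, and the
\<open>d\<close>-th derivative is constant.\<close>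

lemma root_of_maximal_order:
  assumes "d \<ge> 1" and van: "\<And>j. j < d \<Longrightarrow> (\<Sum>n\<le>d. a n * power_deriv j n t) = 0" and "n \<le> d"
  shows "a n = a d * beta d t n"
proof -
  define D where "D j x = (\<Sum>n\<le>d. a n * power_deriv j n x)" for j x
  have D': "(D j has_real_derivative D (Suc j) x) (at x)" for j x
    unfolding D_def by (auto intro!: derivative_eq_intros sum.cong simp del: power_deriv.simps)
  have Dd: "D d x = a d * fact d" for x
    unfolding D_def by (simp add: power_deriv_top if_distrib cong: if_cong)
  have "(\<Sum>n\<le>d. a n * x ^ n) = (\<Sum>n\<le>d. a d * beta d t n * x ^ n)" for x
  proof (cases "x = t")
    case True
    have "(\<Sum>n\<le>d. a n * t ^ n) = 0" using van[of 0] assms(1) by simp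
    moreover have "(\<Sum>n\<le>d. a d * beta d t n * t ^ n) = a d * (\<Sum>n\<le>d. beta d t n * t ^ n)"
      by (simp add: sum_distrib_left mult_ac)
    ultimately show ?thesis using assms(1) True by (simp add: sum_beta)
  next
    case False
    have "\<exists>\<xi>. (if x < t then x < \<xi> \<and> \<xi> < t else t < \<xi> \<and> \<xi> < x) \<and>
        D 0 x = (\<Sum>m<d. D m t / fact m * (x - t) ^ m) + D d \<xi> / fact d * (x - t) ^ d"
      using assms(1) False D'
      by (intro Taylor[of d D "D 0" "min x t" "max x t" t x]) auto
    then have "D 0 x = (\<Sum>m<d. D m t / fact m * (x - t) ^ m) + a d * (x - t) ^ d"
      by (auto simp: Dd)
    moreover have "(\<Sum>m<d. D m t / fact m * (x - t) ^ m) = 0"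
      using van unfolding D_def by (intro sum.neutral) auto
    ultimately have "D 0 x = a d * (\<Sum>n\<le>d. beta d t n * x ^ n)" by (simp add: sum_beta)
    then show ?thesis unfolding D_def by (simp add: sum_distrib_left mult_ac)
  qed
  then show ?thesis using polyfun_eq_coeffs[of a d "\<lambda>n. a d * beta d t n"] assms(3) by blast
qed

lemma polyfun_zero_on_interval:
  assumes "a < b" "\<And>x. a \<le> x \<Longrightarrow> x \<le> b \<Longrightarrow> (\<Sum>i\<le>n. c i * x ^ i) = (0::real)" "i \<le> n"
  shows "c i = 0"
proof (rule ccontr)
  assume "c i \<noteq> 0"
  then have "finite {x. (\<Sum>i\<le>n. c i * x ^ i) = 0}" using polyfun_finite_roots[of c n] assms(3) by blast
  moreover have "{a..b} \<subseteq> {x. (\<Sum>i\<le>n. c i * x ^ i) = 0}" using assms(2) by auto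
  ultimately show False using assms(1) infinite_Icc finite_subset by blast
qed

section \<open>Coefficients of piecewise polynomials\<close>

type_synonym coeffs = "point set \<times> nat \<times> nat \<Rightarrow> real"

text \<open>The exponent \<open>m\<close> belongs to the variable along the axis, \<open>n\<close> to the one across it.\<close>

definition coeff_along :: "bool \<Rightarrow> coeffs \<Rightarrow> point set \<Rightarrow> nat \<Rightarrow> nat \<Rightarrow> real" where
  "coeff_along ax c f m n = (if ax then c (f, m, n) else c (f, n, m))"

lemma coeff_along_not: "coeff_along (\<not> ax) c f m n = coeff_along ax c f n m"
  by (simp add: coeff_along_def)

text \<open>The \<open>j\<close>-th partial derivative along the axis of the polynomial on \<open>f\<close>.\<close>

definition piece_deriv :: "nat \<Rightarrow> bool \<Rightarrow> nat \<Rightarrow> coeffs \<Rightarrow> point set \<Rightarrow> point \<Rightarrow> real" where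
  "piece_deriv d ax j c f p = (\<Sum>m\<le>d. \<Sum>n\<le>d. coeff_along ax c f m n * power_deriv j m (along ax p) * along (\<not> ax) p ^ n)"

definition piece :: "nat \<Rightarrow> coeffs \<Rightarrow> point set \<Rightarrow> point \<Rightarrow> real" where
  "piece d c f p = (\<Sum>i\<le>d. \<Sum>j\<le>d. c (f, i, j) * fst p ^ i * snd p ^ j)"

lemma piece_deriv_0: "piece_deriv d ax 0 c f p = piece d c f p"
proof (cases ax)
  case True
  then show ?thesis by (simp add: piece_deriv_def piece_def coeff_along_def along_def)
next
  case False
  have "piece_deriv d ax 0 c f p = (\<Sum>j\<le>d. \<Sum>i\<le>d. c (f, i, j) * fst p ^ i * snd p ^ j)"
    using False by (auto simp: piece_deriv_def coeff_along_def along_def mult_ac intro!: sum.cong)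
  then show ?thesis unfolding piece_def using sum.swap[of "\<lambda>j i. c (f, i, j) * fst p ^ i * snd p ^ j"] by simp
qed

lemma DERIV_piece_deriv:
  "((\<lambda>u. piece_deriv d ax j c f (p + u *\<^sub>R pt ax 1 0)) has_real_derivative piece_deriv d ax (Suc j) c f p) (at 0)"
  unfolding piece_deriv_def by (auto intro!: derivative_eq_intros sum.cong simp del: power_deriv.simps)

lemma continuous_on_piece_deriv: "continuous_on S (piece_deriv d ax j c f)"
  unfolding piece_deriv_def by (intro continuous_intros)

text \<open>The polynomials on \<open>f\<close> and \<open>g\<close> differ by the \<open>d\<close>-th power of the signed distance to a line parallel to
the axis, times a polynomial in the variable along it.  As \<open>beta d t d = 1\<close>, the coefficients of that
cofactor are the differences of the coefficients with exponent \<open>d\<close> across the axis.\<close>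

definition smooth_jump :: "nat \<Rightarrow> bool \<Rightarrow> real \<Rightarrow> coeffs \<Rightarrow> point set \<Rightarrow> point set \<Rightarrow> bool" where
  "smooth_jump d ax t c f g \<longleftrightarrow>
     (\<forall>m\<le>d. \<forall>n\<le>d. coeff_along ax c f m n - coeff_along ax c g m n = beta d t n * (coeff_along ax c f m d - coeff_along ax c g m d))"

lemma piece_deriv_diff:
  "piece_deriv d ax j c f p - piece_deriv d ax j c g p =
    (\<Sum>m\<le>d. \<Sum>n\<le>d. (coeff_along ax c f m n - coeff_along ax c g m n) * power_deriv j m (along ax p) * along (\<not> ax) p ^ n)"
  unfolding piece_deriv_def by (simp add: sum_subtractf left_diff_distrib)

text \<open>Derivatives along the line vanish on it because of the factor \<open>(t - t) ^ d\<close>; derivatives of order below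
\<open>d\<close> across the line leave a positive power of this factor.\<close>

lemma smooth_jump_imp_deriv_eq:
  assumes sj: "smooth_jump d ax t c f g" and p: "along (\<not> ax) p = t" and j: "j < d"
  shows "piece_deriv d ax j c f p = piece_deriv d ax j c g p" "piece_deriv d (\<not> ax) j c f p = piece_deriv d (\<not> ax) j c g p"
proof -
  have "(\<Sum>n\<le>d. (coeff_along ax c f m n - coeff_along ax c g m n) * power_deriv j m (along ax p) * t ^ n) = 0" if m: "m \<le> d" for m
  proof -
    define e where "e = coeff_along ax c f m d - coeff_along ax c g m d"
    have J: "coeff_along ax c f m n - coeff_along ax c g m n = beta d t n * e" if "n \<le> d" for n
      using sj m that unfolding smooth_jump_def e_def by blast
    have "(\<Sum>n\<le>d. (coeff_along ax c f m n - coeff_along ax c g m n) * power_deriv j m (along ax p) * t ^ n)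
      = (\<Sum>n\<le>d. e * power_deriv j m (along ax p) * (beta d t n * t ^ n))"
      by (intro sum.cong refl) (simp add: J mult_ac)
    also have "\<dots> = e * power_deriv j m (along ax p) * (t - t) ^ d"
      by (simp only: sum_distrib_left[symmetric] sum_beta)
    finally show ?thesis using j by simp
  qed
  then show "piece_deriv d ax j c f p = piece_deriv d ax j c g p"
    using piece_deriv_diff[of d ax j c f p g] p by simp
  have "(\<Sum>n\<le>d. (coeff_along ax c f m n - coeff_along ax c g m n) * power_deriv j n t * along ax p ^ m) = 0" if m: "m \<le> d" for m
  proof -
    define e where "e = coeff_along ax c f m d - coeff_along ax c g m d"
    have J: "coeff_along ax c f m n - coeff_along ax c g m n = beta d t n * e" if "n \<le> d" for n
      using sj m that unfolding smooth_jump_def e_def by blast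
    have "(\<Sum>n\<le>d. (coeff_along ax c f m n - coeff_along ax c g m n) * power_deriv j n t * along ax p ^ m)
      = (\<Sum>n\<le>d. e * along ax p ^ m * (beta d t n * power_deriv j n t))"
      by (intro sum.cong refl) (simp add: J mult_ac)
    also have "\<dots> = e * along ax p ^ m * power_deriv j d (t - t)"
      by (simp only: sum_distrib_left[symmetric] sum_beta_power_deriv)
    finally show ?thesis using j by (simp add: power_deriv_zero)
  qed
  then have "(\<Sum>n\<le>d. \<Sum>m\<le>d. (coeff_along ax c f m n - coeff_along ax c g m n) * power_deriv j n t * along ax p ^ m) = 0"
    by (subst sum.swap) simp
  then show "piece_deriv d (\<not> ax) j c f p = piece_deriv d (\<not> ax) j c g p"
    using piece_deriv_diff[of d "\<not> ax" j c f p g] p by (simp add: coeff_along_not)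
qed

text \<open>For each fixed point of the segment the difference is a polynomial in the transversal variable with a
root of order \<open>d\<close>; comparing coefficients over infinitely many points gives the identity of coefficients.\<close>

lemma deriv_eq_imp_smooth_jump:
  assumes d: "d \<ge> 1" and "a < b"
    and eq: "\<And>s j. a \<le> s \<Longrightarrow> s \<le> b \<Longrightarrow> j < d \<Longrightarrow> piece_deriv d (\<not> ax) j c f (pt ax s t) = piece_deriv d (\<not> ax) j c g (pt ax s t)"
  shows "smooth_jump d ax t c f g"
  unfolding smooth_jump_def
proof (intro allI impI)
  fix m n assume mn: "m \<le> d" "n \<le> d"
  define \<Delta> where "\<Delta> m n = coeff_along ax c f m n - coeff_along ax c g m n" for m n
  have "(\<Sum>m\<le>d. (\<Delta> m n - beta d t n * \<Delta> m d) * s ^ m) = 0" if s: "a \<le> s" "s \<le> b" for s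
  proof -
    have "(\<Sum>n\<le>d. (\<Sum>m\<le>d. \<Delta> m n * s ^ m) * power_deriv j n t) = 0" if "j < d" for j
      using eq[OF s that] piece_deriv_diff[of d "\<not> ax" j c f "pt ax s t" g]
      by (simp add: coeff_along_not \<Delta>_def sum_distrib_left sum_distrib_right mult_ac)
    then have "(\<Sum>m\<le>d. \<Delta> m n * s ^ m) = (\<Sum>m\<le>d. \<Delta> m d * s ^ m) * beta d t n"
      using root_of_maximal_order[OF d, of "\<lambda>n. \<Sum>m\<le>d. \<Delta> m n * s ^ m" t n] mn by blast
    then show ?thesis by (simp add: sum_subtractf left_diff_distrib right_diff_distrib sum_distrib_left sum_distrib_right mult_ac)
  qed
  then have "\<Delta> m n - beta d t n * \<Delta> m d = 0"
    using polyfun_zero_on_interval[OF assms(2), of "\<lambda>m. \<Delta> m n - beta d t n * \<Delta> m d" d m] mn by blast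
  then show "coeff_along ax c f m n - coeff_along ax c g m n = beta d t n * (coeff_along ax c f m d - coeff_along ax c g m d)"
    unfolding \<Delta>_def by simp
qed

section \<open>Axis-parallel segments and rectangles\<close>

definition seg :: "bool \<Rightarrow> real \<Rightarrow> real \<Rightarrow> real \<Rightarrow> point set" where
  "seg ax t a b = {p. along (\<not> ax) p = t \<and> a \<le> along ax p \<and> along ax p \<le> b}"

lemma pt_in_seg [simp]: "pt ax s t' \<in> seg ax t a b \<longleftrightarrow> t' = t \<and> a \<le> s \<and> s \<le> b"
  by (auto simp: seg_def)

lemma closed_segment_pt:
  assumes "a \<le> b" shows "closed_segment (pt ax a t) (pt ax b t) = seg ax t a b"
proof (cases "a = b")
  case True
  then show ?thesis by (auto simp: seg_def point_eq_iff[of _ "pt ax b t" ax])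
next
  case False
  show ?thesis
  proof
    show "closed_segment (pt ax a t) (pt ax b t) \<subseteq> seg ax t a b"
    proof
      fix p assume "p \<in> closed_segment (pt ax a t) (pt ax b t)"
      then obtain u where u: "0 \<le> u" "u \<le> 1" "p = (1 - u) *\<^sub>R pt ax a t + u *\<^sub>R pt ax b t"
        unfolding in_segment by blast
      have "along ax p = a + u * (b - a)" "along (\<not> ax) p = t"
        unfolding u(3) by (auto simp: pt_def along_def algebra_simps)
      moreover have "u * (b - a) \<le> 1 * (b - a)" using u assms by (intro mult_right_mono) auto
      ultimately show "p \<in> seg ax t a b" using u assms by (auto simp: seg_def)
    qed
    show "seg ax t a b \<subseteq> closed_segment (pt ax a t) (pt ax b t)"
    proof
      fix p assume p: "p \<in> seg ax t a b"
      define u where "u = (along ax p - a) / (b - a)"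
      have ab: "b - a > 0" using False assms by simp
      have "0 \<le> u" "u \<le> 1" using p ab unfolding u_def seg_def by (auto simp: field_simps)
      moreover have "p = (1 - u) *\<^sub>R pt ax a t + u *\<^sub>R pt ax b t"
      proof -
        have "u * (b - a) = along ax p - a" unfolding u_def using ab by simp
        then show ?thesis using p unfolding point_eq_iff[of p _ ax] seg_def
          by (auto simp: pt_def along_def algebra_simps)
      qed
      ultimately show "p \<in> closed_segment (pt ax a t) (pt ax b t)" unfolding in_segment by blast
    qed
  qed
qed

lemma horizontal_iff: "horizontal l \<longleftrightarrow> (\<exists>a b t. a < b \<and> l = seg True t a b)"
  unfolding horizontal_def using closed_segment_pt[of _ _ True] by (metis less_imp_le pt_def)

lemma vertical_iff: "vertical l \<longleftrightarrow> (\<exists>a b t. a < b \<and> l = seg False t a b)"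
  unfolding vertical_def using closed_segment_pt[of _ _ False] by (metis less_imp_le pt_def)

lemma endpoints_seg: "a < b \<Longrightarrow> endpoints (seg ax t a b) = {pt ax a t, pt ax b t}"
  unfolding endpoints_def closed_segment_pt[of a b ax t, symmetric, OF less_imp_le]
  by (auto simp: extreme_point_of_segment)

lemma compact_seg: "compact (seg ax t a b)"
proof (cases "a \<le> b")
  case False
  then have "seg ax t a b = {}" by (auto simp: seg_def)
  then show ?thesis by simp
qed (simp add: closed_segment_pt[symmetric])

lemma connected_seg: "connected (seg ax t a b)"
proof (cases "a \<le> b")
  case False
  then have "seg ax t a b = {}" by (auto simp: seg_def)
  then show ?thesis by simp
qed (simp add: closed_segment_pt[symmetric])

lemma seg_direction:
  assumes "seg ax t a b \<subseteq> seg ax' t' a' b'" "a < b"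
  shows "ax' = ax \<and> t' = t \<and> a' \<le> a \<and> b \<le> b'"
proof -
  have "pt ax a t \<in> seg ax' t' a' b'" "pt ax b t \<in> seg ax' t' a' b'" using assms by auto
  then show ?thesis using assms(2) by (cases ax; cases ax') (auto simp: seg_def pt_def along_def)
qed

lemma seg_eq_iff:
  assumes "a < b" "a' < b'"
  shows "seg ax t a b = seg ax' t' a' b' \<longleftrightarrow> ax = ax' \<and> t = t' \<and> a = a' \<and> b = b'"
  using seg_direction[of ax t a b ax' t' a' b'] seg_direction[of ax' t' a' b' ax t a b] assms by auto

definition lo :: "bool \<Rightarrow> point set \<Rightarrow> real" where "lo ax f = Inf (along ax ` f)"
definition hi :: "bool \<Rightarrow> point set \<Rightarrow> real" where "hi ax f = Sup (along ax ` f)"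

lemma rectangle_bounds:
  assumes "rectangle f"
  shows "lo ax f < hi ax f"
    and "p \<in> f \<longleftrightarrow> lo ax f \<le> along ax p \<and> along ax p \<le> hi ax f \<and> lo (\<not> ax) f \<le> along (\<not> ax) p \<and> along (\<not> ax) p \<le> hi (\<not> ax) f"
    and "p \<in> interior f \<longleftrightarrow> lo ax f < along ax p \<and> along ax p < hi ax f \<and> lo (\<not> ax) f < along (\<not> ax) p \<and> along (\<not> ax) p < hi (\<not> ax) f"
    and "closed f" "compact f" "convex f" "f \<noteq> {}" "f \<subseteq> closure (interior f)"
proof -
  obtain a b c e where *: "a < b" "c < e" "f = {a..b} \<times> {c..e}" using assms unfolding rectangle_def by blast
  have im: "along True ` f = {a..b}" "along False ` f = {c..e}" using * unfolding along_def by auto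
  have v: "lo True f = a" "hi True f = b" "lo False f = c" "hi False f = e"
    unfolding lo_def hi_def im using * by auto
  have box: "f = cbox (a, c) (b, e)" using * by (auto simp: cbox_Pair_eq)
  show "lo ax f < hi ax f" using v * by (cases ax) auto
  show "p \<in> f \<longleftrightarrow> lo ax f \<le> along ax p \<and> along ax p \<le> hi ax f \<and> lo (\<not> ax) f \<le> along (\<not> ax) p \<and> along (\<not> ax) p \<le> hi (\<not> ax) f"
    using v * by (cases ax; cases p) (auto simp: along_def)
  have i: "interior f = {a<..<b} \<times> {c<..<e}" unfolding *(3) interior_Times by simp
  show "p \<in> interior f \<longleftrightarrow> lo ax f < along ax p \<and> along ax p < hi ax f \<and> lo (\<not> ax) f < along (\<not> ax) p \<and> along (\<not> ax) p < hi (\<not> ax) f"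
    unfolding i using v * by (cases ax; cases p) (auto simp: along_def)
  show "closed f" "compact f" "convex f" unfolding box by (rule closed_cbox compact_cbox convex_box)+
  show "f \<noteq> {}" using * by simp
  show "f \<subseteq> closure (interior f)" unfolding i closure_Times using * by simp
qed

lemma frontier_rectangle:
  assumes "rectangle f" shows "p \<in> frontier f \<longleftrightarrow> p \<in> f \<and> p \<notin> interior f"
  using rectangle_bounds(4)[OF assms] by (simp add: frontier_def)

lemma segment_on_frontier:
  assumes f: "rectangle f" and ab: "a < b" and sub: "seg ax t a b \<subseteq> frontier f"
  shows "(t = lo (\<not> ax) f \<or> t = hi (\<not> ax) f) \<and> lo ax f \<le> a \<and> b \<le> hi ax f"
proof -
  have "pt ax a t \<in> frontier f" "pt ax b t \<in> frontier f" "pt ax ((a + b) / 2) t \<in> frontier f"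
    using sub ab by auto
  then show ?thesis unfolding frontier_rectangle[OF f] rectangle_bounds(2,3)[OF f, where ax = ax]
    using ab by auto
qed

lemma finite_gap_right:
  fixes s b :: real
  assumes "finite A" "s < b" shows "\<exists>s'. s < s' \<and> s' < b \<and> (\<forall>x\<in>A. s < x \<longrightarrow> s' < x)"
  using assms(1)
proof induction
  case empty
  then show ?case using dense[OF assms(2)] by blast
next
  case (insert x A)
  then obtain s' where s': "s < s'" "s' < b" "\<forall>x\<in>A. s < x \<longrightarrow> s' < x" by blast
  show ?case
  proof (cases "s < x")
    case True
    then obtain z where "s < z" "z < min s' x" using dense[of s "min s' x"] s' by auto
    then show ?thesis using s' by (intro exI[of _ z]) force
  qed (use s' in auto)
qed

lemma finite_gap_left:
  fixes s a :: real
  assumes "finite A" "a < s" shows "\<exists>s'. a < s' \<and> s' < s \<and> (\<forall>x\<in>A. x < s \<longrightarrow> x < s')"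
proof -
  obtain z where "- s < z" "z < - a" "\<forall>x\<in>uminus ` A. - s < x \<longrightarrow> z < x"
    using finite_gap_right[of "uminus ` A" "- s" "- a"] assms by auto
  then show ?thesis by (intro exI[of _ "- z"]) force
qed

text \<open>A nondegenerate segment fixes the line of every collinear set containing it.\<close>

lemma collinear_contains_seg:
  assumes "collinear l" "seg ax t a b \<subseteq> l" "a < b" "p \<in> l"
  shows "along (\<not> ax) p = t"
proof -
  obtain u where u: "\<And>x y. x \<in> l \<Longrightarrow> y \<in> l \<Longrightarrow> \<exists>c. x - y = c *\<^sub>R u"
    using assms(1) unfolding collinear_def by blast
  have in_l: "pt ax a t \<in> l" "pt ax b t \<in> l" using assms by auto
  obtain c where c: "pt ax b t - pt ax a t = c *\<^sub>R u" using u in_l by blast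
  obtain c' where c': "p - pt ax a t = c' *\<^sub>R u" using u in_l assms(4) by blast
  have lin: "along ax' (x - y) = along ax' x - along ax' y" "along ax' (k *\<^sub>R x) = k * along ax' x" for ax' x y k
    by (auto simp: along_def)
  have "b - a = c * along ax u" "0 = c * along (\<not> ax) u"
    using arg_cong[OF c, of "along ax"] arg_cong[OF c, of "along (\<not> ax)"] by (simp_all add: lin)
  then have "along (\<not> ax) u = 0" using assms(3) by auto
  then show ?thesis using arg_cong[OF c', of "along (\<not> ax)"] by (simp add: lin)
qed

lemma collinear_seg: "collinear (seg ax t a b)"
  unfolding collinear_def
proof (intro exI[of _ "pt ax 1 0"] ballI)
  fix x y assume "x \<in> seg ax t a b" "y \<in> seg ax t a b"
  then have "x - y = (along ax x - along ax y) *\<^sub>R pt ax 1 0"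
    by (auto simp: seg_def along_def pt_def prod_eq_iff split: if_splits)
  then show "\<exists>c. x - y = c *\<^sub>R pt ax 1 0" by blast
qed

section \<open>Cells around a point of a T-mesh\<close>

text \<open>For \<open>q\<close> in the rectangle \<open>f\<close>: one can move from \<open>q\<close> a little inside \<open>f\<close>, in the positive
direction of the axis if \<open>r\<close> holds and in the negative one otherwise.\<close>

definition extends :: "bool \<Rightarrow> bool \<Rightarrow> point set \<Rightarrow> point \<Rightarrow> bool" where
  "extends ax r f q \<longleftrightarrow> (if r then along ax q < hi ax f else lo ax f < along ax q)"

text \<open>The two rectangles share a nondegenerate segment parallel to the axis, with \<open>f\<close> on its positive side
across the axis and \<open>g\<close> on the negative one.\<close>

definition above :: "bool \<Rightarrow> point set \<Rightarrow> point set \<Rightarrow> bool" where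
  "above ax f g \<longleftrightarrow> hi (\<not> ax) g = lo (\<not> ax) f \<and> lo ax f < hi ax g \<and> lo ax g < hi ax f"

locale T_mesh =
  fixes M :: mesh
  assumes tmesh: "tmesh M"
begin

lemmas tmesh_facts = tmesh[unfolded tmesh_def]

lemma fin_cells: "finite (cells M)" using tmesh_facts by (elim conjE)
lemma fin_edges: "finite (edges M)" using tmesh_facts by (elim conjE)
lemma rect: "f \<in> cells M \<Longrightarrow> rectangle f" using tmesh_facts by (elim conjE) (rule bspec)
lemma edges_directed: "l \<in> edges M \<Longrightarrow> horizontal l \<or> vertical l"
  using tmesh_facts by (elim conjE) (rule bspec)
lemma edges_in_frontiers: "l \<in> edges M \<Longrightarrow> l \<subseteq> (\<Union>f\<in>cells M. frontier f)"
  using tmesh_facts by (elim conjE) (rule bspec)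
lemma verts_eq: "verts M = (\<Union>l\<in>edges M. endpoints l)" using tmesh_facts by (elim conjE)
lemma frontier_cell: "f \<in> cells M \<Longrightarrow> \<exists>E\<subseteq>edges M. frontier f = \<Union>E"
  using tmesh_facts by (elim conjE) (rule bspec)
lemma cell_inter: "f \<in> cells M \<Longrightarrow> f' \<in> cells M \<Longrightarrow> f \<noteq> f' \<Longrightarrow> f \<inter> f' = frontier f \<inter> frontier f'"
  using tmesh_facts by (elim conjE) meson
lemma edge_inter: "l \<in> edges M \<Longrightarrow> l' \<in> edges M \<Longrightarrow> l \<noteq> l' \<Longrightarrow>
        l \<inter> l' = endpoints l \<inter> endpoints l' \<and> l \<inter> l' \<subseteq> verts M"
  using tmesh_facts by (elim conjE) meson
lemma vert_cross: "p \<in> verts M \<Longrightarrow> \<exists>h\<in>edges M. \<exists>v\<in>edges M. horizontal h \<and> vertical v \<and> h \<inter> v = {p}"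
  using tmesh_facts by (elim conjE) (rule bspec)
lemma simply: "simply_connected (domain M)" using tmesh_facts by (elim conjE)
lemma interior_connected: "connected (interior (domain M))" using tmesh_facts by (elim conjE)

lemma edge_form: assumes "e \<in> edges M" obtains ax t a b where "a < b" "e = seg ax t a b"
proof -
  have "horizontal e \<or> vertical e" using edges_directed assms .
  then show thesis using that unfolding horizontal_iff vertical_iff by blast
qed

lemma fin_verts: "finite (verts M)"
  unfolding verts_eq using fin_edges edge_form endpoints_seg by (intro finite_UN_I) (metis finite.emptyI finite.insertI)+

lemma cell_bounds:
  assumes "f \<in> cells M"
  shows "lo ax f < hi ax f"
    and "p \<in> f \<longleftrightarrow> lo ax f \<le> along ax p \<and> along ax p \<le> hi ax f \<and> lo (\<not> ax) f \<le> along (\<not> ax) p \<and> along (\<not> ax) p \<le> hi (\<not> ax) f"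
  using rectangle_bounds[OF rect[OF assms]] by blast+

lemma cell_closed: "f \<in> cells M \<Longrightarrow> closed f" using rectangle_bounds(4)[OF rect] .
lemma cell_compact: "f \<in> cells M \<Longrightarrow> compact f" using rectangle_bounds(5)[OF rect] .
lemma cell_convex: "f \<in> cells M \<Longrightarrow> convex f" using rectangle_bounds(6)[OF rect] .
lemma cell_nonempty: "f \<in> cells M \<Longrightarrow> f \<noteq> {}" using rectangle_bounds(7)[OF rect] .
lemma cell_regular: "f \<in> cells M \<Longrightarrow> f \<subseteq> closure (interior f)" using rectangle_bounds(8)[OF rect] .

lemma closed_domain: "closed (domain M)"
  unfolding domain_def using fin_cells cell_closed by (rule closed_Union[OF _ ballI])

lemma frontier_domain: "frontier (domain M) = domain M - interior (domain M)"
  unfolding frontier_def using closed_domain by simp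

text \<open>Distinct cells have disjoint interiors, and two rectangles with disjoint interiors are separated by an
axis-parallel line.\<close>

lemma separated:
  assumes f: "f \<in> cells M" and g: "g \<in> cells M" and "f \<noteq> g"
  shows "hi ax f \<le> lo ax g \<or> hi ax g \<le> lo ax f \<or> hi (\<not> ax) f \<le> lo (\<not> ax) g \<or> hi (\<not> ax) g \<le> lo (\<not> ax) f"
proof (rule ccontr)
  assume *: "\<not> ?thesis"
  define m where "m ax = (max (lo ax f) (lo ax g) + min (hi ax f) (hi ax g)) / 2" for ax
  have m: "lo ax' f < m ax'" "m ax' < hi ax' f" "lo ax' g < m ax'" "m ax' < hi ax' g" if "ax' = ax \<or> ax' = (\<not> ax)" for ax'
    using * that cell_bounds(1)[OF f] cell_bounds(1)[OF g] unfolding m_def by (auto simp: max_def min_def not_le field_simps)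
  have "pt ax (m ax) (m (\<not> ax)) \<in> interior f" "pt ax (m ax) (m (\<not> ax)) \<in> interior g"
    using m rectangle_bounds(3)[OF rect[OF f], of _ ax] rectangle_bounds(3)[OF rect[OF g], of _ ax] by auto
  then show False using cell_inter[OF f g assms(3)] interior_subset[of f] interior_subset[of g]
    unfolding frontier_def by blast
qed

text \<open>A rectangle through \<open>q\<close> contains near \<open>q\<close> each of the four closed quadrants at \<open>q\<close>, or no
point of the interior of that quadrant.  So the mesh near \<open>q\<close> is described by the cells
containing the quadrant with directions \<open>r\<close> along and \<open>t\<close> across the axis; there is at most one for each quadrant, and exactly one
for all four if \<open>q\<close> is interior.\<close>

definition germ :: "bool \<Rightarrow> bool \<Rightarrow> bool \<Rightarrow> point \<Rightarrow> point set \<Rightarrow> bool" where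
  "germ ax r t q f \<longleftrightarrow> f \<in> cells M \<and> q \<in> f \<and> extends ax r f q \<and> extends (\<not> ax) t f q"

lemma germ_swap: "germ (\<not> ax) t r q f \<longleftrightarrow> germ ax r t q f"
  by (auto simp: germ_def)

lemma germ_unique:
  assumes f: "germ ax r t q f" and g: "germ ax r t q g" shows "f = g"
proof (rule ccontr)
  assume ne: "f \<noteq> g"
  have fg: "f \<in> cells M" "q \<in> f" "g \<in> cells M" "q \<in> g" using f g unfolding germ_def by auto
  have "extends ax r f q" "extends (\<not> ax) t f q" "extends ax r g q" "extends (\<not> ax) t g q" using f g unfolding germ_def by auto
  then show False using separated[OF fg(1,3) ne, of ax]
      cell_bounds(2)[OF fg(1), of q ax, THEN iffD1, OF fg(2)] cell_bounds(2)[OF fg(3), of q ax, THEN iffD1, OF fg(4)]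
    unfolding extends_def by (cases r; cases t) auto
qed

lemma germ_ex:
  assumes f: "f \<in> cells M" and "q \<in> f" shows "\<exists>r t. germ ax r t q f"
proof -
  have "extends ax' (along ax' q < hi ax' f) f q" for ax'
    using cell_bounds(1)[OF f, of ax'] unfolding extends_def by simp
  then show ?thesis using assms unfolding germ_def by blast
qed

lemma near_cells:
  shows "\<exists>\<epsilon>>0. \<forall>p f. dist q p < \<epsilon> \<longrightarrow> f \<in> cells M \<longrightarrow> p \<in> f \<longrightarrow> q \<in> f"
proof -
  have "closed (\<Union>{f\<in>cells M. q \<notin> f})" using fin_cells cell_closed by (intro closed_Union) auto
  then have "open (- \<Union>{f\<in>cells M. q \<notin> f})" by (rule open_Compl)
  moreover have "q \<in> - \<Union>{f\<in>cells M. q \<notin> f}" by auto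
  ultimately obtain \<epsilon> where \<epsilon>: "\<epsilon> > 0" "ball q \<epsilon> \<subseteq> - \<Union>{f\<in>cells M. q \<notin> f}" by (meson openE)
  have "q \<in> f" if "dist q p < \<epsilon>" "f \<in> cells M" "p \<in> f" for p f
  proof -
    have "p \<in> ball q \<epsilon>" using that(1) by simp
    then have "p \<in> - \<Union>{f\<in>cells M. q \<notin> f}" using \<epsilon>(2) by (rule subsetD[rotated])
    then show ?thesis using that by auto
  qed
  then show ?thesis using \<epsilon>(1) by blast
qed

lemma interior_germ:
  assumes "q \<in> interior (domain M)" shows "\<exists>f. germ ax r t q f"
proof -
  obtain e1 where e1: "e1 > 0" "ball q e1 \<subseteq> domain M" using assms by (meson mem_interior)
  obtain e2 where e2: "e2 > 0" "\<And>p f. dist q p < e2 \<Longrightarrow> f \<in> cells M \<Longrightarrow> p \<in> f \<Longrightarrow> q \<in> f" using near_cells by metis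
  define h where "h = min e1 e2 / 3"
  have h: "h > 0" "2 * h < e1" "2 * h < e2" unfolding h_def using e1 e2 by auto
  define p where "p = pt ax (if r then along ax q + h else along ax q - h) (if t then along (\<not> ax) q + h else along (\<not> ax) q - h)"
  have "dist q p \<le> dist q (pt ax (along ax q) (along (\<not> ax) p)) + dist (pt ax (along ax q) (along (\<not> ax) p)) p"
    by (rule dist_triangle)
  also have "\<dots> = \<bar>along (\<not> ax) q - along (\<not> ax) p\<bar> + \<bar>along ax q - along ax p\<bar>"
    using dist_pt_same(2)[of ax "along ax q" "along (\<not> ax) q" "along (\<not> ax) p"]
      dist_pt_same(1)[of ax "along ax q" "along (\<not> ax) p" "along ax p"] by simp
  also have "\<dots> \<le> 2 * h" unfolding p_def using h(1) by auto
  finally have d: "dist q p < e1" "dist q p < e2" using h by auto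
  then have "p \<in> domain M" using e1 by auto
  then obtain f where f: "f \<in> cells M" "p \<in> f" unfolding domain_def by blast
  have "q \<in> f" using e2(2)[OF d(2) f] .
  moreover have "extends ax r f q" "extends (\<not> ax) t f q"
    using f(2) h(1) unfolding cell_bounds(2)[OF f(1), where ax = ax] extends_def p_def by (auto split: if_splits)
  ultimately show ?thesis using f unfolding germ_def by blast
qed

lemma germ_box:
  assumes "germ ax r t q f"
  shows "\<exists>\<epsilon>>0. \<forall>p. dist q p < \<epsilon> \<longrightarrow> (if r then along ax q \<le> along ax p else along ax p \<le> along ax q) \<longrightarrow>
    (if t then along (\<not> ax) q \<le> along (\<not> ax) p else along (\<not> ax) p \<le> along (\<not> ax) q) \<longrightarrow> p \<in> f"
proof -
  have f: "f \<in> cells M" "q \<in> f" "extends ax r f q" "extends (\<not> ax) t f q" using assms unfolding germ_def by auto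
  define e1 where "e1 = (if r then hi ax f - along ax q else along ax q - lo ax f)"
  define e2 where "e2 = (if t then hi (\<not> ax) f - along (\<not> ax) q else along (\<not> ax) q - lo (\<not> ax) f)"
  have "min e1 e2 > 0" using f unfolding extends_def e1_def e2_def by (auto split: if_splits)
  moreover have "p \<in> f" if "dist q p < min e1 e2" "if r then along ax q \<le> along ax p else along ax p \<le> along ax q"
    "if t then along (\<not> ax) q \<le> along (\<not> ax) p else along (\<not> ax) p \<le> along (\<not> ax) q" for p
  proof -
    have d: "\<bar>along ax q - along ax p\<bar> < e1" "\<bar>along (\<not> ax) q - along (\<not> ax) p\<bar> < e2"
      using abs_along_le_dist[of ax q p] abs_along_le_dist[of "\<not> ax" q p] that(1) by linarith+
    have "lo ax f \<le> along ax p \<and> along ax p \<le> hi ax f"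
      using d(1) that(2) f(2) unfolding cell_bounds(2)[OF f(1), where ax = ax] e1_def by (cases r) auto
    moreover have "lo (\<not> ax) f \<le> along (\<not> ax) p \<and> along (\<not> ax) p \<le> hi (\<not> ax) f"
      using d(2) that(3) f(2) unfolding cell_bounds(2)[OF f(1), where ax = ax] e2_def by (cases t) auto
    ultimately show ?thesis unfolding cell_bounds(2)[OF f(1), where ax = ax] by blast
  qed
  ultimately show ?thesis by blast
qed

lemma germs_interior:
  assumes "\<And>r t. \<exists>f. germ ax r t q f" shows "q \<in> interior (domain M)"
proof -
  have "\<exists>\<epsilon>>0. \<forall>p. dist q p < \<epsilon> \<longrightarrow> (if r then along ax q \<le> along ax p else along ax p \<le> along ax q) \<longrightarrow>
    (if t then along (\<not> ax) q \<le> along (\<not> ax) p else along (\<not> ax) p \<le> along (\<not> ax) q) \<longrightarrow> p \<in> domain M" for r t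
  proof -
    obtain f where f: "germ ax r t q f" using assms by blast
    then have "f \<subseteq> domain M" unfolding germ_def domain_def by blast
    then show ?thesis using germ_box[OF f] by blast
  qed
  then obtain e where e: "\<And>r t. e r t > 0" and eD: "\<And>r t p. dist q p < e r t \<Longrightarrow>
     (if r then along ax q \<le> along ax p else along ax p \<le> along ax q) \<Longrightarrow>
    (if t then along (\<not> ax) q \<le> along (\<not> ax) p else along (\<not> ax) p \<le> along (\<not> ax) q) \<Longrightarrow> p \<in> domain M"
    by metis
  define d where "d = min (min (e True True) (e True False)) (min (e False True) (e False False))"
  have "d > 0" using e unfolding d_def by simp
  moreover have "d \<le> e r t" for r t unfolding d_def by (cases r; cases t) auto
  then have "p \<in> domain M" if "dist q p < d" for p
    using eD[of p "along ax q \<le> along ax p" "along (\<not> ax) q \<le> along (\<not> ax) p"] that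
    by (smt (verit))
  then have "ball q d \<subseteq> domain M" by auto
  ultimately show ?thesis by (meson mem_interior)
qed

text \<open>Equivalently, an interior edge starts at \<open>q\<close> or passes through it in the direction \<open>r\<close> of the
axis.  All facts about interior edges and l-edges are expressed through this local condition.\<close>

definition split :: "bool \<Rightarrow> bool \<Rightarrow> point \<Rightarrow> bool" where
  "split ax r q \<longleftrightarrow> (\<exists>f g. f \<noteq> g \<and> germ ax r True q f \<and> germ ax r False q g)"

lemma above_of_germs:
  assumes f: "germ ax r True q f" and g: "germ ax r False q g" and "f \<noteq> g"
  shows "above ax f g \<and> along (\<not> ax) q = lo (\<not> ax) f"
proof -
  have fg: "f \<in> cells M" "q \<in> f" "g \<in> cells M" "q \<in> g" using f g unfolding germ_def by auto
  have "extends ax r f q" "extends (\<not> ax) True f q" "extends ax r g q" "extends (\<not> ax) False g q"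
    using f g unfolding germ_def by auto
  then show ?thesis using separated[OF fg(1,3) assms(3), of ax]
      cell_bounds(2)[OF fg(1), of q ax, THEN iffD1, OF fg(2)] cell_bounds(2)[OF fg(3), of q ax, THEN iffD1, OF fg(4)]
    unfolding extends_def above_def by (cases r) auto
qed

lemma above_neq:
  assumes "above ax f g" "f \<in> cells M" "g \<in> cells M" shows "f \<noteq> g"
  using assms cell_bounds(1)[of f "\<not> ax"] unfolding above_def by auto

lemma split_both_interior:
  assumes "split ax True q" "split ax False q" shows "q \<in> interior (domain M)"
  using assms unfolding split_def by (intro germs_interior[of ax]) (metis (full_types))

end

context T_mesh
begin

section \<open>Edges and l-edges\<close>

lemma frontier_cell_subset: "f \<in> cells M \<Longrightarrow> frontier f \<subseteq> f"
  using cell_closed frontier_subset_closed by blast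

lemma edge_ends_in_verts:
  assumes "seg ax t a b \<in> edges M" "a < b" shows "pt ax a t \<in> verts M" "pt ax b t \<in> verts M"
proof -
  have "endpoints (seg ax t a b) \<subseteq> verts M" unfolding verts_eq using assms(1) by blast
  then show "pt ax a t \<in> verts M" "pt ax b t \<in> verts M" using endpoints_seg[OF assms(2)] by auto
qed

text \<open>A cell through a relative interior point of an edge has it on its frontier, which is a union of edges;
since distinct edges meet in end points only, one of these is the edge itself.\<close>

lemma edge_through_cell:
  assumes e: "seg ax t a b \<in> edges M" and ab: "a < b" and p: "p \<in> seg ax t a b" "p \<notin> verts M"
    and f: "f \<in> cells M" "p \<in> f"
  shows "seg ax t a b \<subseteq> frontier f"
proof -
  obtain f0 where f0: "f0 \<in> cells M" "p \<in> frontier f0" using edges_in_frontiers[OF e] p(1) by blast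
  have "p \<in> f0" using f0 cell_closed frontier_subset_closed by blast
  then have "p \<in> frontier f" using cell_inter[OF f(1) f0(1)] f(2) f0(2) by (cases "f = f0") auto
  then obtain e' where e': "e' \<in> edges M" "p \<in> e'" "e' \<subseteq> frontier f" using frontier_cell[OF f(1)] by blast
  have "e' = seg ax t a b" using edge_inter[OF e'(1) e] e'(2) p by blast
  then show ?thesis using e' by simp
qed

lemma edge_at_cell_frontier:
  assumes f: "f \<in> cells M" and p: "p \<in> frontier f" "p \<notin> verts M"
  obtains ax a b where "a < b" "seg ax (along (\<not> ax) p) a b \<in> edges M" "a < along ax p" "along ax p < b"
    "\<And>g. g \<in> cells M \<Longrightarrow> p \<in> g \<Longrightarrow> seg ax (along (\<not> ax) p) a b \<subseteq> frontier g"
proof -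
  obtain e where e: "e \<in> edges M" "p \<in> e" using frontier_cell[OF f] p(1) by blast
  obtain ax t a b where s: "a < b" "e = seg ax t a b" using edge_form[OF e(1)] .
  have t: "t = along (\<not> ax) p" using e s by (auto simp: seg_def)
  have "pt ax a t \<noteq> p" "pt ax b t \<noteq> p" using edge_ends_in_verts[of ax t a b] e s p(2) by auto
  then have "along ax p \<noteq> a" "along ax p \<noteq> b" using t pt_along[of ax p] by auto
  then have ap: "a < along ax p" "along ax p < b" using e s by (auto simp: seg_def)
  have sub: "seg ax t a b \<subseteq> frontier g" if "g \<in> cells M" "p \<in> g" for g
    using edge_through_cell[of ax t a b p g] that e s p(2) by blast
  show thesis using that[OF s(1) _ ap, unfolded t[symmetric], OF _ sub] e(1) s(2) by simp
qed

text \<open>A vertex lies on a perpendicular edge, and distinct edges meet only in common end points.\<close>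

lemma relint_not_vert_of_edge:
  assumes "seg ax t a b \<in> edges M" "a < s" "s < b"
  shows "pt ax s t \<notin> verts M"
proof
  assume "pt ax s t \<in> verts M"
  then obtain h v where hv: "h \<in> edges M" "v \<in> edges M" "horizontal h" "vertical v" "h \<inter> v = {pt ax s t}"
    using vert_cross by blast
  have ab: "a < b" using assms by simp
  define l where "l = (if ax then v else h)"
  have "pt ax s t \<in> h" "pt ax s t \<in> v" using hv(5) by blast+
  then have l: "l \<in> edges M" "pt ax s t \<in> l" using hv(1,2) unfolding l_def by (cases ax; auto)+
  obtain a' b' t' where l': "a' < b'" "l = seg (\<not> ax) t' a' b'"
    using hv(3,4) unfolding l_def horizontal_iff vertical_iff by (cases ax) auto
  have "l \<noteq> seg ax t a b" using seg_eq_iff[OF l'(1) ab, of "\<not> ax" t' ax t] l'(2) by simp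
  then have "pt ax s t \<in> endpoints (seg ax t a b)" using edge_inter[OF l(1) assms(1)] l(2) assms by auto
  then show False using endpoints_seg[OF ab, of ax t] assms by auto
qed

lemma interior_edgeI:
  assumes e: "seg ax t a b \<in> edges M" and p: "p \<in> seg ax t a b" "p \<in> interior (domain M)"
  shows "seg ax t a b \<in> interior_edges M"
  using assms unfolding interior_edges_def boundary_edges_def frontier_def by blast

text \<open>Near a point of the edge in the interior of the domain there are cells on both sides.  They contain
relative interior points of the edge, so the whole edge lies on their frontiers.\<close>

lemma interior_edge_between_cells:
  assumes e: "seg ax t a b \<in> interior_edges M" and ab: "a < b"
  obtains f g where "f \<in> cells M" "g \<in> cells M" "lo (\<not> ax) f = t" "hi (\<not> ax) g = t"
    "lo ax f \<le> a" "b \<le> hi ax f" "lo ax g \<le> a" "b \<le> hi ax g"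
proof -
  have eE: "seg ax t a b \<in> edges M" "\<not> seg ax t a b \<subseteq> frontier (domain M)"
    using e unfolding interior_edges_def boundary_edges_def by auto
  have "seg ax t a b \<subseteq> domain M"
    using edges_in_frontiers[OF eE(1)] frontier_cell_subset unfolding domain_def by blast
  then obtain p where p: "p \<in> seg ax t a b" "p \<in> interior (domain M)" using eE(2) unfolding frontier_domain by blast
  define r where "r = (along ax p < b)"
  obtain f where f: "germ ax r True p f" using interior_germ[OF p(2)] by blast
  obtain g where g: "germ ax r False p g" using interior_germ[OF p(2)] by blast
  have fg: "f \<in> cells M" "p \<in> f" "extends ax r f p" "extends (\<not> ax) True f p" "g \<in> cells M" "p \<in> g" "extends ax r g p" "extends (\<not> ax) False g p"
    using f g unfolding germ_def by auto
  note bf = cell_bounds(2)[OF fg(1), where ax = ax] and bg = cell_bounds(2)[OF fg(5), where ax = ax]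
  have pp: "along (\<not> ax) p = t" "a \<le> along ax p" "along ax p \<le> b" using p(1) by (auto simp: seg_def)
  obtain s where s: "a < s" "s < b" "pt ax s t \<in> f" "pt ax s t \<in> g"
  proof (cases r)
    case True
    define m where "m = min (min (hi ax f) (hi ax g)) b"
    have "along ax p < m" using True fg(3,7) unfolding m_def extends_def r_def by auto
    then obtain s where "along ax p < s" "s < m" using dense by blast
    then show thesis using that[of s] fg(2,6) pp unfolding bf bg m_def by auto
  next
    case False
    define m where "m = max (max (lo ax f) (lo ax g)) a"
    have "m < along ax p" using False fg(3,7) ab pp unfolding m_def extends_def r_def by auto
    then obtain s where "m < s" "s < along ax p" using dense by blast
    then show thesis using that[of s] fg(2,6) pp unfolding bf bg m_def by auto
  qed
  have "pt ax s t \<notin> verts M" using relint_not_vert_of_edge[OF eE(1) s(1,2)] .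
  then have "seg ax t a b \<subseteq> frontier f" "seg ax t a b \<subseteq> frontier g"
    using edge_through_cell[OF eE(1) ab, of "pt ax s t"] s fg by auto
  then have "(t = lo (\<not> ax) f \<or> t = hi (\<not> ax) f) \<and> lo ax f \<le> a \<and> b \<le> hi ax f"
    "(t = lo (\<not> ax) g \<or> t = hi (\<not> ax) g) \<and> lo ax g \<le> a \<and> b \<le> hi ax g"
    using segment_on_frontier[OF rect ab] fg by blast+
  moreover have "t < hi (\<not> ax) f" "lo (\<not> ax) g < t" using fg(4,8) pp unfolding extends_def by auto
  ultimately have "lo (\<not> ax) f = t" "hi (\<not> ax) g = t" "lo ax f \<le> a" "b \<le> hi ax f" "lo ax g \<le> a" "b \<le> hi ax g"
    by linarith+
  then show thesis using that[OF fg(1,5)] by blast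
qed

lemma split_of_interior_edge:
  assumes e: "seg ax t a b \<in> interior_edges M" "a < b"
  shows "a \<le> s \<Longrightarrow> s < b \<Longrightarrow> split ax True (pt ax s t)" and "a < s \<Longrightarrow> s \<le> b \<Longrightarrow> split ax False (pt ax s t)"
proof -
  obtain f g where fg: "f \<in> cells M" "g \<in> cells M" "lo (\<not> ax) f = t" "hi (\<not> ax) g = t"
    "lo ax f \<le> a" "b \<le> hi ax f" "lo ax g \<le> a" "b \<le> hi ax g" using interior_edge_between_cells[OF e] .
  note bnd = cell_bounds(1)[OF fg(1), of "\<not> ax"] cell_bounds(1)[OF fg(2), of "\<not> ax"]
  have "f \<noteq> g" using fg bnd by auto
  show "split ax True (pt ax s t)" if "a \<le> s" "s < b"
  proof -
    have "germ ax True True (pt ax s t) f" "germ ax True False (pt ax s t) g"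
      unfolding germ_def extends_def cell_bounds(2)[OF fg(1), where ax = ax] cell_bounds(2)[OF fg(2), where ax = ax]
      using fg that bnd by auto
    then show ?thesis using \<open>f \<noteq> g\<close> unfolding split_def by blast
  qed
  show "split ax False (pt ax s t)" if "a < s" "s \<le> b"
  proof -
    have "germ ax False True (pt ax s t) f" "germ ax False False (pt ax s t) g"
      unfolding germ_def extends_def cell_bounds(2)[OF fg(1), where ax = ax] cell_bounds(2)[OF fg(2), where ax = ax]
      using fg that bnd by auto
    then show ?thesis using \<open>f \<noteq> g\<close> unfolding split_def by blast
  qed
qed

text \<open>The common side of the two cells is covered by edges.  A point on it so close to \<open>q\<close> that no vertex
lies in between belongs to an edge reaching back to \<open>q\<close>.\<close>

lemma interior_edge_of_split:
  assumes "split ax r q"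
  obtains a b where "a < b" "seg ax (along (\<not> ax) q) a b \<in> interior_edges M" "a \<le> along ax q" "along ax q \<le> b"
    "if r then along ax q < b else a < along ax q"
proof -
  obtain f g where "f \<noteq> g" and f: "germ ax r True q f" and g: "germ ax r False q g"
    using assms unfolding split_def by blast
  define t where "t = along (\<not> ax) q"
  have ab: "above ax f g" "t = lo (\<not> ax) f" using above_of_germs[OF f g \<open>f \<noteq> g\<close>] unfolding t_def by auto
  have fg: "f \<in> cells M" "q \<in> f" "extends ax r f q" "g \<in> cells M" "q \<in> g" "extends ax r g q"
    using f g unfolding germ_def by auto
  note bf = cell_bounds(2)[OF fg(1), where ax = ax] and bg = cell_bounds(2)[OF fg(4), where ax = ax]
  define V where "V = along ax ` verts M"
  have V: "finite V" unfolding V_def using fin_verts by simp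
  obtain s where s: "pt ax s t \<in> f" "pt ax s t \<in> g" "lo ax f < s" "s < hi ax f" "lo ax g < s" "s < hi ax g"
    "if r then along ax q < s else s < along ax q"
    "\<And>x. x \<in> V \<Longrightarrow> (if r then along ax q < x \<longrightarrow> s < x else x < along ax q \<longrightarrow> x < s)"
  proof (cases r)
    case True
    then have "along ax q < min (hi ax f) (hi ax g)" using fg(3,6) unfolding extends_def by auto
    then obtain s where "along ax q < s" "s < min (hi ax f) (hi ax g)" "\<forall>x\<in>V. along ax q < x \<longrightarrow> s < x"
      using finite_gap_right[OF V] by blast
    then show thesis using that[of s] True fg(2,5) unfolding bf bg t_def by auto
  next
    case False
    then have "max (lo ax f) (lo ax g) < along ax q" using fg(3,6) unfolding extends_def by auto
    then obtain s where "max (lo ax f) (lo ax g) < s" "s < along ax q" "\<forall>x\<in>V. x < along ax q \<longrightarrow> x < s"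
      using finite_gap_left[OF V] by blast
    then show thesis using that[of s] False fg(2,5) unfolding bf bg t_def by auto
  qed
  define p where "p = pt ax s t"
  have pv: "p \<notin> verts M"
  proof
    assume "p \<in> verts M"
    then have "s \<in> V" unfolding V_def p_def by (metis along_pt(1) image_eqI)
    then show False using s(7) s(8)[of s] by (cases r) auto
  qed
  have pf: "p \<in> frontier f" using cell_inter[OF fg(1,4) \<open>f \<noteq> g\<close>] s(1,2) unfolding p_def by blast
  obtain ax' a b where e: "a < b" "seg ax' (along (\<not> ax') p) a b \<in> edges M" "a < along ax' p" "along ax' p < b"
    "\<And>g. g \<in> cells M \<Longrightarrow> p \<in> g \<Longrightarrow> seg ax' (along (\<not> ax') p) a b \<subseteq> frontier g"
    by (rule edge_at_cell_frontier[OF fg(1) pf pv]) (rule that, assumption+)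
  have sf: "seg ax' (along (\<not> ax') p) a b \<subseteq> frontier f" "seg ax' (along (\<not> ax') p) a b \<subseteq> frontier g"
    using e(5) fg s(1,2) unfolding p_def by auto
  have "ax' = ax"
  proof (rule ccontr)
    assume "ax' \<noteq> ax"
    then have ax': "ax' = (\<not> ax)" by auto
    have "lo (\<not> ax) f \<le> a" using segment_on_frontier[OF rect[OF fg(1)] e(1) sf(1)] ax' by simp
    then show False using e(3) ab(2) unfolding ax' p_def by simp
  qed
  then have eE: "seg ax t a b \<in> edges M" and as: "a < s" "s < b" using e unfolding p_def by auto
  have "p \<in> interior (domain M)"
  proof (rule germs_interior[of ax])
    fix r' t'
    have "germ ax r' True p f" "germ ax r' False p g"
      using s ab fg cell_bounds(1)[OF fg(1), of "\<not> ax"] cell_bounds(1)[OF fg(4), of "\<not> ax"]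
      unfolding germ_def extends_def p_def above_def by auto
    then show "\<exists>f. germ ax r' t' p f" by (cases t') auto
  qed
  then have int: "seg ax t a b \<in> interior_edges M" using interior_edgeI[OF eE, of p] as unfolding p_def by auto
  have ends: "a \<in> V" "b \<in> V" using edge_ends_in_verts[OF eE e(1)] unfolding V_def
    by (metis along_pt(1) image_eqI)+
  show thesis
    using that[OF e(1) int[unfolded t_def]] s(7) s(8)[OF ends(1)] s(8)[OF ends(2)] as
    by (cases r) (auto simp: not_less[symmetric])
qed

lemma vert_imp_split:
  assumes "q \<in> verts M" "q \<in> interior (domain M)" shows "\<exists>r. split ax r q"
proof -
  obtain h v where hv: "h \<in> edges M" "v \<in> edges M" "horizontal h" "vertical v" "h \<inter> v = {q}"
    using vert_cross[OF assms(1)] by blast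
  then obtain t a b where e: "a < b" "seg ax t a b \<in> edges M" "q \<in> seg ax t a b"
    unfolding horizontal_iff vertical_iff by (cases ax) auto
  then have int: "seg ax t a b \<in> interior_edges M" using interior_edgeI assms by blast
  have q: "pt ax (along ax q) t = q" using e(3) pt_along[of ax q] unfolding seg_def by auto
  show ?thesis
  proof (cases "along ax q < b")
    case True
    then show ?thesis using split_of_interior_edge(1)[OF int e(1), of "along ax q"] e(3) q by (auto simp: seg_def)
  next
    case False
    then show ?thesis using split_of_interior_edge(2)[OF int e(1), of "along ax q"] e q by (auto simp: seg_def)
  qed
qed

lemma split_imp_vert:
  assumes "split ax r q" "split (\<not> ax) r' q" shows "q \<in> verts M"
proof -
  obtain a b where e: "a < b" "seg ax (along (\<not> ax) q) a b \<in> interior_edges M" "a \<le> along ax q" "along ax q \<le> b"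
    using interior_edge_of_split[OF assms(1)] by metis
  obtain a' b' where e': "a' < b'" "seg (\<not> ax) (along ax q) a' b' \<in> interior_edges M" "a' \<le> along (\<not> ax) q" "along (\<not> ax) q \<le> b'"
    using interior_edge_of_split[OF assms(2)] by (metis (full_types))
  have "seg ax (along (\<not> ax) q) a b \<noteq> seg (\<not> ax) (along ax q) a' b'" using e(1) e'(1) by (simp add: seg_eq_iff)
  moreover have "q \<in> seg ax (along (\<not> ax) q) a b \<inter> seg (\<not> ax) (along ax q) a' b'"
    using e e' unfolding seg_def by auto
  ultimately show ?thesis using edge_inter e(2) e'(2) unfolding interior_edges_def by blast
qed

text \<open>A segment is compact, connected and contained in the line of any of its edges.\<close>

lemma segment_shape:
  assumes "E \<subseteq> edges M" and l: "segment_of E l"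
  obtains ax t a b E' where "a < b" "l = seg ax t a b" "E' \<subseteq> E" "l = \<Union>E'"
    "\<And>e. e \<in> E' \<Longrightarrow> \<exists>a' b'. a' < b' \<and> e = seg ax t a' b'"
proof -
  obtain E' where E': "E' \<subseteq> E" "E' \<noteq> {}" "l = \<Union>E'" "connected l" "collinear l" using l unfolding segment_of_def by blast
  obtain e where e: "e \<in> E'" using E'(2) by blast
  then have "e \<in> edges M" using E'(1) assms(1) by blast
  then obtain ax t a0 b0 where s: "a0 < b0" "e = seg ax t a0 b0" using edge_form by metis
  have line: "along (\<not> ax) p = t" if "p \<in> l" for p
    using collinear_contains_seg[OF E'(5) _ s(1) that] e s E'(3) by blast
  have form: "\<exists>a' b'. a' < b' \<and> e' = seg ax t a' b'" if e': "e' \<in> E'" for e'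
  proof -
    have "e' \<in> edges M" using e' E'(1) assms(1) by blast
    then obtain ax' t' a' b' where s': "a' < b'" "e' = seg ax' t' a' b'" using edge_form by metis
    have "pt ax' a' t' \<in> l" "pt ax' b' t' \<in> l" using s' e' E'(3) by auto
    then have *: "along (\<not> ax) (pt ax' a' t') = t" "along (\<not> ax) (pt ax' b' t') = t" using line by auto
    then have "ax' = ax" using s'(1) by (cases ax; cases ax') (auto simp: pt_def along_def)
    then show ?thesis using s' * by auto
  qed
  have "compact l" unfolding E'(3)
  proof (rule compact_Union)
    show "finite E'" using finite_subset[OF E'(1) finite_subset[OF assms(1) fin_edges]] .
    show "\<And>e. e \<in> E' \<Longrightarrow> compact e" using form compact_seg by metis
  qed
  then have "compact (along ax ` l)" "connected (along ax ` l)"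
    using E'(4) by (auto intro!: compact_continuous_image connected_continuous_image continuous_on_along)
  then obtain a b where ab: "along ax ` l = {a..b}" using connected_compact_interval_1[of "along ax ` l"] by auto
  have "l = seg ax t a b"
  proof
    show "l \<subseteq> seg ax t a b"
    proof
      fix p assume p: "p \<in> l"
      then have "along ax p \<in> {a..b}" unfolding ab[symmetric] by (rule imageI)
      then show "p \<in> seg ax t a b" using line[OF p] unfolding seg_def by simp
    qed
    show "seg ax t a b \<subseteq> l"
    proof
      fix p assume p: "p \<in> seg ax t a b"
      then have "along ax p \<in> along ax ` l" unfolding ab seg_def by simp
      then obtain p' where p': "p' \<in> l" "along ax p = along ax p'" by (rule imageE)
      then have "p = p'" using line[OF p'(1)] p unfolding point_eq_iff[of p p' ax] seg_def by simp
      then show "p \<in> l" using p' by simp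
    qed
  qed
  moreover have "a < b"
  proof -
    have "pt ax a0 t \<in> l" "pt ax b0 t \<in> l" using s e E'(3) by auto
    then have "a0 \<in> along ax ` l" "b0 \<in> along ax ` l" by (metis along_pt(1) image_eqI)+
    then show ?thesis using s(1) unfolding ab by auto
  qed
  ultimately show thesis using that E' form by blast
qed

text \<open>Finitely many closed edges cover the segment, so one that contains points just beyond \<open>s\<close> contains
\<open>s\<close> as well.\<close>

lemma interior_segment_splits:
  assumes l: "segment_of (interior_edges M) (seg ax t a b)" and ab: "a < b"
  shows "a \<le> s \<Longrightarrow> s < b \<Longrightarrow> split ax True (pt ax s t)" and "a < s \<Longrightarrow> s \<le> b \<Longrightarrow> split ax False (pt ax s t)"
proof -
  have "interior_edges M \<subseteq> edges M" unfolding interior_edges_def by blast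
  then obtain ax0 t0 a0 b0 E' where *: "a0 < b0" "seg ax t a b = seg ax0 t0 a0 b0" "E' \<subseteq> interior_edges M" "seg ax t a b = \<Union>E'"
    "\<And>e. e \<in> E' \<Longrightarrow> \<exists>a' b'. a' < b' \<and> e = seg ax0 t0 a' b'" using segment_shape[OF _ l] by metis
  have "ax0 = ax" "t0 = t" using *(1,2) ab by (auto simp: seg_eq_iff)
  then have form: "\<And>e. e \<in> E' \<Longrightarrow> \<exists>a' b'. a' < b' \<and> e = seg ax t a' b'" using *(5) by simp
  have "finite E'" using *(3) fin_edges unfolding interior_edges_def by (meson finite_Diff finite_subset)
  define V where "V = along ax ` verts M"
  have V: "finite V" unfolding V_def using fin_verts by simp
  have mem: "\<exists>a' b'. a' < b' \<and> seg ax t a' b' \<in> interior_edges M \<and> a' \<le> s \<and> s \<le> b' \<and> a' \<in> V \<and> b' \<in> V" if s: "a \<le> s" "s \<le> b" for s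
  proof -
    have "pt ax s t \<in> \<Union>E'" using s *(4) by auto
    then obtain e where e: "e \<in> E'" "pt ax s t \<in> e" by blast
    obtain a' b' where e': "a' < b'" "e = seg ax t a' b'" using form[OF e(1)] by blast
    have "seg ax t a' b' \<in> edges M" using e e' *(3) unfolding interior_edges_def by blast
    then have "a' \<in> V" "b' \<in> V" using edge_ends_in_verts[OF _ e'(1)] unfolding V_def by (metis along_pt(1) image_eqI)+
    then show ?thesis using e e' *(3) by auto
  qed
  show "split ax True (pt ax s t)" if "a \<le> s" "s < b"
  proof -
    obtain s' where s': "s < s'" "s' < b" "\<forall>x\<in>V. s < x \<longrightarrow> s' < x" using finite_gap_right[OF V \<open>s < b\<close>] by blast
    obtain a' b' where e: "a' < b'" "seg ax t a' b' \<in> interior_edges M" "a' \<le> s'" "s' \<le> b'" "a' \<in> V"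
      using mem[of s'] s'(1,2) \<open>a \<le> s\<close> by force
    then show ?thesis using split_of_interior_edge(1)[OF e(2,1), of s] s' by force
  qed
  show "split ax False (pt ax s t)" if "a < s" "s \<le> b"
  proof -
    obtain s' where s': "a < s'" "s' < s" "\<forall>x\<in>V. x < s \<longrightarrow> x < s'" using finite_gap_left[OF V \<open>a < s\<close>] by blast
    obtain a' b' where e: "a' < b'" "seg ax t a' b' \<in> interior_edges M" "a' \<le> s'" "s' \<le> b'" "b' \<in> V"
      using mem[of s'] s'(1,2) \<open>s \<le> b\<close> by force
    then show ?thesis using split_of_interior_edge(2)[OF e(2,1), of s] s' by force
  qed
qed

text \<open>The interior l-edges are the segments satisfying this (\<open>interior_ledge_iff\<close>): interior edges cover
them, and no interior edge continues them beyond either end.\<close>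

definition is_ledge :: "bool \<Rightarrow> real \<Rightarrow> real \<Rightarrow> real \<Rightarrow> bool" where
  "is_ledge ax t a b \<longleftrightarrow> a < b \<and> (\<forall>s. a \<le> s \<and> s < b \<longrightarrow> split ax True (pt ax s t)) \<and>
     (\<forall>s. a < s \<and> s \<le> b \<longrightarrow> split ax False (pt ax s t)) \<and>
     \<not> split ax False (pt ax a t) \<and> \<not> split ax True (pt ax b t)"

lemma segment_extend:
  assumes l: "segment_of (interior_edges M) (seg ax t a b)" and "a < b"
    and e: "seg ax t a' b' \<in> interior_edges M" and "a' < b'" "a' \<le> b" "a \<le> b'"
  shows "segment_of (interior_edges M) (seg ax t a b \<union> seg ax t a' b')"
proof -
  obtain E' where E': "E' \<subseteq> interior_edges M" "seg ax t a b = \<Union>E'" using l unfolding segment_of_def by blast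
  have un: "seg ax t a b \<union> seg ax t a' b' = seg ax t (min a a') (max b b')"
    using assms by (auto simp: seg_def)
  show ?thesis unfolding segment_of_def
  proof (intro exI[of _ "insert (seg ax t a' b') E'"] conjI)
    show "seg ax t a b \<union> seg ax t a' b' = \<Union>(insert (seg ax t a' b') E')" using E' by blast
    show "connected (seg ax t a b \<union> seg ax t a' b')" "collinear (seg ax t a b \<union> seg ax t a' b')"
      unfolding un by (rule connected_seg collinear_seg)+
  qed (use E' e in auto)
qed

lemma ledge_of_maximal:
  assumes "l \<in> interior_ledges M"
  obtains ax t a b where "is_ledge ax t a b" "l = seg ax t a b"
proof -
  have l: "segment_of (interior_edges M) l" and max: "\<And>l'. segment_of (interior_edges M) l' \<Longrightarrow> l \<subseteq> l' \<Longrightarrow> l' = l"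
    using assms unfolding interior_ledges_def maximal_segments_def by auto
  have "interior_edges M \<subseteq> edges M" unfolding interior_edges_def by blast
  then obtain ax t a b where s: "a < b" "l = seg ax t a b" using segment_shape[OF _ l] by metis
  note sp = interior_segment_splits[OF l[unfolded s(2)] s(1)]
  have ns: "a \<le> a' \<and> b' \<le> b" if e: "seg ax t a' b' \<in> interior_edges M" "a' < b'" "a' \<le> b" "a \<le> b'" for a' b'
  proof -
    have "seg ax t a b \<union> seg ax t a' b' = seg ax t a b"
      using max segment_extend[OF l[unfolded s(2)] s(1) e] s(2) by blast
    then have "seg ax t a' b' \<subseteq> seg ax t a b" by blast
    then show ?thesis using seg_direction e(2) by blast
  qed
  have "\<not> split ax False (pt ax a t)"
  proof
    assume "split ax False (pt ax a t)"
    then obtain a' b' where "a' < b'" "seg ax t a' b' \<in> interior_edges M" "a' < a" "a \<le> b'"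
      using interior_edge_of_split by (metis along_pt(1,2))
    then show False using ns[of a' b'] s by auto
  qed
  moreover have "\<not> split ax True (pt ax b t)"
  proof
    assume "split ax True (pt ax b t)"
    then obtain a' b' where "a' < b'" "seg ax t a' b' \<in> interior_edges M" "a' \<le> b" "b < b'"
      using interior_edge_of_split by (metis along_pt(1,2))
    then show False using ns[of a' b'] s by auto
  qed
  ultimately have "is_ledge ax t a b" unfolding is_ledge_def using sp s by blast
  then show thesis using that s by blast
qed

lemma ledge_unique:
  assumes "is_ledge ax t a b" "is_ledge ax t a' b'" "a \<le> s" "s \<le> b" "a' \<le> s" "s \<le> b'"
  shows "a = a'" "b = b'"
proof -
  have aux: "b \<le> b' \<and> a' \<le> a" if "is_ledge ax t a b" "is_ledge ax t a' b'" "a \<le> s" "s \<le> b" "a' \<le> s" "s \<le> b'" for a b a' b'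
    using that unfolding is_ledge_def by (meson le_less_trans less_le_trans not_le)
  show "a = a'" "b = b'" using aux[of a b a' b'] aux[of a' b' a b] assms by auto
qed

lemma maximal_segment_exists:
  assumes "segment_of E l" "finite E" shows "\<exists>l'\<in>maximal_segments E. l \<subseteq> l'"
proof -
  have "{l. segment_of E l} \<subseteq> Union ` Pow E" unfolding segment_of_def by blast
  then have "finite {l. segment_of E l}" using assms(2) finite_subset by blast
  then obtain m where "m \<in> {l. segment_of E l}" "l \<subseteq> m" "\<forall>x\<in>{l. segment_of E l}. m \<subseteq> x \<longrightarrow> m = x"
    using finite_has_maximal2[of "{l. segment_of E l}" l] assms(1) by blast
  then show ?thesis unfolding maximal_segments_def by auto
qed

lemma edge_segment_of: "e \<in> E \<Longrightarrow> E \<subseteq> edges M \<Longrightarrow> segment_of E e"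
  unfolding segment_of_def
  using edge_form[of e] connected_seg collinear_seg by (intro exI[of _ "{e}"]) (metis Union_insert Union_empty Un_empty_right empty_subsetI insert_not_empty insert_subset subsetD)

lemma ledge_exists:
  assumes "split ax r q"
  obtains a b where "is_ledge ax (along (\<not> ax) q) a b" "a \<le> along ax q" "along ax q \<le> b"
    "seg ax (along (\<not> ax) q) a b \<in> interior_ledges M"
proof -
  define t where "t = along (\<not> ax) q"
  obtain a b where e: "a < b" "seg ax t a b \<in> interior_edges M" "a \<le> along ax q" "along ax q \<le> b"
    using interior_edge_of_split[OF assms] unfolding t_def by metis
  have sub: "interior_edges M \<subseteq> edges M" unfolding interior_edges_def by blast
  then obtain l where l: "l \<in> interior_ledges M" "seg ax t a b \<subseteq> l"
    using maximal_segment_exists[OF edge_segment_of[OF e(2) sub]] finite_subset[OF sub fin_edges]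
    unfolding interior_ledges_def by blast
  obtain ax' t' a' b' where l': "is_ledge ax' t' a' b'" "l = seg ax' t' a' b'" using ledge_of_maximal[OF l(1)] .
  have "ax' = ax \<and> t' = t \<and> a' \<le> a \<and> b \<le> b'" using seg_direction l(2) l'(2) e(1) by blast
  then show thesis using that[of a' b'] l l' e unfolding t_def by auto
qed

lemma maximal_of_ledge:
  assumes "is_ledge ax t a b" shows "seg ax t a b \<in> interior_ledges M"
proof -
  have "a < b" "split ax True (pt ax a t)" using assms unfolding is_ledge_def by auto
  then obtain a' b' where l: "is_ledge ax t a' b'" "a' \<le> a" "a \<le> b'" "seg ax t a' b' \<in> interior_ledges M"
    using ledge_exists by (metis along_pt(1,2))
  then show ?thesis using ledge_unique[OF assms l(1), of a] \<open>a < b\<close> by auto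
qed

lemma ledge_interior:
  assumes "is_ledge ax t a b" "a < s" "s < b" shows "pt ax s t \<in> interior (domain M)"
  using assms split_both_interior[of ax "pt ax s t"] unfolding is_ledge_def by auto

lemma ledge_ends:
  assumes l: "is_ledge ax t a b" shows "pt ax a t \<in> verts M" "pt ax b t \<in> verts M"
proof -
  have sp: "split ax True (pt ax a t)" "split ax False (pt ax b t)" "\<not> split ax False (pt ax a t)" "\<not> split ax True (pt ax b t)"
    using l unfolding is_ledge_def by auto
  obtain a' b' where e: "a' < b'" "seg ax t a' b' \<in> interior_edges M" "a' \<le> a" "a < b'"
    using interior_edge_of_split[OF sp(1)] by (metis along_pt(1,2))
  have "a' = a" using split_of_interior_edge(2)[OF e(2,1), of a] sp(3) e by force
  then show "pt ax a t \<in> verts M" using edge_ends_in_verts(1)[of ax t a' b'] e unfolding interior_edges_def by auto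
  obtain a' b' where e: "a' < b'" "seg ax t a' b' \<in> interior_edges M" "a' < b" "b \<le> b'"
    using interior_edge_of_split[OF sp(2)] by (metis along_pt(1,2))
  have "b' = b" using split_of_interior_edge(1)[OF e(2,1), of b] sp(4) e by force
  then show "pt ax b t \<in> verts M" using edge_ends_in_verts(2)[of ax t a' b'] e unfolding interior_edges_def by auto
qed

section \<open>Boundary l-edges\<close>

lemma boundary_ledge_form:
  assumes "l \<in> boundary_ledges M"
  obtains ax t a b where "a < b" "l = seg ax t a b" "l \<subseteq> frontier (domain M)"
proof -
  have l: "segment_of (boundary_edges M) l" using assms unfolding boundary_ledges_def maximal_segments_def by auto
  have sub: "boundary_edges M \<subseteq> edges M" unfolding boundary_edges_def by blast
  have "l \<subseteq> frontier (domain M)" using l unfolding segment_of_def boundary_edges_def by blast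
  then show thesis using segment_shape[OF sub l] that by metis
qed

text \<open>Such a point is interior to a cell or a relative interior point of an interior edge, which has cells on
both sides.\<close>

lemma not_on_boundary_edge_interior:
  assumes "p \<in> domain M" "p \<notin> verts M" "p \<notin> \<Union>(boundary_edges M)"
  shows "p \<in> interior (domain M)"
proof -
  obtain f where f: "f \<in> cells M" "p \<in> f" using assms(1) unfolding domain_def by blast
  show ?thesis
  proof (cases "p \<in> interior f")
    case True
    then show ?thesis using f unfolding domain_def by (meson Union_upper interior_mono subsetD)
  next
    case False
    then have "p \<in> frontier f" using frontier_rectangle[OF rect] f by blast
    then obtain ax a b where e: "a < b" "seg ax (along (\<not> ax) p) a b \<in> edges M" "a < along ax p" "along ax p < b"
      using edge_at_cell_frontier[OF f(1) _ assms(2)] by metis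
    have "p \<in> seg ax (along (\<not> ax) p) a b" using e by (auto simp: seg_def)
    then have int: "seg ax (along (\<not> ax) p) a b \<in> interior_edges M" using e(2) assms(3) unfolding interior_edges_def by blast
    show ?thesis
      using split_both_interior[of ax p] split_of_interior_edge[OF int e(1), of "along ax p"] e by simp
  qed
qed

text \<open>Otherwise a small disc around \<open>q\<close> avoids the boundary edges.  Without the vertices this disc is still
connected, and it would be the disjoint union of two nonempty open sets, its intersections with the
interior and with the exterior of the domain.\<close>

lemma frontier_on_boundary_ledge:
  assumes q: "q \<in> frontier (domain M)"
  shows "\<exists>l\<in>boundary_ledges M. q \<in> l"
proof -
  have sub: "boundary_edges M \<subseteq> edges M" unfolding boundary_edges_def by blast
  have fin: "finite (boundary_edges M)" using finite_subset[OF sub fin_edges] .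
  have "q \<in> \<Union>(boundary_edges M)"
  proof (rule ccontr)
    assume nq: "q \<notin> \<Union>(boundary_edges M)"
    have "closed e" if e: "e \<in> boundary_edges M" for e
    proof -
      have "e \<in> edges M" using e sub by blast
      then obtain ax t a b where "e = seg ax t a b" by (rule edge_form)
      then show ?thesis using compact_seg compact_imp_closed by blast
    qed
    then have "open (- \<Union>(boundary_edges M))" using fin by (intro open_Compl closed_Union) auto
    then obtain \<epsilon> where \<epsilon>: "\<epsilon> > 0" "ball q \<epsilon> \<subseteq> - \<Union>(boundary_edges M)" using nq by (meson ComplI openE)
    define B where "B = ball q \<epsilon> - verts M"
    have "connected B" unfolding B_def
      by (rule connected_open_delete_finite) (auto simp: fin_verts connected_ball)
    have cov: "B \<subseteq> interior (domain M) \<union> - domain M"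
      using not_on_boundary_edge_interior \<epsilon>(2) unfolding B_def by blast
    have meets: "U \<inter> B \<noteq> {}" if "open U" "U \<inter> ball q \<epsilon> \<noteq> {}" for U
    proof
      assume "U \<inter> B = {}"
      then have "U \<inter> ball q \<epsilon> \<subseteq> verts M" unfolding B_def by blast
      then have "finite (U \<inter> ball q \<epsilon>)" using fin_verts finite_subset by blast
      moreover have "open (U \<inter> ball q \<epsilon>)" using that by blast
      ultimately show False using that(2) finite_imp_not_open by blast
    qed
    have qD: "q \<in> domain M" "q \<notin> interior (domain M)" using q unfolding frontier_domain by auto
    obtain f where f: "f \<in> cells M" "q \<in> f" using qD(1) unfolding domain_def by blast
    have "interior f \<subseteq> interior (domain M)" using f(1) unfolding domain_def by (meson Union_upper interior_mono)
    moreover have "q \<in> closure (interior f)" using cell_regular f by blast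
    ultimately have "q \<in> closure (interior (domain M))" using closure_mono by blast
    moreover have "q \<in> ball q \<epsilon>" using \<epsilon>(1) by simp
    ultimately have "ball q \<epsilon> \<inter> closure (interior (domain M)) \<noteq> {}" by blast
    then have "interior (domain M) \<inter> ball q \<epsilon> \<noteq> {}"
      using open_Int_closure_eq_empty[OF open_ball, of q \<epsilon> "interior (domain M)"] by blast
    then have 1: "interior (domain M) \<inter> B \<noteq> {}" using meets by blast
    have "\<not> ball q \<epsilon> \<subseteq> domain M" using qD(2) \<epsilon>(1) by (meson mem_interior)
    then have 2: "- domain M \<inter> B \<noteq> {}" using meets[of "- domain M"] closed_domain by blast
    show False using \<open>connected B\<close> cov 1 2 closed_domain interior_subset[of "domain M"] unfolding connected_def by blast
  qed
  then obtain e where e: "e \<in> boundary_edges M" "q \<in> e" by blast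
  then show ?thesis
    using maximal_segment_exists[OF edge_segment_of[OF e(1) sub] fin] unfolding boundary_ledges_def by blast
qed

end

section \<open>Cells meeting at a point\<close>

context T_mesh
begin

text \<open>If only the two opposite quadrants at \<open>p\<close> were covered, then \<open>f\<close> and \<open>g\<close> would meet in \<open>p\<close> alone
and no other cell would contain \<open>p\<close>.  Hence the function that is 1 from \<open>f\<close> to \<open>g\<close>, -1 back, and
0 on other pairs would be a cocycle.  Its potential distinguishes \<open>f\<close> from \<open>g\<close> but is
constant across all other contacts, which disconnects the interior of the domain.\<close>

lemma no_pinch:
  assumes f: "germ True r t p f" and g: "germ True (\<not> r) (\<not> t) p g"
  shows "\<exists>h. germ True r (\<not> t) p h \<or> germ True (\<not> r) t p h"
proof (rule ccontr)
  assume none: "\<not> ?thesis"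
  have fg: "f \<in> cells M" "p \<in> f" "extends True r f p" "extends False t f p" "g \<in> cells M" "p \<in> g" "extends True (\<not> r) g p" "extends False (\<not> t) g p"
    using f g unfolding germ_def by auto
  have nf: "\<not> extends False (\<not> t) f p" "\<not> extends True (\<not> r) f p" "\<not> extends False t g p" "\<not> extends True r g p"
    using none fg unfolding germ_def by auto
  then have "f \<noteq> g" using fg by auto
  have only: "h = f \<or> h = g" if h: "h \<in> cells M" "p \<in> h" for h
  proof -
    obtain r' t' where rt: "germ True r' t' p h" using germ_ex[OF h, of True] by blast
    then have "(r' = r \<and> t' = t) \<or> (r' = (\<not> r) \<and> t' = (\<not> t))" using none by (cases "r' = r"; cases "t' = t") auto
    then show ?thesis using rt germ_unique f g by blast
  qed
  have single: "q = p" if q: "q \<in> f" "q \<in> g" for q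
  proof -
    have "along True q = along True p"
      using nf(2,4) cell_bounds(2)[OF fg(1), of q True, THEN iffD1, OF q(1)] cell_bounds(2)[OF fg(5), of q True, THEN iffD1, OF q(2)]
        cell_bounds(2)[OF fg(1), of p True, THEN iffD1, OF fg(2)] cell_bounds(2)[OF fg(5), of p True, THEN iffD1, OF fg(6)]
      unfolding extends_def by (cases r) auto
    moreover have "along False q = along False p"
      using nf(1,3) cell_bounds(2)[OF fg(1), of q False, THEN iffD1, OF q(1)] cell_bounds(2)[OF fg(5), of q False, THEN iffD1, OF q(2)]
        cell_bounds(2)[OF fg(1), of p False, THEN iffD1, OF fg(2)] cell_bounds(2)[OF fg(5), of p False, THEN iffD1, OF fg(6)]
      unfolding extends_def by (cases t) auto
    ultimately show ?thesis using point_eq_iff[of q p True] by simp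
  qed
  have np: "p \<notin> interior (domain M)" using interior_germ[of p True r "\<not> t"] none by blast
  \<comment> \<open>A common point of three cells that include \<open>f\<close> and \<open>g\<close> is \<open>p\<close>, and then the third cell is one of these two.\<close>
  define J :: "point set \<Rightarrow> point set \<Rightarrow> int"
    where "J a b = (if a = f \<and> b = g then 1 else if a = g \<and> b = f then -1 else 0)" for a b
  have "\<exists>u. \<forall>a\<in>cells M. \<forall>b\<in>cells M. a \<inter> b \<noteq> {} \<longrightarrow> u a - u b = J a b"
  proof (rule cech_integer)
    fix a b c assume abc: "a \<in> cells M" "b \<in> cells M" "c \<in> cells M" "a \<inter> b \<inter> c \<noteq> {}"
    show "J a b + J b c = J a c"
    proof (cases "f \<in> {a, b, c} \<and> g \<in> {a, b, c}")
      case True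
      obtain q where q: "q \<in> a" "q \<in> b" "q \<in> c" using abc(4) by blast
      then have "q \<in> f" "q \<in> g" using True by auto
      then have "q = p" using single by blast
      then have "a \<in> {f, g}" "b \<in> {f, g}" "c \<in> {f, g}" using only abc q by blast+
      then show ?thesis using \<open>f \<noteq> g\<close> unfolding J_def by (elim insertE emptyE) simp_all
    next
      case False
      then consider "f \<noteq> a" "f \<noteq> b" "f \<noteq> c" | "g \<noteq> a" "g \<noteq> b" "g \<noteq> c" by blast
      then show ?thesis unfolding J_def by cases simp_all
    qed
  qed (use simply in \<open>simp_all add: fin_cells cell_compact cell_convex cell_nonempty domain_def\<close>)
  then obtain u where u: "\<And>a b. a \<in> cells M \<Longrightarrow> b \<in> cells M \<Longrightarrow> a \<inter> b \<noteq> {} \<Longrightarrow> u a - u b = J a b" by blast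
  have "f \<inter> g \<noteq> {}" using fg(2,6) by blast
  then have ufg: "u f \<noteq> u g" using u[of f g] fg(1,5) unfolding J_def by simp
  define A where "A = \<Union>{h\<in>cells M. u h = u f}"
  define B where "B = \<Union>{h\<in>cells M. u h \<noteq> u f}"
  have cl: "closed A" "closed B" unfolding A_def B_def using fin_cells cell_closed by (auto intro!: closed_Union)
  have "interior (domain M) \<subseteq> A \<union> B" using interior_subset[of "domain M"] unfolding A_def B_def domain_def by blast
  moreover have "A \<inter> B \<inter> interior (domain M) = {}"
  proof (rule ccontr)
    assume "A \<inter> B \<inter> interior (domain M) \<noteq> {}"
    then obtain q a b where q: "q \<in> interior (domain M)" "a \<in> cells M" "b \<in> cells M" "q \<in> a" "q \<in> b" "u a = u f" "u b \<noteq> u f"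
      unfolding A_def B_def by blast
    then have "a \<inter> b \<noteq> {}" by blast
    then have "J a b \<noteq> 0" using u[of a b] q by simp
    then have "q = p" using single q unfolding J_def by (auto split: if_splits)
    then show False using q(1) np by simp
  qed
  moreover have ne: "interior h \<noteq> {}" "interior h \<subseteq> interior (domain M)" if "h \<in> cells M" for h
    using cell_regular[OF that] cell_nonempty[OF that] that unfolding domain_def by (auto simp: Union_upper interior_mono)
  have "A \<inter> interior (domain M) \<noteq> {}"
    using ne[OF fg(1)] interior_subset[of f] fg(1) unfolding A_def by blast
  moreover have "B \<inter> interior (domain M) \<noteq> {}"
    using ne[OF fg(5)] interior_subset[of g] fg(5) ufg unfolding B_def by fastforce
  ultimately show False using interior_connected cl unfolding connected_closed by blast
qed

text \<open>Neighbouring quadrants at \<open>p\<close> lie in the same cell or in cells with a common side.  Opposite ones are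
linked through a third quadrant.\<close>

lemma linked_at_point:
  assumes R: "\<And>f. R f f" "\<And>f g. R f g \<Longrightarrow> R g f" "\<And>f g h. R f g \<Longrightarrow> R g h \<Longrightarrow> R f h"
    and ab: "\<And>ax f g. f \<in> cells M \<Longrightarrow> g \<in> cells M \<Longrightarrow> p \<in> f \<Longrightarrow> p \<in> g \<Longrightarrow> above ax f g \<Longrightarrow> R f g"
    and fg: "f \<in> cells M" "g \<in> cells M" "p \<in> f" "p \<in> g"
  shows "R f g"
proof -
  have R1: "R f g" if "germ ax r True p f" "germ ax r False p g" for ax r f g
    using that above_of_germs[OF that] ab[of f g ax] R(1) unfolding germ_def by (cases "f = g") auto
  have R2: "R f g" if "germ ax r t p f" "germ ax r t' p g" for ax r t t' f g
  proof (cases "t = t'")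
    case True
    then show ?thesis using germ_unique[of ax r t p f g] that R(1) by simp
  next
    case False
    then show ?thesis using R1[of ax r f g] R1[of ax r g f] R(2) that by (cases t) auto
  qed
  have R3: "R f g" if "germ ax r t p f" "germ ax r' t p g" for ax r r' t f g
    using R2[of "\<not> ax" t r f r' g] that unfolding germ_swap .
  obtain r t where f: "germ True r t p f" using germ_ex[OF fg(1,3), of True] by blast
  obtain r' t' where g: "germ True r' t' p g" using germ_ex[OF fg(2,4), of True] by blast
  show ?thesis
  proof (cases "r = r' \<or> t = t'")
    case True
    then show ?thesis using R2[OF f, of t' g] R3[OF f, of r' g] g by auto
  next
    case False
    then have "r' = (\<not> r)" "t' = (\<not> t)" by auto
    then obtain h where "germ True r t' p h \<or> germ True r' t p h" using no_pinch[OF f] g by blast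
    then show ?thesis using R2[OF f, of t' h] R3[of True r t' h r' g] R3[OF f, of r' h] R2[of True r' t h t' g] g R(3) by blast
  qed
qed

lemma above_meet:
  assumes ab: "above ax f g" and fg: "f \<in> cells M" "g \<in> cells M" and p: "p \<in> f" "p \<in> g"
  shows "along (\<not> ax) p = lo (\<not> ax) f"
  using ab cell_bounds(2)[OF fg(1), of p ax, THEN iffD1, OF p(1)] cell_bounds(2)[OF fg(2), of p ax, THEN iffD1, OF p(2)]
  unfolding above_def by linarith

lemma above_common:
  assumes ab: "above ax f g" and fg: "f \<in> cells M" "g \<in> cells M"
  shows "max (lo ax f) (lo ax g) < min (hi ax f) (hi ax g)"
    and "max (lo ax f) (lo ax g) \<le> s \<Longrightarrow> s \<le> min (hi ax f) (hi ax g) \<Longrightarrow>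
      pt ax s (lo (\<not> ax) f) \<in> f \<and> pt ax s (lo (\<not> ax) f) \<in> g"
    and "max (lo ax f) (lo ax g) \<le> s \<Longrightarrow> s < min (hi ax f) (hi ax g) \<Longrightarrow>
      germ ax True True (pt ax s (lo (\<not> ax) f)) f \<and> germ ax True False (pt ax s (lo (\<not> ax) f)) g"
    and "max (lo ax f) (lo ax g) < s \<Longrightarrow> s \<le> min (hi ax f) (hi ax g) \<Longrightarrow>
      germ ax False True (pt ax s (lo (\<not> ax) f)) f \<and> germ ax False False (pt ax s (lo (\<not> ax) f)) g"
proof -
  note b = cell_bounds(1)[OF fg(1)] cell_bounds(1)[OF fg(2)]
  show "max (lo ax f) (lo ax g) < min (hi ax f) (hi ax g)" using ab b unfolding above_def by auto
  show *: "pt ax s (lo (\<not> ax) f) \<in> f \<and> pt ax s (lo (\<not> ax) f) \<in> g"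
    if "max (lo ax f) (lo ax g) \<le> s" "s \<le> min (hi ax f) (hi ax g)" for s
    using ab b[of "\<not> ax"] that unfolding above_def cell_bounds(2)[OF fg(1), where ax = ax] cell_bounds(2)[OF fg(2), where ax = ax] by auto
  show "germ ax True True (pt ax s (lo (\<not> ax) f)) f \<and> germ ax True False (pt ax s (lo (\<not> ax) f)) g"
    if "max (lo ax f) (lo ax g) \<le> s" "s < min (hi ax f) (hi ax g)"
    using that *[of s] ab b[of "\<not> ax"] fg unfolding germ_def extends_def above_def by auto
  show "germ ax False True (pt ax s (lo (\<not> ax) f)) f \<and> germ ax False False (pt ax s (lo (\<not> ax) f)) g"
    if "max (lo ax f) (lo ax g) < s" "s \<le> min (hi ax f) (hi ax g)"
    using that *[of s] ab b[of "\<not> ax"] fg unfolding germ_def extends_def above_def by auto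
qed

end

section \<open>Splines as coefficient families\<close>

text \<open>Splines as families of polynomials, one for each cell, with coefficients outside the mesh or of too high
degree set to 0 so that a spline has only one such family.\<close>

definition coeff_space :: "nat \<Rightarrow> mesh \<Rightarrow> coeffs set" where
  "coeff_space d M = {c. (\<forall>f i j. \<not> (f \<in> cells M \<and> i \<le> d \<and> j \<le> d) \<longrightarrow> c (f, i, j) = 0) \<and>
     (\<forall>ax. \<forall>f\<in>cells M. \<forall>g\<in>cells M. above ax f g \<longrightarrow> smooth_jump d ax (lo (\<not> ax) f) c f g)}"

definition assemble :: "nat \<Rightarrow> mesh \<Rightarrow> coeffs \<Rightarrow> point \<Rightarrow> real" where
  "assemble d M c p = (if p \<in> domain M then piece d c (SOME f. f \<in> cells M \<and> p \<in> f) p else 0)"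

lemma piece_add: "piece d (c + c') f p = piece d c f p + piece d c' f p"
  by (simp add: piece_def sum.distrib algebra_simps)

lemma piece_scale: "piece d (k *\<^sub>R c) f p = k * piece d c f p"
  by (simp add: piece_def sum_distrib_left mult_ac)

lemma linear_assemble: "linear (assemble d M)"
  by (rule linearI) (auto simp: assemble_def fun_eq_iff piece_add piece_scale)

lemma coeff_along_add: "coeff_along ax (c + c') f m n = coeff_along ax c f m n + coeff_along ax c' f m n"
  and coeff_along_scale: "coeff_along ax (k *\<^sub>R c) f m n = k * coeff_along ax c f m n"
  by (auto simp: coeff_along_def)

lemma subspace_coeff_space: "subspace (coeff_space d M)"
proof -
  have a: "smooth_jump d ax t (c + c') f g" if "smooth_jump d ax t c f g" "smooth_jump d ax t c' f g" for ax t c c' f g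
    unfolding smooth_jump_def
  proof (intro allI impI)
    fix m n assume mn: "m \<le> d" "n \<le> d"
    show "coeff_along ax (c + c') f m n - coeff_along ax (c + c') g m n = beta d t n * (coeff_along ax (c + c') f m d - coeff_along ax (c + c') g m d)"
      using that[unfolded smooth_jump_def, rule_format, OF mn] unfolding coeff_along_add by (simp only: algebra_simps)
  qed
  have s: "smooth_jump d ax t (k *\<^sub>R c) f g" if "smooth_jump d ax t c f g" for ax t c f g k
    unfolding smooth_jump_def
  proof (intro allI impI)
    fix m n assume mn: "m \<le> d" "n \<le> d"
    have "coeff_along ax (k *\<^sub>R c) f m n - coeff_along ax (k *\<^sub>R c) g m n = k * (coeff_along ax c f m n - coeff_along ax c g m n)"
      unfolding coeff_along_scale by (simp add: algebra_simps)
    also have "\<dots> = k * (beta d t n * (coeff_along ax c f m d - coeff_along ax c g m d))"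
      using that[unfolded smooth_jump_def, rule_format, OF mn] by simp
    finally show "coeff_along ax (k *\<^sub>R c) f m n - coeff_along ax (k *\<^sub>R c) g m n = beta d t n * (coeff_along ax (k *\<^sub>R c) f m d - coeff_along ax (k *\<^sub>R c) g m d)"
      unfolding coeff_along_scale by (simp add: algebra_simps)
  qed
  have z: "smooth_jump d ax t 0 f g" for ax t f g by (simp add: smooth_jump_def coeff_along_def)
  show ?thesis unfolding subspace_def
  proof (intro conjI ballI allI)
    show "0 \<in> coeff_space d M" unfolding coeff_space_def using z by simp
    show "x + y \<in> coeff_space d M" if "x \<in> coeff_space d M" "y \<in> coeff_space d M" for x y
      using that a unfolding coeff_space_def by auto
    show "k *\<^sub>R x \<in> coeff_space d M" if "x \<in> coeff_space d M" for k x
      using that s unfolding coeff_space_def by auto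
  qed
qed

context T_mesh
begin

text \<open>Agreement on common sides suffices, because at a common corner two cells are linked through cells with
common sides.\<close>

lemma smooth_iff_derivs_agree:
  assumes d: "d \<ge> 1"
  shows "(\<forall>ax. \<forall>f\<in>cells M. \<forall>g\<in>cells M. above ax f g \<longrightarrow> smooth_jump d ax (lo (\<not> ax) f) c f g) \<longleftrightarrow>
    (\<forall>ax. \<forall>j<d. \<forall>f\<in>cells M. \<forall>g\<in>cells M. \<forall>p\<in>f \<inter> g. piece_deriv d ax j c f p = piece_deriv d ax j c g p)" (is "?L \<longleftrightarrow> ?R")
proof
  assume L: ?L
  show ?R
  proof (intro allI impI ballI)
    fix ax j f g p assume j: "j < d" and fg: "f \<in> cells M" "g \<in> cells M" "p \<in> f \<inter> g"
    have "\<forall>ax. \<forall>j<d. piece_deriv d ax j c f p = piece_deriv d ax j c g p"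
    proof (rule linked_at_point[of "\<lambda>f g. \<forall>ax. \<forall>j<d. piece_deriv d ax j c f p = piece_deriv d ax j c g p" p f g])
      fix ax f g assume *: "f \<in> cells M" "g \<in> cells M" "p \<in> f" "p \<in> g" "above ax f g"
      have sj: "smooth_jump d ax (lo (\<not> ax) f) c f g" using L * by blast
      have al: "along (\<not> ax) p = lo (\<not> ax) f" using above_meet[OF *(5,1,2,3,4)] .
      show "\<forall>ax. \<forall>j<d. piece_deriv d ax j c f p = piece_deriv d ax j c g p"
      proof (intro allI impI)
        fix ax' j assume "j < d"
        then show "piece_deriv d ax' j c f p = piece_deriv d ax' j c g p"
          using smooth_jump_imp_deriv_eq[OF sj al] by (cases "ax' = ax") (auto simp: neq_iff)
      qed
    qed (use fg in auto)
    then show "piece_deriv d ax j c f p = piece_deriv d ax j c g p" using j by blast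
  qed
next
  assume R: ?R
  show ?L
  proof (intro allI impI ballI)
    fix ax f g assume fg: "f \<in> cells M" "g \<in> cells M" and ab: "above ax f g"
    show "smooth_jump d ax (lo (\<not> ax) f) c f g"
      by (rule deriv_eq_imp_smooth_jump[OF d above_common(1)[OF ab fg]]) (use R above_common(2)[OF ab fg] fg in blast)
  qed
qed

lemma cont_order_iff_derivs_agree:
  assumes d: "d \<ge> 1" and s: "\<And>f p. f \<in> cells M \<Longrightarrow> p \<in> f \<Longrightarrow> s p = piece d c f p"
  shows "cont_order (d - 1) (pt ax 1 0) (domain M) s \<longleftrightarrow>
    (\<forall>j<d. \<forall>f\<in>cells M. \<forall>g\<in>cells M. \<forall>p\<in>f \<inter> g. piece_deriv d ax j c f p = piece_deriv d ax j c g p)"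
proof -
  have "cont_order (d - 1) (pt ax 1 0) (domain M) s \<longleftrightarrow>
    (\<forall>j\<le>d - 1. \<forall>f\<in>cells M. \<forall>g\<in>cells M. \<forall>p\<in>f \<inter> g. piece_deriv d ax j c f p = piece_deriv d ax j c g p)"
    unfolding domain_def
    by (rule cont_order_glued_iff)
      (auto simp: fin_cells cell_closed cell_convex continuous_on_piece_deriv DERIV_piece_deriv piece_deriv_0 s intro: subsetD[OF cell_regular])
  moreover have "j \<le> d - 1 \<longleftrightarrow> j < d" for j using d by auto
  ultimately show ?thesis by simp
qed

lemma assemble_on_cell:
  assumes "d \<ge> 1" "c \<in> coeff_space d M" "f \<in> cells M" "p \<in> f"
  shows "assemble d M c p = piece d c f p"
proof -
  define g where "g = (SOME f. f \<in> cells M \<and> p \<in> f)"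
  have g: "g \<in> cells M \<and> p \<in> g" unfolding g_def by (rule someI_ex) (use assms in auto)
  have "\<forall>ax. \<forall>j<d. \<forall>f\<in>cells M. \<forall>g\<in>cells M. \<forall>p\<in>f \<inter> g. piece_deriv d ax j c f p = piece_deriv d ax j c g p"
    using assms(2) unfolding smooth_iff_derivs_agree[OF assms(1), symmetric] coeff_space_def by blast
  then have "\<forall>p\<in>g \<inter> f. piece_deriv d True 0 c g p = piece_deriv d True 0 c f p" using g assms(1,3) by (metis (no_types, lifting) less_le_trans zero_less_one)
  then have "piece_deriv d True 0 c g p = piece_deriv d True 0 c f p" using g assms(4) by blast
  moreover have "p \<in> domain M" using assms(3,4) unfolding domain_def by blast
  ultimately show ?thesis unfolding assemble_def piece_deriv_0 g_def by simp
qed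

text \<open>Smoothness in each direction means agreement of the derivatives of the pieces, which is the cofactor
condition on common sides.\<close>

lemma spline_space_eq_assemble:
  assumes d: "d \<ge> 1" shows "spline_space d M = assemble d M ` coeff_space d M"
proof
  have e: "(1, 0) = pt True 1 0" "(0, 1) = pt False 1 0" by (auto simp: pt_def)
  show "spline_space d M \<subseteq> assemble d M ` coeff_space d M"
  proof
    fix s assume s: "s \<in> spline_space d M"
    have "\<forall>f\<in>cells M. \<exists>c. \<forall>x y. (x, y) \<in> f \<longrightarrow> s (x, y) = (\<Sum>i\<le>d. \<Sum>j\<le>d. c i j * x ^ i * y ^ j)"
      using s unfolding spline_space_def bidegree_poly_on_def by blast
    then have "\<exists>k. \<forall>f\<in>cells M. \<forall>x y. (x, y) \<in> f \<longrightarrow> s (x, y) = (\<Sum>i\<le>d. \<Sum>j\<le>d. k f i j * x ^ i * y ^ j)"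
      by (rule bchoice)
    then obtain k where k: "\<And>f x y. f \<in> cells M \<Longrightarrow> (x, y) \<in> f \<Longrightarrow> s (x, y) = (\<Sum>i\<le>d. \<Sum>j\<le>d. k f i j * x ^ i * y ^ j)"
      by blast
    define c :: coeffs where "c = (\<lambda>(f, i, j). if f \<in> cells M \<and> i \<le> d \<and> j \<le> d then k f i j else 0)"
    have sc: "s p = piece d c f p" if "f \<in> cells M" "p \<in> f" for f p
      using k[OF that(1), of "fst p" "snd p"] that unfolding piece_def c_def by simp
    have "cont_order (d - 1) (pt ax 1 0) (domain M) s" for ax
      using s unfolding spline_space_def e by (cases ax) auto
    then have "\<forall>ax. \<forall>j<d. \<forall>f\<in>cells M. \<forall>g\<in>cells M. \<forall>p\<in>f \<inter> g. piece_deriv d ax j c f p = piece_deriv d ax j c g p"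
      using cont_order_iff_derivs_agree[OF d sc] by blast
    then have c: "c \<in> coeff_space d M"
      unfolding smooth_iff_derivs_agree[OF d, symmetric] coeff_space_def by (auto simp: c_def)
    have "s = assemble d M c"
    proof
      fix p
      show "s p = assemble d M c p"
      proof (cases "p \<in> domain M")
        case True
        then obtain f where "f \<in> cells M" "p \<in> f" unfolding domain_def by blast
        then show ?thesis using assemble_on_cell[OF d c] sc by simp
      next
        case False
        then show ?thesis using s unfolding spline_space_def assemble_def by (cases p) simp
      qed
    qed
    then show "s \<in> assemble d M ` coeff_space d M" using c by blast
  qed
  show "assemble d M ` coeff_space d M \<subseteq> spline_space d M"
  proof clarify
    fix c assume c: "c \<in> coeff_space d M"
    have "\<forall>ax. \<forall>j<d. \<forall>f\<in>cells M. \<forall>g\<in>cells M. \<forall>p\<in>f \<inter> g. piece_deriv d ax j c f p = piece_deriv d ax j c g p"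
      using c unfolding smooth_iff_derivs_agree[OF d, symmetric] coeff_space_def by blast
    then have "cont_order (d - 1) (pt ax 1 0) (domain M) (assemble d M c)" for ax
      using cont_order_iff_derivs_agree[OF d assemble_on_cell[OF d c]] by blast
    moreover have "bidegree_poly_on d f (assemble d M c)" if "f \<in> cells M" for f
      unfolding bidegree_poly_on_def
      by (intro exI[of _ "\<lambda>i j. c (f, i, j)"]) (auto simp: assemble_on_cell[OF d c that] piece_def)
    ultimately show "assemble d M c \<in> spline_space d M"
      unfolding spline_space_def e by (auto simp: assemble_def)
  qed
qed

lemma piece_zero_coeffs:
  assumes f: "f \<in> cells M" and z: "\<And>p. p \<in> f \<Longrightarrow> piece d c f p = 0" and ij: "i \<le> d" "j \<le> d"
  shows "c (f, i, j) = 0"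
proof -
  have "(\<Sum>i\<le>d. c (f, i, j) * x ^ i) = 0" if x: "lo True f \<le> x" "x \<le> hi True f" for x
  proof -
    have "(\<Sum>j\<le>d. (\<Sum>i\<le>d. c (f, i, j) * x ^ i) * y ^ j) = 0" if y: "lo False f \<le> y" "y \<le> hi False f" for y
    proof -
      have "(x, y) \<in> f" using x y cell_bounds(2)[OF f, of "(x, y)" True] by (simp add: along_def)
      then have "piece d c f (x, y) = 0" using z by blast
      then show ?thesis unfolding piece_def
        by (subst (asm) sum.swap) (simp add: sum_distrib_right)
    qed
    then show ?thesis
      using polyfun_zero_on_interval[OF cell_bounds(1)[OF f], of False "\<lambda>j. \<Sum>i\<le>d. c (f, i, j) * x ^ i" d j] ij by blast
  qed
  then show ?thesis
    using polyfun_zero_on_interval[OF cell_bounds(1)[OF f], of True "\<lambda>i. c (f, i, j)" d i] ij by blast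
qed

lemma inj_on_assemble:
  assumes d: "d \<ge> 1" shows "inj_on (assemble d M) (coeff_space d M)"
proof (rule inj_onI)
  fix c c' assume c: "c \<in> coeff_space d M" "c' \<in> coeff_space d M" and eq: "assemble d M c = assemble d M c'"
  define e where "e = c - c'"
  have e: "e \<in> coeff_space d M" unfolding e_def using c subspace_coeff_space subspace_diff by blast
  have z: "assemble d M e = 0" unfolding e_def using linear_diff[OF linear_assemble] eq by simp
  have "e (f, i, j) = 0" for f i j
  proof (cases "f \<in> cells M \<and> i \<le> d \<and> j \<le> d")
    case True
    then show ?thesis using assemble_on_cell[OF d e, of f] z piece_zero_coeffs[of f d e i j] by auto
  next
    case False
    then show ?thesis using e unfolding coeff_space_def by blast
  qed
  then have "e = 0" by (auto simp: fun_eq_iff)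
  then show "c = c'" unfolding e_def by simp
qed

lemma dim_spline_space:
  assumes "d \<ge> 1" shows "dim (spline_space d M) = dim (coeff_space d M)"
  unfolding spline_space_eq_assemble[OF assms]
  by (rule dim_image_inj_on[OF linear_assemble subspace_coeff_space inj_on_assemble[OF assms]])

end

section \<open>Cofactors along l-edges\<close>

context T_mesh
begin

definition quadrant_cell :: "bool \<Rightarrow> bool \<Rightarrow> bool \<Rightarrow> point \<Rightarrow> point set" where
  "quadrant_cell ax r t q = (THE f. germ ax r t q f)"

lemma quadrant_cell_eq: "germ ax r t q f \<Longrightarrow> quadrant_cell ax r t q = f"
  unfolding quadrant_cell_def by (rule the_equality) (assumption, erule (1) germ_unique)

lemma quadrant_cell_swap: "quadrant_cell (\<not> ax) t r q = quadrant_cell ax r t q"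
  unfolding quadrant_cell_def germ_swap ..

text \<open>The alternating sum of the coefficients of \<open>x ^ d * y ^ d\<close> over the four quadrants.  It is the number
\<open>\<delta>\<close> attached to an interior vertex in the conformality conditions.\<close>

definition vertex_cofactor :: "nat \<Rightarrow> coeffs \<Rightarrow> point \<Rightarrow> real" where
  "vertex_cofactor d c q = c (quadrant_cell True True True q, d, d) - c (quadrant_cell True True False q, d, d)
     - c (quadrant_cell True False True q, d, d) + c (quadrant_cell True False False q, d, d)"

lemma vertex_cofactor_eq:
  "vertex_cofactor d c q = c (quadrant_cell ax True True q, d, d) - c (quadrant_cell ax True False q, d, d)
     - c (quadrant_cell ax False True q, d, d) + c (quadrant_cell ax False False q, d, d)"
  using quadrant_cell_swap[of True] by (cases ax) (simp_all add: vertex_cofactor_def)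

text \<open>The coefficient of exponent \<open>m\<close> of the smoothing cofactor along the ray from \<open>q\<close> in direction
\<open>r\<close>, the side with positive coordinate across the axis counted positively.\<close>

definition cofactor :: "nat \<Rightarrow> coeffs \<Rightarrow> bool \<Rightarrow> bool \<Rightarrow> point \<Rightarrow> nat \<Rightarrow> real" where
  "cofactor d c ax r q m = coeff_along ax c (quadrant_cell ax r True q) m d - coeff_along ax c (quadrant_cell ax r False q) m d"

lemma cofactor_unsplit:
  assumes "q \<in> interior (domain M)" "\<not> split ax r q" shows "cofactor d c ax r q m = 0"
proof -
  obtain f g where "germ ax r True q f" "germ ax r False q g" using interior_germ[OF assms(1)] by metis
  moreover then have "f = g" using assms(2) unfolding split_def by blast
  ultimately show ?thesis unfolding cofactor_def using quadrant_cell_eq by simp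
qed

text \<open>Going around \<open>q\<close>, the difference of the two cofactors along the axis equals the difference of two jumps
across the perpendicular line, and these jumps are multiples of \<open>beta d (along ax q)\<close>.\<close>

lemma cofactor_jump:
  assumes c: "c \<in> coeff_space d M" and q: "q \<in> interior (domain M)" and m: "m \<le> d"
  shows "cofactor d c ax True q m - cofactor d c ax False q m = beta d (along ax q) m * vertex_cofactor d c q"
proof -
  have J: "coeff_along ax c (quadrant_cell ax True t q) m d - coeff_along ax c (quadrant_cell ax False t q) m d
      = beta d (along ax q) m * (c (quadrant_cell ax True t q, d, d) - c (quadrant_cell ax False t q, d, d))" for t
  proof -
    obtain f where f: "germ ax True t q f" using interior_germ[OF q] by blast
    obtain g where g: "germ ax False t q g" using interior_germ[OF q] by blast
    have e: "quadrant_cell ax True t q = f" "quadrant_cell ax False t q = g" using quadrant_cell_eq f g by auto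
    show ?thesis
    proof (cases "f = g")
      case False
      have "germ (\<not> ax) t True q f" "germ (\<not> ax) t False q g" using f g unfolding germ_swap .
      then have ab: "above (\<not> ax) f g" "along ax q = lo ax f" using above_of_germs[of "\<not> ax" t q f g] False by simp_all
      have "f \<in> cells M" "g \<in> cells M" using f g unfolding germ_def by auto
      then have "smooth_jump d (\<not> ax) (lo (\<not> \<not> ax) f) c f g" using c ab(1) unfolding coeff_space_def by blast
      then have "coeff_along (\<not> ax) c f d m - coeff_along (\<not> ax) c g d m = beta d (lo ax f) m * (coeff_along (\<not> ax) c f d d - coeff_along (\<not> ax) c g d d)"
        using m unfolding smooth_jump_def not_not by blast
      then show ?thesis unfolding e coeff_along_not ab(2) by (simp add: coeff_along_def)
    qed (simp add: e)
  qed
  show ?thesis using J[of True] J[of False] unfolding cofactor_def vertex_cofactor_eq[of d c q ax] by (simp add: algebra_simps)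
qed

text \<open>At such a point no edge leaves in one of the two axis directions, so the quadrants on the two sides of
that axis lie in the same cells and the sum cancels.\<close>

lemma vertex_cofactor_not_vert:
  assumes "q \<in> interior (domain M)" "q \<notin> verts M" shows "vertex_cofactor d c q = 0"
proof -
  have "\<exists>ax. \<forall>r. \<not> split ax r q"
  proof (rule ccontr)
    assume "\<not> ?thesis"
    then obtain r r' where "split True r q" "split (\<not> True) r' q" by blast
    then show False using split_imp_vert assms(2) by blast
  qed
  then obtain ax where "\<And>r. \<not> split ax r q" by blast
  moreover have "\<exists>f. germ ax r t q f" for r t using interior_germ[OF assms(1)] .
  ultimately have "quadrant_cell ax r True q = quadrant_cell ax r False q" for r unfolding split_def by (metis quadrant_cell_eq)
  then show ?thesis unfolding vertex_cofactor_eq[of d c q ax] by simp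
qed

text \<open>The vertices of the whole line are included; sums are restricted to intervals of coordinates.\<close>

definition vert_coords :: "bool \<Rightarrow> real \<Rightarrow> real set" where
  "vert_coords ax t = {x. pt ax x t \<in> verts M}"

lemma finite_vert_coords [simp]: "finite (vert_coords ax t)"
proof -
  have "vert_coords ax t \<subseteq> along ax ` verts M" unfolding vert_coords_def by (force intro: rev_image_eqI)
  then show ?thesis using fin_verts finite_subset by blast
qed

lemma germ_shift_right:
  assumes "germ ax True \<tau> (pt ax s t) f" "s < s'"
  shows "s' < hi ax f \<Longrightarrow> germ ax True \<tau> (pt ax s' t) f" "s' \<le> hi ax f \<Longrightarrow> germ ax False \<tau> (pt ax s' t) f"
proof -
  have f: "f \<in> cells M" "pt ax s t \<in> f" "s < hi ax f" "extends (\<not> ax) \<tau> f (pt ax s t)"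
    using assms unfolding germ_def extends_def by auto
  note b = cell_bounds(2)[OF f(1), of "pt ax s t" ax, THEN iffD1, OF f(2)]
  have "extends (\<not> ax) \<tau> f (pt ax s' t)" using f(4) unfolding extends_def along_pt .
  moreover have "pt ax s' t \<in> f" if "s' \<le> hi ax f" using that b assms(2) cell_bounds(2)[OF f(1), of "pt ax s' t" ax] by simp
  moreover have "extends ax False f (pt ax s' t)" using b assms(2) unfolding extends_def by simp
  moreover have "extends ax True f (pt ax s' t)" if "s' < hi ax f" using that unfolding extends_def by simp
  ultimately show "s' < hi ax f \<Longrightarrow> germ ax True \<tau> (pt ax s' t) f" "s' \<le> hi ax f \<Longrightarrow> germ ax False \<tau> (pt ax s' t) f"
    using f(1) unfolding germ_def by auto
qed

lemma germ_shift_left: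
  assumes "germ ax False \<tau> (pt ax s t) f" "s' < s"
  shows "lo ax f < s' \<Longrightarrow> germ ax False \<tau> (pt ax s' t) f" "lo ax f \<le> s' \<Longrightarrow> germ ax True \<tau> (pt ax s' t) f"
proof -
  have f: "f \<in> cells M" "pt ax s t \<in> f" "lo ax f < s" "extends (\<not> ax) \<tau> f (pt ax s t)"
    using assms unfolding germ_def extends_def by auto
  note b = cell_bounds(2)[OF f(1), of "pt ax s t" ax, THEN iffD1, OF f(2)]
  have "extends (\<not> ax) \<tau> f (pt ax s' t)" using f(4) unfolding extends_def along_pt .
  moreover have "pt ax s' t \<in> f" if "lo ax f \<le> s'" using that b assms(2) cell_bounds(2)[OF f(1), of "pt ax s' t" ax] by simp
  moreover have "extends ax True f (pt ax s' t)" using b assms(2) unfolding extends_def by simp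
  moreover have "extends ax False f (pt ax s' t)" if "lo ax f < s'" using that unfolding extends_def by simp
  ultimately show "lo ax f < s' \<Longrightarrow> germ ax False \<tau> (pt ax s' t) f" "lo ax f \<le> s' \<Longrightarrow> germ ax True \<tau> (pt ax s' t) f"
    using f(1) unfolding germ_def by auto
qed

lemma cofactor_just_left:
  assumes "germ ax False True (pt ax s t) f" "germ ax False False (pt ax s t) g" "a < s"
  shows "\<exists>s1. a < s1 \<and> s1 < s \<and> (\<forall>x\<in>vert_coords ax t. x < s \<longrightarrow> x < s1) \<and>
    (\<forall>s'. s1 \<le> s' \<and> s' < s \<longrightarrow> cofactor d c ax True (pt ax s' t) m = cofactor d c ax False (pt ax s t) m)"
proof -
  have "max (max (lo ax f) (lo ax g)) a < s" using assms unfolding germ_def extends_def by auto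
  then obtain s1 where s1: "max (max (lo ax f) (lo ax g)) a < s1" "s1 < s" "\<forall>x\<in>vert_coords ax t. x < s \<longrightarrow> x < s1"
    using finite_gap_left[OF finite_vert_coords] by blast
  have "cofactor d c ax True (pt ax s' t) m = cofactor d c ax False (pt ax s t) m" if "s1 \<le> s'" "s' < s" for s'
  proof -
    have "germ ax True True (pt ax s' t) f" "germ ax True False (pt ax s' t) g"
      using germ_shift_left(2)[OF assms(1)] germ_shift_left(2)[OF assms(2)] s1 that by auto
    then show ?thesis unfolding cofactor_def using assms quadrant_cell_eq by simp
  qed
  then show ?thesis using s1 by (intro exI[of _ s1]) auto
qed

text \<open>The cofactor minus the sum is locally constant in \<open>s\<close>: between vertices the cells on both sides do not
change, and at a vertex both terms jump by the same amount.\<close>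

lemma cofactor_along:
  assumes l: "is_ledge ax t a b" and c: "c \<in> coeff_space d M" and m: "m \<le> d" and s: "a \<le> s" "s < b"
  shows "cofactor d c ax True (pt ax s t) m =
    cofactor d c ax True (pt ax a t) m + (\<Sum>x\<in>vert_coords ax t \<inter> {a<..s}. beta d x m * vertex_cofactor d c (pt ax x t))"
proof -
  \<comment> \<open>The interval is half open: the starting value already includes the jump at \<open>a\<close>.\<close>
  define G where "G s = cofactor d c ax True (pt ax s t) m - (\<Sum>x\<in>vert_coords ax t \<inter> {a<..s}. beta d x m * vertex_cofactor d c (pt ax x t))" for s
  have "G a = G s"
  proof (rule connected_local_const[where A = "{a..<b}" and f = G])
    show "\<forall>s\<in>{a..<b}. \<forall>\<^sub>F s' in at s within {a..<b}. G s = G s'"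
    proof
      fix s assume s: "s \<in> {a..<b}"
      then have "split ax True (pt ax s t)" using l unfolding is_ledge_def by auto
      then obtain f g where fg: "germ ax True True (pt ax s t) f" "germ ax True False (pt ax s t) g"
        unfolding split_def by blast
      then have "s < min (hi ax f) (hi ax g)" unfolding germ_def extends_def by auto
      then obtain s2 where s2: "s < s2" "s2 < min (hi ax f) (hi ax g)" "\<forall>x\<in>vert_coords ax t. s < x \<longrightarrow> s2 < x"
        using finite_gap_right[OF finite_vert_coords] by blast
      have right: "G s = G s'" if s': "s < s'" "s' < s2" for s'
      proof -
        have "germ ax True True (pt ax s' t) f" "germ ax True False (pt ax s' t) g"
          using germ_shift_right(1)[OF fg(1)] germ_shift_right(1)[OF fg(2)] s2 s' by auto
        then have "cofactor d c ax True (pt ax s' t) m = cofactor d c ax True (pt ax s t) m"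
          unfolding cofactor_def using fg quadrant_cell_eq by simp
        moreover have "vert_coords ax t \<inter> {a<..s'} = vert_coords ax t \<inter> {a<..s}" using s2(3) s' by fastforce
        ultimately show ?thesis unfolding G_def by simp
      qed
      show "\<forall>\<^sub>F s' in at s within {a..<b}. G s = G s'"
      proof (cases "a < s")
        case False
        then show ?thesis unfolding eventually_at using right s s2(1)
          by (intro exI[of _ "s2 - s"]) (auto simp: dist_real_def)
      next
        case True
        then have int: "pt ax s t \<in> interior (domain M)" using ledge_interior[OF l] s by auto
        obtain f' where f': "germ ax False True (pt ax s t) f'" using interior_germ[OF int] by blast
        obtain g' where g': "germ ax False False (pt ax s t) g'" using interior_germ[OF int] by blast
        obtain s1 where s1: "a < s1" "s1 < s" "\<forall>x\<in>vert_coords ax t. x < s \<longrightarrow> x < s1"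
          "\<And>s'. s1 \<le> s' \<Longrightarrow> s' < s \<Longrightarrow> cofactor d c ax True (pt ax s' t) m = cofactor d c ax False (pt ax s t) m"
          using cofactor_just_left[OF f' g' True, of d c m] by blast
        have left: "G s = G s'" if s': "s1 < s'" "s' < s" for s'
        proof -
          have "cofactor d c ax True (pt ax s t) m = cofactor d c ax True (pt ax s' t) m + beta d s m * vertex_cofactor d c (pt ax s t)"
            using s1(4)[of s'] cofactor_jump[OF c int m, of ax] s' by simp
          moreover have "(\<Sum>x\<in>vert_coords ax t \<inter> {a<..s}. beta d x m * vertex_cofactor d c (pt ax x t)) =
              (\<Sum>x\<in>vert_coords ax t \<inter> {a<..s'}. beta d x m * vertex_cofactor d c (pt ax x t)) + beta d s m * vertex_cofactor d c (pt ax s t)"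
          proof (cases "s \<in> vert_coords ax t")
            case sv: True
            have "vert_coords ax t \<inter> {a<..s} = insert s (vert_coords ax t \<inter> {a<..s'})" using s1(3) s' sv True by fastforce
            then show ?thesis using s' by simp
          next
            case sv: False
            have "vert_coords ax t \<inter> {a<..s} = vert_coords ax t \<inter> {a<..s'}" using s1(3) s' sv by (auto simp: order_le_less)
            then show ?thesis using vertex_cofactor_not_vert[OF int] sv unfolding vert_coords_def by simp
          qed
          ultimately show ?thesis unfolding G_def by simp
        qed
        show ?thesis unfolding eventually_at using right left s1(2) s2(1)
          by (intro exI[of _ "min (s2 - s) (s - s1)"]) (auto simp: dist_real_def abs_real_def split: if_splits)
      qed
    qed
  qed (use s in auto)
  then show ?thesis unfolding G_def by simp
qed

lemma cofactor_along_left: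
  assumes l: "is_ledge ax t a b" and c: "c \<in> coeff_space d M" and m: "m \<le> d" and s: "a < s" "s \<le> b"
  shows "cofactor d c ax False (pt ax s t) m =
    cofactor d c ax True (pt ax a t) m + (\<Sum>x\<in>vert_coords ax t \<inter> {a<..<s}. beta d x m * vertex_cofactor d c (pt ax x t))"
proof -
  have "split ax False (pt ax s t)" using l s unfolding is_ledge_def by auto
  then obtain f g where fg: "germ ax False True (pt ax s t) f" "germ ax False False (pt ax s t) g"
    unfolding split_def by blast
  obtain s1 where s1: "a < s1" "s1 < s" "\<forall>x\<in>vert_coords ax t. x < s \<longrightarrow> x < s1"
    "cofactor d c ax True (pt ax s1 t) m = cofactor d c ax False (pt ax s t) m"
    using cofactor_just_left[OF fg s(1), of d c m] by blast
  have "vert_coords ax t \<inter> {a<..s1} = vert_coords ax t \<inter> {a<..<s}" using s1 by fastforce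
  then show ?thesis using cofactor_along[OF l c m, of s1] s1 s by simp
qed

lemma cofactor_start_interior:
  assumes l: "is_ledge ax t a b" and c: "c \<in> coeff_space d M" and m: "m \<le> d" and "pt ax a t \<in> interior (domain M)"
  shows "cofactor d c ax True (pt ax a t) m = beta d a m * vertex_cofactor d c (pt ax a t)"
proof -
  have "\<not> split ax False (pt ax a t)" using l unfolding is_ledge_def by blast
  then show ?thesis using cofactor_unsplit[OF assms(4)] cofactor_jump[OF c assms(4) m, of ax] by simp
qed

lemma cofactor_end_interior:
  assumes l: "is_ledge ax t a b" and c: "c \<in> coeff_space d M" and m: "m \<le> d" and "pt ax b t \<in> interior (domain M)"
  shows "cofactor d c ax False (pt ax b t) m = - (beta d b m * vertex_cofactor d c (pt ax b t))"
proof -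
  have "\<not> split ax True (pt ax b t)" using l unfolding is_ledge_def by blast
  then show ?thesis using cofactor_unsplit[OF assms(4)] cofactor_jump[OF c assms(4) m, of ax] by simp
qed

lemma vert_coords_ledge:
  assumes "is_ledge ax t a b"
  shows "vert_coords ax t \<inter> {a..b} = insert a (insert b (vert_coords ax t \<inter> {a<..<b}))"
  using ledge_ends[OF assms] assms unfolding vert_coords_def is_ledge_def by auto

lemma sum_ledge:
  assumes "is_ledge ax t a b"
  shows "(\<Sum>x\<in>vert_coords ax t \<inter> {a..b}. F x) = F a + F b + (\<Sum>x\<in>vert_coords ax t \<inter> {a<..<b}. F x :: real)"
  unfolding vert_coords_ledge[OF assms] using assms unfolding is_ledge_def by simp

text \<open>The cofactor starts from 0 before an interior end point, and returns to 0 after the other one.\<close>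

lemma vertex_cofactor_sum_zero:
  assumes l: "is_ledge ax t a b" and c: "c \<in> coeff_space d M" and m: "m \<le> d"
    and ends: "pt ax a t \<in> interior (domain M)" "pt ax b t \<in> interior (domain M)"
  shows "(\<Sum>x\<in>vert_coords ax t \<inter> {a..b}. beta d x m * vertex_cofactor d c (pt ax x t)) = 0"
proof -
  have "a < b" using l unfolding is_ledge_def by blast
  then show ?thesis
    using cofactor_along_left[OF l c m, of b] cofactor_start_interior[OF l c m ends(1)] cofactor_end_interior[OF l c m ends(2)]
    unfolding sum_ledge[OF l] by simp
qed

text \<open>Up to a nonzero factor, the coefficient of exponent \<open>m\<close> of \<open>(y - x) ^ d\<close> in \<open>y\<close> is
\<open>x ^ (d - m)\<close>.\<close>

lemma moments_zero_iff:
  "(\<forall>k\<le>d. (\<Sum>x\<in>A. x ^ k * \<delta> x) = 0) \<longleftrightarrow> (\<forall>m\<le>d. (\<Sum>x\<in>A. beta d x m * \<delta> x) = 0)" for \<delta> :: "real \<Rightarrow> real"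
proof -
  have b: "(\<Sum>x\<in>A. beta d x m * \<delta> x) = real (d choose m) * (-1) ^ (d - m) * (\<Sum>x\<in>A. x ^ (d - m) * \<delta> x)" for m
    unfolding sum_distrib_left beta_def
  proof (intro sum.cong refl)
    fix x :: real
    have "(- x) ^ (d - m) = (- 1) ^ (d - m) * x ^ (d - m)" by (rule power_minus)
    then show "real (d choose m) * (- x) ^ (d - m) * \<delta> x = real (d choose m) * (- 1) ^ (d - m) * (x ^ (d - m) * \<delta> x)"
      by simp
  qed
  have nz: "real (d choose m) * (-1) ^ (d - m) \<noteq> 0" if "m \<le> d" for m using that by simp
  show ?thesis
  proof (intro iffI allI impI)
    fix m assume "\<forall>k\<le>d. (\<Sum>x\<in>A. x ^ k * \<delta> x) = 0" "m \<le> d"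
    then show "(\<Sum>x\<in>A. beta d x m * \<delta> x) = 0" unfolding b by simp
  next
    fix k assume *: "\<forall>m\<le>d. (\<Sum>x\<in>A. beta d x m * \<delta> x) = 0" "k \<le> d"
    then have "(\<Sum>x\<in>A. beta d x (d - k) * \<delta> x) = 0" by simp
    then show "(\<Sum>x\<in>A. x ^ k * \<delta> x) = 0" unfolding b using nz[of "d - k"] *(2) by simp
  qed
qed

lemma sum_verts_on_seg:
  "(\<Sum>p\<in>verts M \<inter> seg ax t a b. F p) = (\<Sum>x\<in>vert_coords ax t \<inter> {a..b}. F (pt ax x t) :: real)"
proof -
  have "verts M \<inter> seg ax t a b = (\<lambda>x. pt ax x t) ` (vert_coords ax t \<inter> {a..b})" (is "?L = ?R")
  proof
    show "?L \<subseteq> ?R"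
    proof
      fix p assume p: "p \<in> ?L"
      then have "p = pt ax (along ax p) t" using pt_along[of ax p] unfolding seg_def by auto
      then show "p \<in> ?R" using p unfolding vert_coords_def seg_def by auto
    qed
  qed (auto simp: vert_coords_def)
  then show ?thesis by (simp add: sum.reindex inj_on_def)
qed

section \<open>The configuration of T l-edges\<close>

lemma interior_ledge_iff: "l \<in> interior_ledges M \<longleftrightarrow> (\<exists>ax t a b. is_ledge ax t a b \<and> l = seg ax t a b)"
  using ledge_of_maximal maximal_of_ledge by metis

lemma endpoints_ledge: "is_ledge ax t a b \<Longrightarrow> endpoints (seg ax t a b) = {pt ax a t, pt ax b t}"
  unfolding is_ledge_def using endpoints_seg by blast

lemma T_ledge_seg_iff:
  assumes "is_ledge ax t a b"
  shows "seg ax t a b \<in> T_ledges M \<longleftrightarrow> pt ax a t \<in> interior (domain M) \<and> pt ax b t \<in> interior (domain M)"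
  unfolding T_ledges_def interior_verts_def
  using endpoints_ledge[OF assms] ledge_ends[OF assms] maximal_of_ledge[OF assms] by auto

lemma cross_cut_seg_iff:
  assumes "is_ledge ax t a b"
  shows "seg ax t a b \<in> cross_cuts M \<longleftrightarrow> pt ax a t \<notin> interior (domain M) \<and> pt ax b t \<notin> interior (domain M)"
  unfolding cross_cuts_def boundary_verts_def
  using endpoints_ledge[OF assms] ledge_ends[OF assms] maximal_of_ledge[OF assms] by auto

lemma ray_seg_iff:
  assumes "is_ledge ax t a b"
  shows "seg ax t a b \<in> rays M \<longleftrightarrow> (pt ax a t \<in> interior (domain M) \<longleftrightarrow> pt ax b t \<notin> interior (domain M))"
proof -
  have "endpoints (seg ax t a b) \<inter> boundary_verts M = {p \<in> {pt ax a t, pt ax b t}. p \<notin> interior (domain M)}"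
    unfolding boundary_verts_def using endpoints_ledge[OF assms] ledge_ends[OF assms] by auto
  moreover have "a < b" using assms unfolding is_ledge_def by blast
  moreover have "{p \<in> {x, y}. P p} = (if P x then {x} else {}) \<union> (if P y then {y} else {})" for x y :: point and P by auto
  ultimately show ?thesis unfolding rays_def using maximal_of_ledge[OF assms] by simp
qed

lemma T_ledge_form:
  assumes "l \<in> T_ledges M"
  obtains ax t a b where "is_ledge ax t a b" "l = seg ax t a b" "pt ax a t \<in> interior (domain M)" "pt ax b t \<in> interior (domain M)"
proof -
  have "l \<in> interior_ledges M" using assms unfolding T_ledges_def by simp
  then obtain ax t a b where l: "is_ledge ax t a b" "l = seg ax t a b" by (rule ledge_of_maximal)
  then show thesis using that[OF l] T_ledge_seg_iff[OF l(1)] assms by simp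
qed

lemma ledge_pos: "is_ledge ax t a b \<Longrightarrow> a < b"
  unfolding is_ledge_def by blast

lemma T_ledge_interior:
  assumes "l \<in> T_ledges M" shows "l \<subseteq> interior (domain M)"
proof -
  obtain ax t a b where l: "is_ledge ax t a b" "l = seg ax t a b" "pt ax a t \<in> interior (domain M)" "pt ax b t \<in> interior (domain M)"
    using T_ledge_form[OF assms] .
  show ?thesis
  proof
    fix p assume "p \<in> l"
    then have p: "p = pt ax (along ax p) t" "a \<le> along ax p" "along ax p \<le> b"
      using l(2) pt_along[of ax p] unfolding seg_def by auto
    then consider "along ax p = a" | "along ax p = b" | "a < along ax p" "along ax p < b" by linarith
    then show "p \<in> interior (domain M)" using ledge_interior[OF l(1)] l p(1) by cases (metis, metis, metis)
  qed
qed

lemma directed_seg: "a < b \<Longrightarrow> horizontal (seg ax t a b) \<longleftrightarrow> ax" "a < b \<Longrightarrow> vertical (seg ax t a b) \<longleftrightarrow> \<not> ax"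
  unfolding horizontal_iff vertical_iff using seg_eq_iff by metis+

lemma gt_ledges_T: "gt_ledges (T_component M) = T_ledges M"
proof -
  have "horizontal l \<or> vertical l" if "l \<in> T_ledges M" for l
    using T_ledge_form[OF that] directed_seg ledge_pos by metis
  then show ?thesis unfolding gt_ledges_def T_component_def by auto
qed

lemma gt_verts_T: "gt_verts (T_component M) = verts M \<inter> \<Union>(T_ledges M)"
  unfolding gt_verts_def gt_ledges_T by (auto simp: T_component_def)

lemma CVS_T_iff:
  "\<delta> \<in> CVS d (T_component M) \<longleftrightarrow> (\<forall>p. p \<notin> gt_verts (T_component M) \<longrightarrow> \<delta> p = 0) \<and>
    (\<forall>ax t a b m. is_ledge ax t a b \<longrightarrow> pt ax a t \<in> interior (domain M) \<longrightarrow> pt ax b t \<in> interior (domain M) \<longrightarrow> m \<le> d \<longrightarrow>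
      (\<Sum>x\<in>vert_coords ax t \<inter> {a..b}. beta d x m * \<delta> (pt ax x t)) = 0)" (is "_ \<longleftrightarrow> ?S \<and> ?B")
proof -
  define Mom where "Mom ax l \<longleftrightarrow> (\<forall>k\<le>d. (\<Sum>p\<in>verts M \<inter> l. along ax p ^ k * \<delta> p) = 0)" for ax l
  have "\<delta> \<in> CVS d (T_component M) \<longleftrightarrow> ?S \<and> (\<forall>l\<in>T_ledges M. (horizontal l \<longrightarrow> Mom True l) \<and> (vertical l \<longrightarrow> Mom False l))"
    unfolding CVS_def Mom_def by (auto simp: T_component_def along_def)
  also have "(\<forall>l\<in>T_ledges M. (horizontal l \<longrightarrow> Mom True l) \<and> (vertical l \<longrightarrow> Mom False l)) \<longleftrightarrow>
      (\<forall>ax t a b. is_ledge ax t a b \<longrightarrow> pt ax a t \<in> interior (domain M) \<longrightarrow> pt ax b t \<in> interior (domain M) \<longrightarrow> Mom ax (seg ax t a b))"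
    (is "?X \<longleftrightarrow> ?Y")
  proof
    assume X: ?X
    show ?Y
    proof (intro allI impI)
      fix ax t a b assume *: "is_ledge ax t a b" "pt ax a t \<in> interior (domain M)" "pt ax b t \<in> interior (domain M)"
      then have "seg ax t a b \<in> T_ledges M" using T_ledge_seg_iff by blast
      then show "Mom ax (seg ax t a b)" using X directed_seg[OF ledge_pos[OF *(1)], of ax t] by (cases ax) auto
    qed
  next
    assume Y: ?Y
    show ?X
    proof
      fix l assume "l \<in> T_ledges M"
      then obtain ax t a b where *: "is_ledge ax t a b" "l = seg ax t a b" "pt ax a t \<in> interior (domain M)" "pt ax b t \<in> interior (domain M)"
        by (rule T_ledge_form)
      then have "Mom ax l" using Y by blast
      then show "(horizontal l \<longrightarrow> Mom True l) \<and> (vertical l \<longrightarrow> Mom False l)"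
        using directed_seg[OF ledge_pos[OF *(1)], of ax t] *(2) by (cases ax) auto
    qed
  qed
  finally have main: "\<delta> \<in> CVS d (T_component M) \<longleftrightarrow> ?S \<and>
      (\<forall>ax t a b. is_ledge ax t a b \<longrightarrow> pt ax a t \<in> interior (domain M) \<longrightarrow> pt ax b t \<in> interior (domain M) \<longrightarrow> Mom ax (seg ax t a b))" .
  have "Mom ax (seg ax t a b) \<longleftrightarrow> (\<forall>m\<le>d. (\<Sum>x\<in>vert_coords ax t \<inter> {a..b}. beta d x m * \<delta> (pt ax x t)) = 0)" for ax t a b
    unfolding Mom_def sum_verts_on_seg along_pt moments_zero_iff ..
  then show ?thesis unfolding main by blast
qed

end

section \<open>Prescribing the cofactors\<close>

text \<open>Around a square with a missing corner the prescribed differences form a path and are unobstructed; with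
all four corners the sum around the square has to vanish.\<close>

lemma square_potential:
  fixes ex :: "bool \<Rightarrow> bool \<Rightarrow> bool" and a b :: "bool \<Rightarrow> real"
  assumes "(\<And>\<sigma> \<tau>. ex \<sigma> \<tau>) \<Longrightarrow> a True - a False = b True - b False"
  shows "\<exists>U. \<forall>\<sigma>. (ex \<sigma> True \<and> ex \<sigma> False \<longrightarrow> U \<sigma> True - U \<sigma> False = a \<sigma>) \<and>
    (ex True \<sigma> \<and> ex False \<sigma> \<longrightarrow> U True \<sigma> - U False \<sigma> = b \<sigma>)"
proof -
  define mk :: "real \<Rightarrow> real \<Rightarrow> real \<Rightarrow> real \<Rightarrow> bool \<Rightarrow> bool \<Rightarrow> real"
    where "mk x1 x2 x3 x4 = (\<lambda>\<sigma> \<tau>. if \<sigma> then (if \<tau> then x1 else x2) else (if \<tau> then x3 else x4))" for x1 x2 x3 x4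
  consider "\<not> ex False True" | "\<not> ex True True" | "\<not> ex True False" | "\<not> ex False False" | "\<And>\<sigma> \<tau>. ex \<sigma> \<tau>"
    by (metis (full_types))
  then show ?thesis
  proof cases
    case 1 then show ?thesis by (intro exI[of _ "mk (b False + a True) (b False) 0 0"]) (auto simp: mk_def all_bool_eq)
  next
    case 2 then show ?thesis by (intro exI[of _ "mk 0 (b False) (a False) 0"]) (auto simp: mk_def all_bool_eq)
  next
    case 3 then show ?thesis by (intro exI[of _ "mk (a False + b True) 0 (a False) 0"]) (auto simp: mk_def all_bool_eq)
  next
    case 4 then show ?thesis by (intro exI[of _ "mk 0 (- a True) (- b True) 0"]) (auto simp: mk_def all_bool_eq)
  next
    case 5 then show ?thesis using assms[OF 5]
      by (intro exI[of _ "mk (b False + a True) (b False) (a False) 0"]) (auto simp: mk_def all_bool_eq)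
  qed
qed

context T_mesh
begin

text \<open>The corners of the square are the quadrants at \<open>q\<close>.  Quadrants of the same cell get the same value
because \<open>h\<close> vanishes on directions without an edge.\<close>

lemma local_potential:
  fixes h :: "bool \<Rightarrow> bool \<Rightarrow> real"
  assumes h0: "\<And>ax r. \<not> split ax r q \<Longrightarrow> h ax r = 0"
    and hc: "q \<in> interior (domain M) \<Longrightarrow> h True True - h True False = h False True - h False False"
  shows "\<exists>u. \<forall>ax r f g. germ ax r True q f \<longrightarrow> germ ax r False q g \<longrightarrow> u f - u g = h ax r"
proof -
  define ex where "ex \<sigma> \<tau> = (\<exists>f. germ True \<sigma> \<tau> q f)" for \<sigma> \<tau>
  have "h True True - h True False = h False True - h False False" if "\<And>\<sigma> \<tau>. ex \<sigma> \<tau>"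
    using that germs_interior[of True q] hc unfolding ex_def by blast
  then obtain U where U: "\<And>\<sigma>. ex \<sigma> True \<Longrightarrow> ex \<sigma> False \<Longrightarrow> U \<sigma> True - U \<sigma> False = h True \<sigma>"
    "\<And>\<sigma>. ex True \<sigma> \<Longrightarrow> ex False \<sigma> \<Longrightarrow> U True \<sigma> - U False \<sigma> = h False \<sigma>"
    using square_potential[of ex "h True" "h False"] by blast
  have adj1: "U \<sigma> \<tau> = U \<sigma> \<tau>'" if g: "germ True \<sigma> \<tau> q f" "germ True \<sigma> \<tau>' q f" for \<sigma> \<tau> \<tau>' f
  proof (cases "\<tau> = \<tau>'")
    case False
    then have *: "germ True \<sigma> True q f" "germ True \<sigma> False q f" using g by (cases \<tau>; auto)+
    then have "\<not> split True \<sigma> q" unfolding split_def using germ_unique by blast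
    then have "U \<sigma> True = U \<sigma> False" using U(1)[of \<sigma>] h0 * unfolding ex_def by auto
    then show ?thesis by (cases \<tau>; cases \<tau>') auto
  qed simp
  have adj2: "U \<sigma> \<tau> = U \<sigma>' \<tau>" if g: "germ True \<sigma> \<tau> q f" "germ True \<sigma>' \<tau> q f" for \<sigma> \<sigma>' \<tau> f
  proof (cases "\<sigma> = \<sigma>'")
    case False
    then have *: "germ True True \<tau> q f" "germ True False \<tau> q f" using g by (cases \<sigma>; auto)+
    then have "germ False \<tau> True q f" "germ False \<tau> False q f" using germ_swap[of True] by simp_all
    then have "\<not> split False \<tau> q" unfolding split_def using germ_unique by blast
    then have "U True \<tau> = U False \<tau>" using U(2)[of \<tau>] h0 * unfolding ex_def by auto
    then show ?thesis by (cases \<sigma>; cases \<sigma>') auto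
  qed simp
  have wd: "U \<sigma> \<tau> = U \<sigma>' \<tau>'" if g: "germ True \<sigma> \<tau> q f" "germ True \<sigma>' \<tau>' q f" for \<sigma> \<tau> \<sigma>' \<tau>' f
  proof -
    have m: "germ True \<sigma>' \<tau> q f" using g unfolding germ_def by auto
    show ?thesis using adj2[OF g(1) m] adj1[OF m g(2)] by simp
  qed
  define u where "u f = (let z = (SOME z. germ True (fst z) (snd z) q f) in U (fst z) (snd z))" for f
  have u: "u f = U \<sigma> \<tau>" if "germ True \<sigma> \<tau> q f" for f \<sigma> \<tau>
  proof -
    have "germ True (fst (SOME z. germ True (fst z) (snd z) q f)) (snd (SOME z. germ True (fst z) (snd z) q f)) q f"
      by (rule someI[of _ "(\<sigma>, \<tau>)"]) (use that in simp)
    then show ?thesis unfolding u_def Let_def using wd that by blast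
  qed
  have "u f - u g = h ax r" if g: "germ ax r True q f" "germ ax r False q g" for ax r f g
  proof (cases ax)
    case True
    then have g': "germ True r True q f" "germ True r False q g" using g by simp_all
    then show ?thesis unfolding u[OF g'(1)] u[OF g'(2)] using U(1)[of r] True unfolding ex_def by auto
  next
    case False
    then have g': "germ True True r q f" "germ True False r q g" using g germ_swap[of True] by simp_all
    then show ?thesis unfolding u[OF g'(1)] u[OF g'(2)] using U(2)[of r] False unfolding ex_def by auto
  qed
  then show ?thesis by blast
qed

lemma common_points_above:
  assumes fg: "f \<in> cells M" "g \<in> cells M" "f \<noteq> g" and q: "q \<in> f" "q \<in> g" and q': "q' \<in> f" "q' \<in> g" and "q \<noteq> q'"
  shows "\<exists>ax. above ax f g \<or> above ax g f"
proof -
  have aux: "above ax f g" if ax: "hi (\<not> ax) g \<le> lo (\<not> ax) f" and fg: "f \<in> cells M" "g \<in> cells M"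
    and q: "q \<in> f" "q \<in> g" "q' \<in> f" "q' \<in> g" for ax f g
  proof -
    note b = cell_bounds(2)[OF fg(1), of _ ax, THEN iffD1] cell_bounds(2)[OF fg(2), of _ ax, THEN iffD1]
    have "along (\<not> ax) q = along (\<not> ax) q'" "hi (\<not> ax) g = lo (\<not> ax) f"
      using ax b(1)[OF q(1)] b(1)[OF q(3)] b(2)[OF q(2)] b(2)[OF q(4)] by linarith+
    moreover then have "along ax q \<noteq> along ax q'" using \<open>q \<noteq> q'\<close> point_eq_iff[of q q' ax] by blast
    ultimately show ?thesis unfolding above_def using b(1)[OF q(1)] b(1)[OF q(3)] b(2)[OF q(2)] b(2)[OF q(4)] by linarith
  qed
  consider "hi True f \<le> lo True g" | "hi True g \<le> lo True f" | "hi False f \<le> lo False g" | "hi False g \<le> lo False f"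
    using separated[OF fg, of True] by auto
  then show ?thesis
  proof cases
    case 1
    then have "above False g f" using aux[of False f g] fg q q' by simp
    then show ?thesis by blast
  next
    case 2
    then have "above False f g" using aux[of False g f] fg q q' by simp
    then show ?thesis by blast
  next
    case 3
    then have "above True g f" using aux[of True f g] fg q q' by simp
    then show ?thesis by blast
  next
    case 4
    then have "above True f g" using aux[of True g f] fg q q' by simp
    then show ?thesis by blast
  qed
qed

lemma above_germs_at:
  assumes ab: "above ax f g" and fg: "f \<in> cells M" "g \<in> cells M" and q: "q \<in> f" "q \<in> g"
  obtains r where "germ ax r True q f" "germ ax r False q g"
proof -
  have q': "q = pt ax (along ax q) (lo (\<not> ax) f)" using above_meet[OF ab fg q] pt_along[of ax q] by simp
  have "max (lo ax f) (lo ax g) \<le> along ax q" "along ax q \<le> min (hi ax f) (hi ax g)"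
    using cell_bounds(2)[OF fg(1), of q ax] cell_bounds(2)[OF fg(2), of q ax] q by auto
  then consider "max (lo ax f) (lo ax g) \<le> along ax q" "along ax q < min (hi ax f) (hi ax g)"
    | "max (lo ax f) (lo ax g) < along ax q" "along ax q \<le> min (hi ax f) (hi ax g)"
    using above_common(1)[OF ab fg] by linarith
  then show thesis
  proof cases
    case 1
    then show thesis using that[of True] above_common(3)[OF ab fg, of "along ax q"] unfolding q'[symmetric] by blast
  next
    case 2
    then show thesis using that[of False] above_common(4)[OF ab fg, of "along ax q"] unfolding q'[symmetric] by blast
  qed
qed

text \<open>The data determine the cofactor of every interior edge, and thereby the differences of the coefficients
of neighbouring cells at each point.  These differences have a potential at each point.  They do not depend
on the common point chosen for two cells, as an interior l-edge has no vertex in the relative interior of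
the common side of two cells.  Simple connectedness turns the local potentials into a global one.\<close>

lemma prescribed_cofactors:
  assumes \<delta>0: "\<And>v. v \<notin> interior_verts M \<Longrightarrow> \<delta> v = 0"
    and T: "\<And>ax t a b m. is_ledge ax t a b \<Longrightarrow> pt ax a t \<in> interior (domain M) \<Longrightarrow> pt ax b t \<in> interior (domain M) \<Longrightarrow> m \<le> d \<Longrightarrow>
      (\<Sum>x\<in>vert_coords ax t \<inter> {a..b}. beta d x m * \<delta> (pt ax x t)) = 0"
  shows "\<exists>c\<in>coeff_space d M. (\<forall>i\<le>d. \<forall>j\<le>d. base \<in> cells M \<longrightarrow> c (base, i, j) = k0 i j) \<and>
    (\<forall>ax t a b m. is_ledge ax t a b \<longrightarrow> pt ax a t \<notin> interior (domain M) \<longrightarrow> pt ax b t \<notin> interior (domain M) \<longrightarrow> m \<le> d \<longrightarrow>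
       cofactor d c ax True (pt ax a t) m = \<kappa> (seg ax t a b) m) \<and>
    (\<forall>v\<in>interior_verts M. vertex_cofactor d c v = \<delta> v)"
proof -
  define tot where "tot ax t A m = (\<Sum>x\<in>vert_coords ax t \<inter> A. beta d x m * \<delta> (pt ax x t))" for ax t A m
  \<comment> \<open>The starting cofactor of an l-edge, before its first point: an interior first point or, for a ray, an interior last point forces its value.\<close>
  define P where "P ax t a b m = (if pt ax a t \<in> interior (domain M) then 0
     else if pt ax b t \<in> interior (domain M) then - tot ax t {a..b} m else \<kappa> (seg ax t a b) m)" for ax t a b m
  define L where "L ax q = (SOME z. is_ledge ax (along (\<not> ax) q) (fst z) (snd z) \<and> fst z \<le> along ax q \<and> along ax q \<le> snd z)" for ax q
  \<comment> \<open>The cofactor prescribed on the ray from \<open>q\<close> in direction \<open>r\<close>; a vertex counts as passed at itself in the positive direction only.\<close>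
  define \<alpha> where "\<alpha> ax r q m = (if split ax r q \<and> m \<le> d then P ax (along (\<not> ax) q) (fst (L ax q)) (snd (L ax q)) m
     + tot ax (along (\<not> ax) q) (if r then {fst (L ax q)..along ax q} else {fst (L ax q)..<along ax q}) m else 0)" for ax r q m
  have \<alpha>I: "\<alpha> ax r (pt ax s t) m = P ax t a b m + tot ax t (if r then {a..s} else {a..<s}) m"
    if l: "is_ledge ax t a b" "a \<le> s" "s \<le> b" and sp: "split ax r (pt ax s t)" and m: "m \<le> d" for ax r s t m a b
  proof -
    define z where "z = L ax (pt ax s t)"
    have "is_ledge ax (along (\<not> ax) (pt ax s t)) (fst z) (snd z) \<and> fst z \<le> along ax (pt ax s t) \<and> along ax (pt ax s t) \<le> snd z"
      unfolding z_def L_def by (rule someI[of _ "(a, b)"]) (use l in simp)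
    then have "is_ledge ax t (fst z) (snd z)" "fst z \<le> s" "s \<le> snd z" by simp_all
    then have "a = fst z" "b = snd z" using ledge_unique[OF l(1)] l(2,3) by blast+
    then show ?thesis unfolding \<alpha>_def z_def[symmetric] along_pt using sp m by simp
  qed
  have \<alpha>0: "\<alpha> ax r q m = 0" if "\<not> split ax r q" for ax r q m unfolding \<alpha>_def using that by simp
  have \<delta>v: "beta d x m * \<delta> (pt ax x t) = 0" if "x \<notin> vert_coords ax t" for x ax t m
    using \<delta>0[of "pt ax x t"] that unfolding vert_coords_def interior_verts_def by auto
  have tot_insert: "tot ax t {a..s} m = tot ax t {a..<s} m + beta d s m * \<delta> (pt ax s t)" if "a \<le> s" for ax t a s m
  proof (cases "s \<in> vert_coords ax t")
    case True
    then have "vert_coords ax t \<inter> {a..s} = insert s (vert_coords ax t \<inter> {a..<s})" using that by auto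
    then show ?thesis unfolding tot_def by simp
  next
    case False
    then have "vert_coords ax t \<inter> {a..s} = vert_coords ax t \<inter> {a..<s}" by (auto simp: order_le_less)
    then show ?thesis unfolding tot_def using \<delta>v[OF False] by simp
  qed
  have tot_empty: "tot ax t {a..<a} m = 0" for ax t a m unfolding tot_def by simp
  \<comment> \<open>The conformality condition at an interior point.\<close>
  have \<alpha>1: "\<alpha> ax True q m - \<alpha> ax False q m = beta d (along ax q) m * \<delta> q" if q: "q \<in> interior (domain M)" and m: "m \<le> d" for ax q m
  proof -
    define t s where "t = along (\<not> ax) q" and "s = along ax q"
    have qe: "q = pt ax s t" unfolding t_def s_def by simp
    show ?thesis
    proof (cases "\<exists>r. split ax r q")
      case False
      then have "q \<notin> verts M" using vert_imp_split q by blast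
      then have "\<delta> q = 0" using \<delta>0 unfolding interior_verts_def by blast
      then show ?thesis using \<alpha>0 False by simp
    next
      case True
      then obtain a b where l: "is_ledge ax t a b" "a \<le> s" "s \<le> b" using ledge_exists unfolding t_def s_def by metis
      have v: "\<alpha> ax True q m = (if s < b then P ax t a b m + tot ax t {a..s} m else 0)"
        "\<alpha> ax False q m = (if a < s then P ax t a b m + tot ax t {a..<s} m else 0)"
      proof -
        have "split ax True q" if "s < b" using l that unfolding is_ledge_def qe by auto
        moreover have "\<not> split ax True q" if "\<not> s < b" using l that unfolding is_ledge_def qe by (metis antisym_conv2)
        ultimately show "\<alpha> ax True q m = (if s < b then P ax t a b m + tot ax t {a..s} m else 0)"
          using \<alpha>0 \<alpha>I[OF l, of True m] m unfolding qe by auto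
        have "split ax False q" if "a < s" using l that unfolding is_ledge_def qe by auto
        moreover have "\<not> split ax False q" if "\<not> a < s" using l that unfolding is_ledge_def qe by (metis antisym_conv2)
        ultimately show "\<alpha> ax False q m = (if a < s then P ax t a b m + tot ax t {a..<s} m else 0)"
          using \<alpha>0 \<alpha>I[OF l, of False m] m unfolding qe by auto
      qed
      have ab: "a < b" using ledge_pos[OF l(1)] .
      consider "a < s" "s < b" | "s = a" | "s = b" using l(2,3) by linarith
      then show ?thesis
      proof cases
        case 1
        then show ?thesis using v tot_insert[of a s ax t m] unfolding qe by simp
      next
        case 2
        then have "P ax t a b m = 0" using q unfolding P_def qe by simp
        then show ?thesis using v tot_insert[of a s ax t m] tot_empty ab 2 unfolding qe by simp
      next
        case 3
        have "P ax t a b m + tot ax t {a..b} m = 0"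
          using T[OF l(1) _ _ m] q 3 unfolding P_def qe tot_def by auto
        then show ?thesis using v tot_insert[of a b ax t m] ab 3 unfolding qe by simp
      qed
    qed
  qed
  have \<alpha>3: "\<alpha> ax r q m = \<alpha> ax r' q' m"
    if ab: "above ax f g" and fg: "f \<in> cells M" "g \<in> cells M"
      and q: "germ ax r True q f" "germ ax r False q g" and q': "germ ax r' True q' f" "germ ax r' False q' g" for ax f g r q r' q' m
  proof (cases "m \<le> d")
    case m: True
    define t a1 b1 where "t = lo (\<not> ax) f" and "a1 = max (lo ax f) (lo ax g)" and "b1 = min (hi ax f) (hi ax g)"
    have "f \<noteq> g" using above_neq[OF ab fg] .
    have rng: "q = pt ax (along ax q) t \<and> (if r then a1 \<le> along ax q \<and> along ax q < b1 else a1 < along ax q \<and> along ax q \<le> b1)"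
      if "germ ax r True q f" "germ ax r False q g" for r q
    proof -
      have q: "q \<in> f" "q \<in> g" "extends ax r f q" "extends ax r g q" using that unfolding germ_def by auto
      have "q = pt ax (along ax q) t" using above_meet[OF ab fg q(1,2)] pt_along[of ax q] unfolding t_def by simp
      moreover have "if r then a1 \<le> along ax q \<and> along ax q < b1 else a1 < along ax q \<and> along ax q \<le> b1"
        using q(3,4) cell_bounds(2)[OF fg(1), of q ax, THEN iffD1, OF q(1)] cell_bounds(2)[OF fg(2), of q ax, THEN iffD1, OF q(2)]
        unfolding a1_def b1_def extends_def by (cases r) simp_all
      ultimately show ?thesis by blast
    qed
    have spR: "split ax True (pt ax s t)" if "a1 \<le> s" "s < b1" for s
      using above_common(3)[OF ab fg] that \<open>f \<noteq> g\<close> unfolding split_def t_def a1_def b1_def by blast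
    have spL: "split ax False (pt ax s t)" if "a1 < s" "s \<le> b1" for s
      using above_common(4)[OF ab fg] that \<open>f \<noteq> g\<close> unfolding split_def t_def a1_def b1_def by blast
    have ab1: "a1 < b1" using above_common(1)[OF ab fg] unfolding a1_def b1_def .
    obtain a b where l: "is_ledge ax t a b" "a \<le> a1" "a1 \<le> b"
    proof -
      have "split ax True (pt ax a1 t)" using spR ab1 by simp
      then show thesis using that ledge_exists[of ax True "pt ax a1 t"] unfolding along_pt by blast
    qed
    have "b1 \<le> b"
    proof (rule ccontr)
      assume "\<not> b1 \<le> b"
      then have "split ax True (pt ax b t)" using spR[of b] l by simp
      then show False using l(1) unfolding is_ledge_def by blast
    qed
    have none: "x \<notin> vert_coords ax t" if x: "a1 < x" "x < b1" for x
    proof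
      assume xv: "x \<in> vert_coords ax t"
      define p where "p = pt ax x t"
      have "p \<in> interior (domain M)" using ledge_interior[OF l(1)] x l \<open>b1 \<le> b\<close> unfolding p_def by auto
      then obtain r2 where "split (\<not> ax) r2 p" using vert_imp_split xv unfolding vert_coords_def p_def by blast
      then obtain f2 g2 where "f2 \<noteq> g2" "germ (\<not> ax) r2 True p f2" "germ (\<not> ax) r2 False p g2" unfolding split_def by blast
      then have 2: "germ ax True r2 p f2" "germ ax False r2 p g2" unfolding germ_swap by auto
      have p4: "germ ax True True p f" "germ ax True False p g" "germ ax False True p f" "germ ax False False p g"
        using above_common(3,4)[OF ab fg, of x] x unfolding p_def t_def a1_def b1_def by auto
      have "f2 = (if r2 then f else g)"
        using germ_unique[OF 2(1), of "if r2 then f else g"] p4 by (cases r2) simp_all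
      moreover have "g2 = (if r2 then f else g)"
        using germ_unique[OF 2(2), of "if r2 then f else g"] p4 by (cases r2) simp_all
      ultimately show False using \<open>f2 \<noteq> g2\<close> by simp
    qed
    have val: "\<alpha> ax r q m = P ax t a b m + tot ax t {a..a1} m" if g: "germ ax r True q f" "germ ax r False q g" for r q
    proof -
      define s where "s = along ax q"
      have s: "q = pt ax s t" "if r then a1 \<le> s \<and> s < b1 else a1 < s \<and> s \<le> b1" using rng[OF g] unfolding s_def by auto
      have sp: "split ax r (pt ax s t)" using g \<open>f \<noteq> g\<close> unfolding split_def s(1) by blast
      have "a \<le> s" "s \<le> b" using s(2) l \<open>b1 \<le> b\<close> by (auto split: if_splits)
      then have "\<alpha> ax r q m = P ax t a b m + tot ax t (if r then {a..s} else {a..<s}) m"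
        unfolding s(1) using \<alpha>I[OF l(1) _ _ sp m] by blast
      moreover have "vert_coords ax t \<inter> (if r then {a..s} else {a..<s}) = vert_coords ax t \<inter> {a..a1}"
      proof -
        have gap: "x \<le> a1 \<or> b1 \<le> x" if "x \<in> vert_coords ax t" for x using none[of x] that by linarith
        show ?thesis
        proof (rule set_eqI)
          fix x
          show "x \<in> vert_coords ax t \<inter> (if r then {a..s} else {a..<s}) \<longleftrightarrow> x \<in> vert_coords ax t \<inter> {a..a1}"
            using gap[of x] s(2) by (cases r) auto
        qed
      qed
      ultimately show ?thesis unfolding tot_def by simp
    qed
    show ?thesis using val[OF q] val[OF q'] by simp
  qed (simp add: \<alpha>_def)
  \<comment> \<open>The prescribed difference of the coefficients with exponents \<open>i\<close> and \<open>j\<close> across the ray.\<close>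
  define h where "h i j ax r q = \<alpha> ax r q (if ax then i else j) * beta d (along (\<not> ax) q) (if ax then j else i)" for i j ax r q
  have "\<exists>u. \<forall>ax r f g. germ ax r True q f \<longrightarrow> germ ax r False q g \<longrightarrow> u f - u g = h i j ax r q" if ij: "i \<le> d" "j \<le> d" for i j q
  proof (rule local_potential)
    show "h i j ax r q = 0" if "\<not> split ax r q" for ax r unfolding h_def using \<alpha>0[OF that] by simp
    show "h i j True True q - h i j True False q = h i j False True q - h i j False False q" if q: "q \<in> interior (domain M)"
      using \<alpha>1[OF q ij(1), of True] \<alpha>1[OF q ij(2), of False] unfolding h_def by (simp add: left_diff_distrib[symmetric])
  qed
  then have "\<forall>i j q. \<exists>u. i \<le> d \<longrightarrow> j \<le> d \<longrightarrow> (\<forall>ax r f g. germ ax r True q f \<longrightarrow> germ ax r False q g \<longrightarrow> u f - u g = h i j ax r q)" by blast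
  then obtain u where u: "\<And>i j q ax r f g. i \<le> d \<Longrightarrow> j \<le> d \<Longrightarrow> germ ax r True q f \<Longrightarrow> germ ax r False q g \<Longrightarrow>
      u i j q f - u i j q g = h i j ax r q"
    by metis
  \<comment> \<open>Independence of the common point; two cells without a common side share at most one point.\<close>
  have indep: "u i j q f - u i j q g = u i j q' f - u i j q' g"
    if ij: "i \<le> d" "j \<le> d" and fg: "f \<in> cells M" "g \<in> cells M" and q: "q \<in> f" "q \<in> g" "q' \<in> f" "q' \<in> g" for i j f g q q'
  proof -
    have aux: "u i j q f - u i j q g = u i j q' f - u i j q' g"
      if ab: "above ax f g" and fg: "f \<in> cells M" "g \<in> cells M" and q: "q \<in> f" "q \<in> g" "q' \<in> f" "q' \<in> g" for ax f g
    proof -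
      obtain r where r: "germ ax r True q f" "germ ax r False q g" using above_germs_at[OF ab fg q(1,2)] .
      obtain r' where r': "germ ax r' True q' f" "germ ax r' False q' g" using above_germs_at[OF ab fg q(3,4)] .
      have "h i j ax r q = h i j ax r' q'"
        unfolding h_def above_meet[OF ab fg q(1,2)] above_meet[OF ab fg q(3,4)] using \<alpha>3[OF ab fg r r'] by simp
      then show ?thesis using u[OF ij r] u[OF ij r'] by simp
    qed
    show ?thesis
    proof (cases "f = g \<or> q = q'")
      case False
      then obtain ax where "above ax f g \<or> above ax g f" using common_points_above[OF fg _ q] by blast
      then show ?thesis using aux[of ax f g] aux[of ax g f] fg q by auto
    qed auto
  qed
  have "\<exists>w. \<forall>f\<in>cells M. \<forall>g\<in>cells M. f \<inter> g \<noteq> {} \<longrightarrow> w f - w g =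
      (let q = (SOME q. q \<in> f \<inter> g) in u i j q f - u i j q g)" if ij: "i \<le> d" "j \<le> d" for i j
  proof (rule cech_real)
    fix f g k assume *: "f \<in> cells M" "g \<in> cells M" "k \<in> cells M" "f \<inter> g \<inter> k \<noteq> {}"
    then obtain q where q: "q \<in> f" "q \<in> g" "q \<in> k" by blast
    have sm: "(let q = (SOME q. q \<in> a \<inter> b) in u i j q a - u i j q b) = u i j q a - u i j q b"
      if ab: "a \<in> cells M" "b \<in> cells M" "q \<in> a" "q \<in> b" for a b
    proof -
      have "(SOME q. q \<in> a \<inter> b) \<in> a \<inter> b" by (rule someI[of _ q]) (use ab in simp)
      then show ?thesis unfolding Let_def using indep[OF ij ab(1,2)] ab by blast
    qed
    show "(let q = (SOME q. q \<in> f \<inter> g) in u i j q f - u i j q g) + (let q = (SOME q. q \<in> g \<inter> k) in u i j q g - u i j q k)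
      = (let q = (SOME q. q \<in> f \<inter> k) in u i j q f - u i j q k)"
      using sm * q by simp
  qed (use simply in \<open>simp_all add: fin_cells cell_compact cell_convex cell_nonempty domain_def\<close>)
  then have "\<forall>i j. \<exists>w. i \<le> d \<longrightarrow> j \<le> d \<longrightarrow> (\<forall>f\<in>cells M. \<forall>g\<in>cells M. f \<inter> g \<noteq> {} \<longrightarrow> w f - w g =
      (let q = (SOME q. q \<in> f \<inter> g) in u i j q f - u i j q g))" by blast
  then obtain w where w: "\<And>i j f g. i \<le> d \<Longrightarrow> j \<le> d \<Longrightarrow> f \<in> cells M \<Longrightarrow> g \<in> cells M \<Longrightarrow> f \<inter> g \<noteq> {} \<Longrightarrow>
     w i j f - w i j g = (let q = (SOME q. q \<in> f \<inter> g) in u i j q f - u i j q g)"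
    by metis
  have wu: "w i j f - w i j g = h i j ax r q" if ij: "i \<le> d" "j \<le> d" and g: "germ ax r True q f" "germ ax r False q g" for i j ax r q f g
  proof -
    have fg: "f \<in> cells M" "g \<in> cells M" "q \<in> f" "q \<in> g" using g unfolding germ_def by auto
    have s: "(SOME q. q \<in> f \<inter> g) \<in> f \<inter> g" by (rule someI[of _ q]) (use fg in simp)
    have "f \<inter> g \<noteq> {}" using fg(3,4) by blast
    then have "w i j f - w i j g = u i j (SOME q. q \<in> f \<inter> g) f - u i j (SOME q. q \<in> f \<inter> g) g"
      using w[OF ij fg(1,2)] unfolding Let_def by blast
    also have "\<dots> = u i j q f - u i j q g" by (rule indep[OF ij fg(1,2)]) (use s fg in auto)
    finally have "w i j f - w i j g = u i j q f - u i j q g" .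
    then show ?thesis using u[OF ij g] by simp
  qed
  define c :: coeffs where "c = (\<lambda>(f, i, j). if f \<in> cells M \<and> i \<le> d \<and> j \<le> d then w i j f - w i j base + k0 i j else 0)"
  have cfd: "coeff_along ax c f m n - coeff_along ax c g m n = \<alpha> ax r q m * beta d (along (\<not> ax) q) n"
    if mn: "m \<le> d" "n \<le> d" and g: "germ ax r True q f" "germ ax r False q g" for ax r q f g m n
  proof -
    have "f \<in> cells M" "g \<in> cells M" using g unfolding germ_def by auto
    then show ?thesis using wu[OF mn g] wu[OF mn(2,1) g] mn unfolding c_def coeff_along_def h_def by (cases ax) auto
  qed
  have cX: "c \<in> coeff_space d M"
    unfolding coeff_space_def
  proof (intro CollectI conjI allI ballI impI)
    show "c (f, i, j) = 0" if "\<not> (f \<in> cells M \<and> i \<le> d \<and> j \<le> d)" for f i j using that unfolding c_def by auto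
    fix ax f g assume fg: "f \<in> cells M" "g \<in> cells M" and ab: "above ax f g"
    define q where "q = pt ax (max (lo ax f) (lo ax g)) (lo (\<not> ax) f)"
    have g: "germ ax True True q f" "germ ax True False q g"
      using above_common(3)[OF ab fg order_refl above_common(1)[OF ab fg]] unfolding q_def by auto
    show "smooth_jump d ax (lo (\<not> ax) f) c f g" unfolding smooth_jump_def
    proof (intro allI impI)
      fix m n assume mn: "m \<le> d" "n \<le> d"
      show "coeff_along ax c f m n - coeff_along ax c g m n = beta d (lo (\<not> ax) f) n * (coeff_along ax c f m d - coeff_along ax c g m d)"
        using cfd[OF mn g] cfd[OF mn(1) order_refl g] unfolding q_def by simp
    qed
  qed
  have cofactor: "cofactor d c ax r q m = \<alpha> ax r q m" if "germ ax r True q f" "germ ax r False q g" "m \<le> d" for ax r q m f g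
    using cfd[OF that(3) order_refl that(1,2)] quadrant_cell_eq[OF that(1)] quadrant_cell_eq[OF that(2)] unfolding cofactor_def by simp
  have "c (base, i, j) = k0 i j" if "i \<le> d" "j \<le> d" "base \<in> cells M" for i j
    using that unfolding c_def by simp
  moreover have "cofactor d c ax True (pt ax a t) m = \<kappa> (seg ax t a b) m"
    if l: "is_ledge ax t a b" and e: "pt ax a t \<notin> interior (domain M)" "pt ax b t \<notin> interior (domain M)" and m: "m \<le> d" for ax t a b m
  proof -
    have ab: "a < b" using ledge_pos[OF l] .
    then have sp: "split ax True (pt ax a t)" using l unfolding is_ledge_def by auto
    then obtain f g where "germ ax True True (pt ax a t) f" "germ ax True False (pt ax a t) g" unfolding split_def by blast
    then have "cofactor d c ax True (pt ax a t) m = \<alpha> ax True (pt ax a t) m" using cofactor m by blast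
    also have "\<dots> = P ax t a b m + tot ax t {a..a} m" using \<alpha>I[OF l _ _ sp m] ab by simp
    also have "tot ax t {a..a} m = 0"
      using tot_insert[of a a ax t m] tot_empty \<delta>0[of "pt ax a t"] e unfolding interior_verts_def by simp
    finally show ?thesis using e unfolding P_def by simp
  qed
  moreover have "vertex_cofactor d c v = \<delta> v" if v: "v \<in> interior_verts M" for v
  proof -
    have q: "v \<in> interior (domain M)" using v unfolding interior_verts_def by simp
    have "cofactor d c True r v d = \<alpha> True r v d" for r
      using interior_germ[OF q] cofactor by (metis order_refl)
    then show ?thesis using cofactor_jump[OF cX q, of d True] \<alpha>1[OF q, of d True] by simp
  qed
  ultimately show ?thesis using cX by blast
qed

end

section \<open>The dimension of the spline space\<close>

definition free_verts :: "mesh \<Rightarrow> point set" where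
  "free_verts M = {v \<in> interior_verts M. v \<notin> \<Union>(T_ledges M)}"

type_synonym param = "(nat \<times> nat) + ((point set \<times> nat) + point)"

text \<open>The unconstrained data: the coefficients of one polynomial piece, which exists only if there is a cell,
the starting cofactors of the cross-cuts and the numbers at the vertices off the T l-edges.\<close>

definition free_index :: "nat \<Rightarrow> mesh \<Rightarrow> param set" where
  "free_index d M = {(i, j). i \<le> d \<and> j \<le> d \<and> cells M \<noteq> {}} <+> ((cross_cuts M \<times> {..d}) <+> free_verts M)"

lemma card_free_index:
  assumes "finite (cross_cuts M)" "finite (free_verts M)"
  shows "finite (free_index d M)"
    "card (free_index d M) = (if cells M = {} then 0 else (d + 1)\<^sup>2) + card (cross_cuts M) * (d + 1) + card (free_verts M)"
proof -
  have e: "{(i, j). i \<le> d \<and> j \<le> d \<and> cells M \<noteq> {}} = (if cells M = {} then {} else {..d} \<times> {..d})" by auto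
  show "finite (free_index d M)" unfolding free_index_def e using assms by auto
  show "card (free_index d M) = (if cells M = {} then 0 else (d + 1)\<^sup>2) + card (cross_cuts M) * (d + 1) + card (free_verts M)"
    unfolding free_index_def e using assms by (simp add: card_Plus card_cartesian_product power2_eq_square)
qed

lemma lo_seg: assumes "a \<le> b" shows "lo ax (seg ax t a b) = a" "lo (\<not> ax) (seg ax t a b) = t"
proof -
  have "along ax ` seg ax t a b = {a..b}"
  proof
    show "{a..b} \<subseteq> along ax ` seg ax t a b"
    proof
      fix x assume "x \<in> {a..b}"
      then show "x \<in> along ax ` seg ax t a b" by (intro image_eqI[of _ _ "pt ax x t"]) auto
    qed
  qed (auto simp: seg_def)
  then show "lo ax (seg ax t a b) = a" unfolding lo_def using assms by simp
  have "pt ax a t \<in> seg ax t a b" using assms by simp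
  then have "along (\<not> ax) ` seg ax t a b = {t}" unfolding seg_def by (auto intro: image_eqI[of _ _ "pt ax a t"])
  then show "lo (\<not> ax) (seg ax t a b) = t" unfolding lo_def by simp
qed

context T_mesh
begin

text \<open>As an l-edge is given as a point set, its axis and its first point are recovered from its extent.\<close>

definition start_cofactor :: "nat \<Rightarrow> coeffs \<Rightarrow> point set \<Rightarrow> nat \<Rightarrow> real" where
  "start_cofactor d c l m = cofactor d c (horizontal l) True (pt (horizontal l) (lo (horizontal l) l) (lo (\<not> horizontal l) l)) m"

lemma start_cofactor_seg: "a < b \<Longrightarrow> start_cofactor d c (seg ax t a b) m = cofactor d c ax True (pt ax a t) m"
  unfolding start_cofactor_def by (simp add: directed_seg lo_seg)

definition base :: "point set" where "base = (SOME f. f \<in> cells M)"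

lemma base_cell: "cells M \<noteq> {} \<Longrightarrow> base \<in> cells M"
  unfolding base_def by (meson all_not_in_conv someI)

definition cofactor_data :: "nat \<Rightarrow> coeffs \<Rightarrow> param + point \<Rightarrow> real" where
  "cofactor_data d c z = (case z of
      Inl i \<Rightarrow> if i \<in> free_index d M
        then (case i of Inl (i, j) \<Rightarrow> c (base, i, j) | Inr (Inl (l, m)) \<Rightarrow> start_cofactor d c l m | Inr (Inr v) \<Rightarrow> vertex_cofactor d c v)
        else 0
    | Inr v \<Rightarrow> if v \<in> gt_verts (T_component M) then vertex_cofactor d c v else 0)"

lemma linear_cofactor_data: "linear (cofactor_data d)"
proof -
  have a: "vertex_cofactor d (c + c') v = vertex_cofactor d c v + vertex_cofactor d c' v" "vertex_cofactor d (k *\<^sub>R c) v = k * vertex_cofactor d c v" for c c' :: coeffs and k v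
    by (auto simp: vertex_cofactor_def algebra_simps)
  have b: "cofactor d (c + c') ax r q m = cofactor d c ax r q m + cofactor d c' ax r q m" "cofactor d (k *\<^sub>R c) ax r q m = k * cofactor d c ax r q m"
    for c c' :: coeffs and k ax r q m
    by (auto simp: cofactor_def coeff_along_add coeff_along_scale algebra_simps)
  show ?thesis
    by (rule linearI) (auto simp: cofactor_data_def fun_eq_iff start_cofactor_def a b split: sum.splits)
qed

lemma interior_verts_cases:
  assumes "v \<in> interior_verts M" shows "v \<in> free_verts M \<or> v \<in> gt_verts (T_component M)"
  using assms unfolding gt_verts_T free_verts_def interior_verts_def by auto

lemma gt_verts_interior: "gt_verts (T_component M) \<subseteq> interior_verts M"
  using T_ledge_interior unfolding gt_verts_T interior_verts_def by blast

lemma T_ledge_vert_in_gt: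
  assumes "is_ledge ax t a b" "pt ax a t \<in> interior (domain M)" "pt ax b t \<in> interior (domain M)" "x \<in> vert_coords ax t \<inter> {a..b}"
  shows "pt ax x t \<in> gt_verts (T_component M)"
proof -
  have "seg ax t a b \<in> T_ledges M" using T_ledge_seg_iff assms by blast
  moreover have "pt ax x t \<in> seg ax t a b" "pt ax x t \<in> verts M" using assms(4) unfolding vert_coords_def by auto
  ultimately show ?thesis unfolding gt_verts_T by blast
qed

text \<open>With zero numbers at the vertices the cofactor is constant along the l-edge.  It is 0 at an end in the
interior, and for a cross-cut its value is one of the data.\<close>

lemma cofactor_zero_of_data_zero:
  assumes c: "c \<in> coeff_space d M" and z: "cofactor_data d c = 0"
    and l: "is_ledge ax t a b" and s: "a \<le> s" "s < b" and m: "m \<le> d"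
  shows "cofactor d c ax True (pt ax s t) m = 0"
proof -
  have lead0: "vertex_cofactor d c v = 0" if v: "v \<in> interior_verts M" for v
  proof -
    have z1: "cofactor_data d c (Inl (Inr (Inr v))) = 0" and z2: "cofactor_data d c (Inr v) = 0" using z by simp_all
    show ?thesis using interior_verts_cases[OF v]
    proof
      assume "v \<in> free_verts M"
      then have "(Inr (Inr v) :: param) \<in> free_index d M" unfolding free_index_def by auto
      then show ?thesis using z1 unfolding cofactor_data_def by simp
    next
      assume "v \<in> gt_verts (T_component M)"
      then show ?thesis using z2 unfolding cofactor_data_def by simp
    qed
  qed
  have ab: "a < b" using ledge_pos[OF l] .
  have int0: "vertex_cofactor d c (pt ax x t) = 0" if "x \<in> vert_coords ax t" "pt ax x t \<in> interior (domain M)" for x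
    using lead0 that unfolding vert_coords_def interior_verts_def by simp
  have mid: "vertex_cofactor d c (pt ax x t) = 0" if "x \<in> vert_coords ax t" "a < x" "x < b" for x
    using int0[OF that(1)] ledge_interior[OF l that(2,3)] by blast
  have ends: "a \<in> vert_coords ax t" "b \<in> vert_coords ax t" using ledge_ends[OF l] unfolding vert_coords_def by auto
  have 1: "cofactor d c ax True (pt ax s t) m = cofactor d c ax True (pt ax a t) m"
    using cofactor_along[OF l c m s] mid s by (simp add: sum.neutral)
  have 2: "cofactor d c ax False (pt ax b t) m = cofactor d c ax True (pt ax a t) m"
    using cofactor_along_left[OF l c m ab order_refl] mid by (simp add: sum.neutral)
  show ?thesis
  proof (cases "pt ax a t \<in> interior (domain M)")
    case True
    then show ?thesis using 1 cofactor_start_interior[OF l c m True] int0[OF ends(1) True] by simp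
  next
    case a: False
    show ?thesis
    proof (cases "pt ax b t \<in> interior (domain M)")
      case True
      then show ?thesis using 1 2 cofactor_end_interior[OF l c m True] int0[OF ends(2) True] by simp
    next
      case False
      then have "seg ax t a b \<in> cross_cuts M" using cross_cut_seg_iff[OF l] a by blast
      then have "(Inr (Inl (seg ax t a b, m)) :: param) \<in> free_index d M" unfolding free_index_def using m by auto
      moreover have "cofactor_data d c (Inl (Inr (Inl (seg ax t a b, m)))) = 0" using z by simp
      ultimately have "start_cofactor d c (seg ax t a b) m = 0" unfolding cofactor_data_def by simp
      then show ?thesis using 1 start_cofactor_seg[OF ab] by simp
    qed
  qed
qed

text \<open>All cofactors vanish, so neighbouring cells carry the same polynomial.  The domain is connected, hence
this polynomial is the one on the base cell, which is 0.\<close>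

lemma cofactor_data_zero:
  assumes c: "c \<in> coeff_space d M" and z: "cofactor_data d c = 0"
  shows "c = 0"
proof (cases "cells M = {}")
  case True
  then show ?thesis using c unfolding coeff_space_def by (auto simp: fun_eq_iff)
next
  case False
  define same where "same f g \<longleftrightarrow> (\<forall>i j. c (f, i, j) = c (g, i, j))" for f g
  have outside: "c (f, i, j) = 0" if "\<not> (f \<in> cells M \<and> i \<le> d \<and> j \<le> d)" for f i j
    using c that unfolding coeff_space_def by blast
  have step: "same f g" if ab: "above ax f g" and fg: "f \<in> cells M" "g \<in> cells M" for ax f g
  proof -
    define s t where "s = max (lo ax f) (lo ax g)" and "t = lo (\<not> ax) f"
    have g: "germ ax True True (pt ax s t) f" "germ ax True False (pt ax s t) g"
      using above_common(3)[OF ab fg order_refl above_common(1)[OF ab fg]] unfolding s_def t_def by auto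
    then have sp: "split ax True (pt ax s t)" using above_neq[OF ab fg] unfolding split_def by blast
    then obtain a b where l: "is_ledge ax t a b" "a \<le> s" "s \<le> b" using ledge_exists[OF sp] unfolding along_pt by metis
    have "s \<noteq> b" using l(1) sp unfolding is_ledge_def by auto
    then have cof0: "cofactor d c ax True (pt ax s t) m = 0" if "m \<le> d" for m
      using cofactor_zero_of_data_zero[OF c z l(1,2) _ that] l(3) by simp
    have sj: "smooth_jump d ax t c f g" using c ab fg unfolding coeff_space_def t_def by blast
    have "coeff_along ax c f m n = coeff_along ax c g m n" for m n
    proof (cases "m \<le> d \<and> n \<le> d")
      case True
      then have "coeff_along ax c f m n - coeff_along ax c g m n = beta d t n * (coeff_along ax c f m d - coeff_along ax c g m d)"
        using sj unfolding smooth_jump_def by blast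
      also have "coeff_along ax c f m d - coeff_along ax c g m d = 0"
        using cof0[of m] True quadrant_cell_eq[OF g(1)] quadrant_cell_eq[OF g(2)] unfolding cofactor_def by simp
      finally show ?thesis by simp
    next
      case False
      then show ?thesis using outside unfolding coeff_along_def by auto
    qed
    then show ?thesis unfolding same_def coeff_along_def by (cases ax) auto
  qed
  have meet: "same f g" if fg: "f \<in> cells M" "g \<in> cells M" "f \<inter> g \<noteq> {}" for f g
  proof -
    obtain p where p: "p \<in> f" "p \<in> g" using fg by blast
    show ?thesis
      by (rule linked_at_point[of same p]) (use step fg p in \<open>auto simp: same_def\<close>)
  qed
  have base: "base \<in> cells M" using base_cell[OF False] .
  have all: "same f base" if "f \<in> cells M" for f
  proof (rule closed_cover_all_related[where C = "cells M" and R = "\<lambda>f. same f base" and ?f0.0 = base])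
    show "connected (\<Union>(cells M))" using simply simply_connected_imp_connected unfolding domain_def by blast
    show "same f base" if "f \<in> cells M" "g \<in> cells M" "f \<inter> g \<noteq> {}" "same g base" for f g
      using meet[OF that(1-3)] that(4) unfolding same_def by simp
    show "same base base" unfolding same_def by simp
  qed (use fin_cells cell_closed cell_nonempty base that in auto)
  have base0: "c (base, i, j) = 0" for i j
  proof (cases "i \<le> d \<and> j \<le> d")
    case True
    then have "(Inl (i, j) :: param) \<in> free_index d M" unfolding free_index_def using False by auto
    moreover have "cofactor_data d c (Inl (Inl (i, j))) = 0" using z by simp
    ultimately show ?thesis unfolding cofactor_data_def by simp
  qed (use outside in auto)
  have "c (f, i, j) = 0" for f i j
    using all[of f] base0[of i j] outside[of f i j] unfolding same_def by (cases "f \<in> cells M") auto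
  then show ?thesis by (auto simp: fun_eq_iff)
qed

lemma inj_on_cofactor_data: "inj_on (cofactor_data d) (coeff_space d M)"
proof (rule inj_onI)
  fix c c' assume c: "c \<in> coeff_space d M" "c' \<in> coeff_space d M" and eq: "cofactor_data d c = cofactor_data d c'"
  have "c - c' \<in> coeff_space d M" using c subspace_coeff_space subspace_diff by blast
  moreover have "cofactor_data d (c - c') = 0" using linear_diff[OF linear_cofactor_data] eq by simp
  ultimately show "c = c'" using cofactor_data_zero by fastforce
qed

text \<open>The conformality conditions on the vertices of the T l-edges are necessary by
\<open>vertex_cofactor_sum_zero\<close> and sufficient by \<open>prescribed_cofactors\<close>.\<close>

lemma cofactor_data_image: "cofactor_data d ` coeff_space d M = free_sum (free_index d M) (CVS d (T_component M))"
proof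
  show "cofactor_data d ` coeff_space d M \<subseteq> free_sum (free_index d M) (CVS d (T_component M))"
  proof clarify
    fix c assume c: "c \<in> coeff_space d M"
    have "cofactor_data d c \<circ> Inr \<in> CVS d (T_component M)"
      unfolding CVS_T_iff
    proof (intro conjI allI impI)
      show "(cofactor_data d c \<circ> Inr) p = 0" if "p \<notin> gt_verts (T_component M)" for p using that by (simp add: cofactor_data_def)
      fix ax t a b m
      assume *: "is_ledge ax t a b" "pt ax a t \<in> interior (domain M)" "pt ax b t \<in> interior (domain M)" "m \<le> d"
      have "(\<Sum>x\<in>vert_coords ax t \<inter> {a..b}. beta d x m * (cofactor_data d c \<circ> Inr) (pt ax x t)) = (\<Sum>x\<in>vert_coords ax t \<inter> {a..b}. beta d x m * vertex_cofactor d c (pt ax x t))"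
        using T_ledge_vert_in_gt[OF *(1-3)] by (intro sum.cong refl) (simp add: cofactor_data_def)
      then show "(\<Sum>x\<in>vert_coords ax t \<inter> {a..b}. beta d x m * (cofactor_data d c \<circ> Inr) (pt ax x t)) = 0"
        using vertex_cofactor_sum_zero[OF *(1) c *(4,2,3)] by simp
    qed
    then show "cofactor_data d c \<in> free_sum (free_index d M) (CVS d (T_component M))"
      unfolding free_sum_def by (simp add: cofactor_data_def)
  qed
  show "free_sum (free_index d M) (CVS d (T_component M)) \<subseteq> cofactor_data d ` coeff_space d M"
  proof
    fix y assume y: "y \<in> free_sum (free_index d M) (CVS d (T_component M))"
    then have yK: "y \<circ> Inr \<in> CVS d (T_component M)" and y0: "\<And>i. i \<notin> free_index d M \<Longrightarrow> y (Inl i) = 0" unfolding free_sum_def by auto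
    \<comment> \<open>The two families of vertices are disjoint and together are all interior vertices.\<close>
    define \<delta> where "\<delta> v = (if v \<in> gt_verts (T_component M) then y (Inr v) else if v \<in> free_verts M then y (Inl (Inr (Inr v))) else 0)" for v
    have "\<delta> v = 0" if "v \<notin> interior_verts M" for v
      using that gt_verts_interior unfolding \<delta>_def free_verts_def by auto
    moreover have "(\<Sum>x\<in>vert_coords ax t \<inter> {a..b}. beta d x m * \<delta> (pt ax x t)) = 0"
      if *: "is_ledge ax t a b" "pt ax a t \<in> interior (domain M)" "pt ax b t \<in> interior (domain M)" "m \<le> d" for ax t a b m
    proof -
      have "(\<Sum>x\<in>vert_coords ax t \<inter> {a..b}. beta d x m * \<delta> (pt ax x t)) = (\<Sum>x\<in>vert_coords ax t \<inter> {a..b}. beta d x m * (y \<circ> Inr) (pt ax x t))"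
        using T_ledge_vert_in_gt[OF *(1-3)] by (intro sum.cong refl) (simp add: \<delta>_def)
      then show ?thesis using yK * unfolding CVS_T_iff by simp
    qed
    ultimately obtain c where c: "c \<in> coeff_space d M"
      and cb: "\<And>i j. i \<le> d \<Longrightarrow> j \<le> d \<Longrightarrow> base \<in> cells M \<Longrightarrow> c (base, i, j) = y (Inl (Inl (i, j)))"
      and cc: "\<And>ax t a b m. is_ledge ax t a b \<Longrightarrow> pt ax a t \<notin> interior (domain M) \<Longrightarrow> pt ax b t \<notin> interior (domain M) \<Longrightarrow> m \<le> d \<Longrightarrow>
         cofactor d c ax True (pt ax a t) m = y (Inl (Inr (Inl (seg ax t a b, m))))"
      and cl: "\<And>v. v \<in> interior_verts M \<Longrightarrow> vertex_cofactor d c v = \<delta> v"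
      using prescribed_cofactors[of \<delta> d base "\<lambda>i j. y (Inl (Inl (i, j)))" "\<lambda>l m. y (Inl (Inr (Inl (l, m))))"] by auto
    have "cofactor_data d c z = y z" for z
    proof (cases z)
      case (Inr v)
      have "y (Inr v) = 0" if "v \<notin> gt_verts (T_component M)"
        using yK that unfolding CVS_T_iff comp_apply by blast
      then show ?thesis using Inr cl[of v] gt_verts_interior by (auto simp: cofactor_data_def \<delta>_def)
    next
      case (Inl i)
      show ?thesis
      proof (cases "i \<in> free_index d M")
        case False
        then show ?thesis using Inl y0 by (simp add: cofactor_data_def)
      next
        case True
        then consider i' j' where "i = Inl (i', j')" "i' \<le> d" "j' \<le> d" "cells M \<noteq> {}"
          | l m where "i = Inr (Inl (l, m))" "l \<in> cross_cuts M" "m \<le> d" | v where "i = Inr (Inr v)" "v \<in> free_verts M"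
          unfolding free_index_def by auto
        then show ?thesis
        proof cases
          case 1
          then show ?thesis using True Inl cb base_cell by (simp add: cofactor_data_def)
        next
          case 2
          then have "l \<in> interior_ledges M" unfolding cross_cuts_def by simp
          then obtain ax t a b where l: "is_ledge ax t a b" "l = seg ax t a b" by (rule ledge_of_maximal)
          have "pt ax a t \<notin> interior (domain M)" "pt ax b t \<notin> interior (domain M)" using cross_cut_seg_iff[OF l(1)] l(2) 2 by auto
          then have "start_cofactor d c l m = y (Inl (Inr (Inl (l, m))))"
            unfolding l(2) start_cofactor_seg[OF ledge_pos[OF l(1)]] using cc[OF l(1)] 2(3) by blast
          then show ?thesis using True Inl 2 by (simp add: cofactor_data_def)
        next
          case 3
          then have "v \<in> interior_verts M" "v \<notin> gt_verts (T_component M)" unfolding free_verts_def gt_verts_T by auto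
          then have "vertex_cofactor d c v = y (Inl (Inr (Inr v)))" using cl 3(2) unfolding \<delta>_def by simp
          then show ?thesis using True Inl 3 by (simp add: cofactor_data_def)
        qed
      qed
    qed
    then show "y \<in> cofactor_data d ` coeff_space d M" using c by (intro image_eqI[of _ _ c]) (auto simp: fun_eq_iff)
  qed
qed

lemma finite_interior_ledges: "finite (interior_ledges M)"
proof -
  have "interior_ledges M \<subseteq> Union ` Pow (interior_edges M)"
    unfolding interior_ledges_def maximal_segments_def segment_of_def by blast
  moreover have "finite (interior_edges M)" using fin_edges unfolding interior_edges_def by simp
  ultimately show ?thesis using finite_subset by blast
qed

lemma subspace_CVS: "subspace (CVS d G)"
  unfolding subspace_def CVS_def
  by (auto simp: algebra_simps sum.distrib mult.left_commute[of _ "_ :: real"] sum_distrib_left[symmetric])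

theorem dim_spline_space_formula:
  assumes "d \<ge> 1"
  shows "dim (spline_space d M) = (if cells M = {} then 0 else (d + 1)\<^sup>2) + card (cross_cuts M) * (d + 1)
     + card (free_verts M) + dim (CVS d (T_component M))"
proof -
  have fin: "finite (cross_cuts M)" "finite (free_verts M)"
    using finite_interior_ledges fin_verts unfolding cross_cuts_def free_verts_def interior_verts_def by auto
  have "dim (spline_space d M) = dim (cofactor_data d ` coeff_space d M)"
    using dim_spline_space[OF assms] dim_image_inj_on[OF linear_cofactor_data subspace_coeff_space inj_on_cofactor_data] by simp
  also have "\<dots> = card (free_index d M) + dim (CVS d (T_component M))"
    unfolding cofactor_data_image
  proof (rule dim_free_sum[OF card_free_index(1)[OF fin] subspace_CVS])
    fix B assume B: "independent B" "B \<subseteq> CVS d (T_component M)"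
    have "finite (gt_verts (T_component M))" using fin_verts unfolding gt_verts_T by simp
    then show "finite B" using finite_basis_of_finite_support[OF _ _ B] unfolding CVS_def by blast
  qed
  finally show ?thesis using card_free_index(2)[OF fin] by simp
qed

end

section \<open>Counting vertices by incidences of l-edges\<close>

lemma card_eq_of_incidence:
  assumes "\<And>v. v \<in> V \<Longrightarrow> \<exists>l\<in>D. R l v" and "\<And>l. l \<in> D \<Longrightarrow> \<exists>v\<in>V. R l v"
    and "\<And>l v v'. l \<in> D \<Longrightarrow> v \<in> V \<Longrightarrow> v' \<in> V \<Longrightarrow> R l v \<Longrightarrow> R l v' \<Longrightarrow> v = v'"
    and "\<And>l l' v. l \<in> D \<Longrightarrow> l' \<in> D \<Longrightarrow> v \<in> V \<Longrightarrow> R l v \<Longrightarrow> R l' v \<Longrightarrow> l = l'"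
  shows "card V = card D"
proof -
  obtain f where f: "\<And>v. v \<in> V \<Longrightarrow> f v \<in> D \<and> R (f v) v" using assms(1) by metis
  have "bij_betw f V D"
    unfolding bij_betw_def
  proof
    show "inj_on f V" using f assms(3) by (intro inj_onI) metis
    show "f ` V = D"
    proof
      show "D \<subseteq> f ` V"
      proof
        fix l assume l: "l \<in> D"
        then obtain v where v: "v \<in> V" "R l v" using assms(2) by blast
        then have "l = f v" using assms(4)[OF l] f by blast
        then show "l \<in> f ` V" using v by blast
      qed
    qed (use f in blast)
  qed
  then show ?thesis by (rule bij_betw_same_card)
qed

text \<open>Two cross-cuts or rays may also meet at a reentrant corner of the domain.  The last condition excludes
this by incidences only: the boundary l-edges through the corner meet both.\<close>

definition crossing_pairs :: "mesh \<Rightarrow> (point set \<times> point set) set" where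
  "crossing_pairs M = {(l, l'). l \<in> cross_cuts M \<union> rays M \<and> l' \<in> cross_cuts M \<union> rays M \<and> l \<noteq> l' \<and> l \<inter> l' \<noteq> {} \<and>
     \<not> (\<exists>b\<in>boundary_ledges M. b \<inter> l \<noteq> {} \<and> b \<inter> l' \<noteq> {})}"

context T_mesh
begin

lemma ledge_at_interior_point:
  assumes "l \<in> ledges M" "p \<in> l" "p \<in> interior (domain M)" shows "l \<in> interior_ledges M"
proof (rule ccontr)
  assume "l \<notin> interior_ledges M"
  then have "l \<in> boundary_ledges M" using assms(1) unfolding ledges_def by blast
  then have "l \<subseteq> frontier (domain M)" using boundary_ledge_form by metis
  then show False using assms unfolding frontier_domain by blast
qed

lemma ledge_split:
  assumes "is_ledge ax t a b" "p \<in> seg ax t a b" shows "\<exists>r. split ax r p"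
proof -
  have p: "p = pt ax (along ax p) t" "a \<le> along ax p" "along ax p \<le> b"
    using assms(2) pt_along[of ax p] unfolding seg_def by auto
  have "a < b" using ledge_pos[OF assms(1)] .
  then show ?thesis using assms(1) p unfolding is_ledge_def by (metis less_eq_real_def not_le)
qed

lemma ledges_meet:
  assumes l: "is_ledge ax t a b" and l': "is_ledge ax' t' a' b'" and p: "p \<in> seg ax t a b" "p \<in> seg ax' t' a' b'"
    and ne: "seg ax t a b \<noteq> seg ax' t' a' b'"
  shows "ax' = (\<not> ax)" "p = pt ax t' t" "p \<in> verts M"
proof -
  show ax': "ax' = (\<not> ax)"
  proof (rule ccontr)
    assume "ax' \<noteq> (\<not> ax)"
    then have e: "ax' = ax" by auto
    then have "t' = t" using p unfolding seg_def by auto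
    then have "a = a'" "b = b'" using ledge_unique[OF l, of a' b' "along ax p"] l' p e unfolding seg_def by auto
    then show False using ne e \<open>t' = t\<close> by simp
  qed
  show "p = pt ax t' t" using p pt_along[of ax p] unfolding ax' seg_def by auto
  show "p \<in> verts M" using ledge_split[OF l p(1)] ledge_split[OF l' p(2)] split_imp_vert unfolding ax' by blast
qed

lemma ledge_through_vert:
  assumes "v \<in> interior_verts M"
  obtains t a b where "is_ledge ax t a b" "v \<in> seg ax t a b"
proof -
  obtain r where "split ax r v" using vert_imp_split assms unfolding interior_verts_def by blast
  then obtain a b where "is_ledge ax (along (\<not> ax) v) a b" "a \<le> along ax v" "along ax v \<le> b" using ledge_exists by metis
  then show thesis using that unfolding seg_def by auto
qed

lemma interior_ledges_classified: "interior_ledges M = cross_cuts M \<union> rays M \<union> T_ledges M"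
proof
  show "interior_ledges M \<subseteq> cross_cuts M \<union> rays M \<union> T_ledges M"
  proof
    fix l assume "l \<in> interior_ledges M"
    then obtain ax t a b where "is_ledge ax t a b" "l = seg ax t a b" by (rule ledge_of_maximal)
    then show "l \<in> cross_cuts M \<union> rays M \<union> T_ledges M" using cross_cut_seg_iff ray_seg_iff T_ledge_seg_iff by blast
  qed
qed (auto simp: cross_cuts_def rays_def T_ledges_def)

lemma T_not_cross_cut_or_ray: "l \<in> T_ledges M \<Longrightarrow> l \<notin> cross_cuts M \<union> rays M"
  using T_ledge_form cross_cut_seg_iff ray_seg_iff by (metis Un_iff)

text \<open>All points of a T l-edge are interior, so only interior l-edges meet it, each perpendicularly and in a
vertex; conversely a perpendicular l-edge passes through each of its vertices.\<close>

lemma card_verts_on_T_ledge: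
  assumes l: "l \<in> T_ledges M"
  shows "card (verts M \<inter> l) = card {l' \<in> ledges M. l' \<noteq> l \<and> l' \<inter> l \<noteq> {}}"
proof -
  obtain ax t a b where s: "is_ledge ax t a b" "l = seg ax t a b" using T_ledge_form[OF l] by metis
  have int: "l \<subseteq> interior (domain M)" using T_ledge_interior[OF l] .
  have other: "\<exists>ax' t' a' b'. is_ledge ax' t' a' b' \<and> l' = seg ax' t' a' b'" if l': "l' \<in> ledges M" "l' \<inter> l \<noteq> {}" for l'
  proof -
    obtain p where "p \<in> l'" "p \<in> l" using l' by blast
    then have "l' \<in> interior_ledges M" using ledge_at_interior_point[OF l'(1)] int by blast
    then show ?thesis unfolding interior_ledge_iff .
  qed
  show ?thesis
  proof (rule card_eq_of_incidence[where R = "\<lambda>l' v. v \<in> l'"])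
    fix v assume v: "v \<in> verts M \<inter> l"
    then have "v \<in> interior_verts M" using int unfolding interior_verts_def by blast
    then obtain t' a' b' where l': "is_ledge (\<not> ax) t' a' b'" "v \<in> seg (\<not> ax) t' a' b'" by (rule ledge_through_vert)
    have "seg (\<not> ax) t' a' b' \<noteq> l" using ledge_pos[OF l'(1)] ledge_pos[OF s(1)] unfolding s(2) by (simp add: seg_eq_iff)
    then show "\<exists>l'\<in>{l' \<in> ledges M. l' \<noteq> l \<and> l' \<inter> l \<noteq> {}}. v \<in> l'"
      using maximal_of_ledge[OF l'(1)] l'(2) v unfolding ledges_def by blast
  next
    fix l' assume l': "l' \<in> {l' \<in> ledges M. l' \<noteq> l \<and> l' \<inter> l \<noteq> {}}"
    then obtain ax' t' a' b' where s': "is_ledge ax' t' a' b'" "l' = seg ax' t' a' b'" using other by blast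
    obtain p where p: "p \<in> l" "p \<in> l'" using l' by blast
    then have "p \<in> verts M" using ledges_meet(3)[OF s(1) s'(1)] l' unfolding s(2) s'(2) by blast
    then show "\<exists>v\<in>verts M \<inter> l. v \<in> l'" using p by blast
  next
    fix l' v v' assume l': "l' \<in> {l' \<in> ledges M. l' \<noteq> l \<and> l' \<inter> l \<noteq> {}}" and v: "v \<in> verts M \<inter> l" "v' \<in> verts M \<inter> l" "v \<in> l'" "v' \<in> l'"
    then obtain ax' t' a' b' where s': "is_ledge ax' t' a' b'" "l' = seg ax' t' a' b'" using other by blast
    have "v = pt ax t' t" "v' = pt ax t' t" using ledges_meet(2)[OF s(1) s'(1)] v l' unfolding s(2) s'(2) by blast+
    then show "v = v'" by simp
  next
    fix l' l'' v assume l': "l' \<in> {l' \<in> ledges M. l' \<noteq> l \<and> l' \<inter> l \<noteq> {}}" "l'' \<in> {l' \<in> ledges M. l' \<noteq> l \<and> l' \<inter> l \<noteq> {}}"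
      and v: "v \<in> verts M \<inter> l" "v \<in> l'" "v \<in> l''"
    then obtain ax' t' a' b' where s': "is_ledge ax' t' a' b'" "l' = seg ax' t' a' b'" using other by blast
    obtain ax'' t'' a'' b'' where s'': "is_ledge ax'' t'' a'' b''" "l'' = seg ax'' t'' a'' b''" using other l'(2) by blast
    have "ax' = (\<not> ax)" "ax'' = (\<not> ax)"
      using ledges_meet(1)[OF s(1) s'(1)] ledges_meet(1)[OF s(1) s''(1)] v l' unfolding s(2) s'(2) s''(2) by blast+
    then show "l' = l''"
      using ledges_meet(1)[OF s'(1) s''(1), of v] v unfolding s'(2) s''(2) by blast
  qed
qed

text \<open>A boundary l-edge meets the two perpendicular l-edges in points different from \<open>v\<close>, so these points
differ in both coordinates and cannot lie on an axis-parallel line.\<close>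

lemma boundary_ledge_not_both:
  assumes l: "is_ledge ax t a b" and l': "is_ledge (\<not> ax) t' a' b'" and v: "v \<in> seg ax t a b" "v \<in> seg (\<not> ax) t' a' b'"
    and int: "v \<in> interior (domain M)" and k: "k \<in> boundary_ledges M" "k \<inter> seg ax t a b \<noteq> {}" "k \<inter> seg (\<not> ax) t' a' b' \<noteq> {}"
  shows False
proof -
  obtain ax2 t2 a2 b2 where k2: "k = seg ax2 t2 a2 b2" "k \<subseteq> frontier (domain M)" using boundary_ledge_form[OF k(1)] by metis
  obtain p where p: "p \<in> k" "p \<in> seg ax t a b" using k(2) by blast
  obtain q where q: "q \<in> k" "q \<in> seg (\<not> ax) t' a' b'" using k(3) by blast
  have "p \<noteq> v" "q \<noteq> v" using p(1) q(1) k2(2) int unfolding frontier_domain by blast+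
  then have "along ax p \<noteq> along ax v" "along (\<not> ax) q \<noteq> along (\<not> ax) v"
    "along (\<not> ax) p = along (\<not> ax) v" "along ax q = along ax v"
    using p(2) q(2) v point_eq_iff[of p v ax] point_eq_iff[of q v ax] unfolding seg_def by auto
  moreover have "along (\<not> ax2) p = along (\<not> ax2) q" using p(1) q(1) unfolding k2(1) seg_def by simp
  ultimately show False by (cases "ax2 = ax") (auto simp: neq_iff)
qed

text \<open>A vertex off the T l-edges corresponds to the pair of its horizontal and its vertical l-edge, in either
order.\<close>

lemma card_crossing_pairs: "card (crossing_pairs M) = 2 * card (free_verts M)"
proof -
  have "card (free_verts M \<times> (UNIV :: bool set)) = card (crossing_pairs M)"
  proof (rule card_eq_of_incidence[where R = "\<lambda>L z. fst z \<in> fst L \<inter> snd L \<and> (horizontal (fst L) \<longleftrightarrow> snd z)"])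
    fix z :: "point \<times> bool" assume z: "z \<in> free_verts M \<times> UNIV"
    define v ax where "v = fst z" and "ax = snd z"
    have v: "v \<in> interior_verts M" "v \<notin> \<Union>(T_ledges M)"
      using z unfolding v_def free_verts_def mem_Times_iff by blast+
    have vi: "v \<in> interior (domain M)" using v(1) unfolding interior_verts_def by simp
    obtain t a b where l: "is_ledge ax t a b" "v \<in> seg ax t a b" by (rule ledge_through_vert[OF v(1)])
    obtain t' a' b' where l': "is_ledge (\<not> ax) t' a' b'" "v \<in> seg (\<not> ax) t' a' b'" by (rule ledge_through_vert[OF v(1)])
    have "seg ax t a b \<in> cross_cuts M \<union> rays M" "seg (\<not> ax) t' a' b' \<in> cross_cuts M \<union> rays M"
      using maximal_of_ledge[OF l(1)] maximal_of_ledge[OF l'(1)] v(2) l(2) l'(2) unfolding interior_ledges_classified by blast+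
    moreover have "seg ax t a b \<noteq> seg (\<not> ax) t' a' b'" using ledge_pos[OF l(1)] ledge_pos[OF l'(1)] by (simp add: seg_eq_iff)
    moreover have "\<not> (\<exists>k\<in>boundary_ledges M. k \<inter> seg ax t a b \<noteq> {} \<and> k \<inter> seg (\<not> ax) t' a' b' \<noteq> {})"
      using boundary_ledge_not_both[OF l(1) l'(1) l(2) l'(2) vi] by blast
    ultimately have "(seg ax t a b, seg (\<not> ax) t' a' b') \<in> crossing_pairs M"
      unfolding crossing_pairs_def using l(2) l'(2) by blast
    then show "\<exists>L\<in>crossing_pairs M. fst z \<in> fst L \<inter> snd L \<and> (horizontal (fst L) \<longleftrightarrow> snd z)"
    proof (rule bexI[rotated])
      show "fst z \<in> fst (seg ax t a b, seg (\<not> ax) t' a' b') \<inter> snd (seg ax t a b, seg (\<not> ax) t' a' b') \<and>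
          (horizontal (fst (seg ax t a b, seg (\<not> ax) t' a' b')) \<longleftrightarrow> snd z)"
        unfolding fst_conv snd_conv v_def[symmetric] ax_def[symmetric]
        using l(2) l'(2) directed_seg(1)[OF ledge_pos[OF l(1)]] by blast
    qed
  next
    fix L assume "L \<in> crossing_pairs M"
    then obtain l l' where L: "L = (l, l')" "l \<in> cross_cuts M \<union> rays M" "l' \<in> cross_cuts M \<union> rays M" "l \<noteq> l'" "l \<inter> l' \<noteq> {}"
      "\<not> (\<exists>k\<in>boundary_ledges M. k \<inter> l \<noteq> {} \<and> k \<inter> l' \<noteq> {})"
      unfolding crossing_pairs_def by (elim CollectE case_prodE conjE) (rule that)
    have il: "l \<in> interior_ledges M" "l' \<in> interior_ledges M" using L(2,3) interior_ledges_classified by blast+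
    obtain ax t a b where s: "is_ledge ax t a b" "l = seg ax t a b" by (rule ledge_of_maximal[OF il(1)])
    obtain ax' t' a' b' where s': "is_ledge ax' t' a' b'" "l' = seg ax' t' a' b'" by (rule ledge_of_maximal[OF il(2)])
    obtain p where p: "p \<in> l" "p \<in> l'" using L(5) by blast
    have m: "ax' = (\<not> ax)" "p \<in> verts M" using ledges_meet[OF s(1) s'(1)] p L(4) unfolding s(2) s'(2) by blast+
    have "p \<in> domain M"
    proof -
      obtain r where "split ax r p" using ledge_split[OF s(1)] p s(2) by blast
      then show ?thesis unfolding split_def germ_def domain_def by blast
    qed
    then have pi: "p \<in> interior (domain M)"
      using frontier_on_boundary_ledge[of p] L(6) p unfolding frontier_domain by blast
    have "p \<notin> k" if k: "k \<in> T_ledges M" for k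
    proof
      assume pk: "p \<in> k"
      obtain ax2 t2 a2 b2 where s2: "is_ledge ax2 t2 a2 b2" "k = seg ax2 t2 a2 b2" using T_ledge_form[OF k] by metis
      have "k \<noteq> l" "k \<noteq> l'" using T_not_cross_cut_or_ray[OF k] L(2,3) by blast+
      then have "ax2 = (\<not> ax)" "ax2 = (\<not> ax')"
        using ledges_meet(1)[OF s(1) s2(1), of p] ledges_meet(1)[OF s'(1) s2(1), of p] p pk unfolding s(2) s'(2) s2(2) by blast+
      then show False using m(1) by blast
    qed
    then have "p \<in> free_verts M" using m(2) pi unfolding free_verts_def interior_verts_def by blast
    then show "\<exists>z\<in>free_verts M \<times> UNIV. fst z \<in> fst L \<inter> snd L \<and> (horizontal (fst L) \<longleftrightarrow> snd z)"
      using p L(1) by (intro bexI[of _ "(p, horizontal l)"]) auto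
  next
    fix L and z z' :: "point \<times> bool"
    assume L: "L \<in> crossing_pairs M" and *: "fst z \<in> fst L \<inter> snd L \<and> (horizontal (fst L) \<longleftrightarrow> snd z)"
      "fst z' \<in> fst L \<inter> snd L \<and> (horizontal (fst L) \<longleftrightarrow> snd z')"
    have il: "fst L \<in> interior_ledges M" "snd L \<in> interior_ledges M" and ne: "fst L \<noteq> snd L"
      using L unfolding interior_ledges_classified crossing_pairs_def mem_Collect_eq case_prod_beta by blast+
    obtain ax t a b where s: "is_ledge ax t a b" "fst L = seg ax t a b" by (rule ledge_of_maximal[OF il(1)])
    obtain ax' t' a' b' where s': "is_ledge ax' t' a' b'" "snd L = seg ax' t' a' b'" by (rule ledge_of_maximal[OF il(2)])
    have "fst z = pt ax t' t" "fst z' = pt ax t' t" using ledges_meet(2)[OF s(1) s'(1)] * ne unfolding s(2) s'(2) by blast+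
    then show "z = z'" using * by (simp add: prod_eq_iff)
  next
    fix L L' and z :: "point \<times> bool"
    assume L: "L \<in> crossing_pairs M" "L' \<in> crossing_pairs M" and *: "fst z \<in> fst L \<inter> snd L \<and> (horizontal (fst L) \<longleftrightarrow> snd z)"
      "fst z \<in> fst L' \<inter> snd L' \<and> (horizontal (fst L') \<longleftrightarrow> snd z)"
    have il: "fst L \<in> interior_ledges M" "snd L \<in> interior_ledges M" "fst L' \<in> interior_ledges M" "snd L' \<in> interior_ledges M"
      and ne: "fst L \<noteq> snd L" "fst L' \<noteq> snd L'"
      using L unfolding interior_ledges_classified crossing_pairs_def mem_Collect_eq case_prod_beta by blast+
    obtain ax t a b where s: "is_ledge ax t a b" "fst L = seg ax t a b" by (rule ledge_of_maximal[OF il(1)])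
    obtain ax' t' a' b' where s': "is_ledge ax' t' a' b'" "snd L = seg ax' t' a' b'" by (rule ledge_of_maximal[OF il(2)])
    obtain ax2 t2 a2 b2 where s2: "is_ledge ax2 t2 a2 b2" "fst L' = seg ax2 t2 a2 b2" by (rule ledge_of_maximal[OF il(3)])
    obtain ax3 t3 a3 b3 where s3: "is_ledge ax3 t3 a3 b3" "snd L' = seg ax3 t3 a3 b3" by (rule ledge_of_maximal[OF il(4)])
    have "ax = snd z" "ax2 = snd z" using * directed_seg(1)[OF ledge_pos[OF s(1)]] directed_seg(1)[OF ledge_pos[OF s2(1)]] s(2) s2(2) by simp_all
    moreover have "ax' = (\<not> ax)" using ledges_meet(1)[OF s(1) s'(1), of "fst z"] * ne(1) s(2) s'(2) by simp
    moreover have "ax3 = (\<not> ax2)" using ledges_meet(1)[OF s2(1) s3(1), of "fst z"] * ne(2) s2(2) s3(2) by simp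
    ultimately have e: "ax2 = ax" "ax3 = ax'" by auto
    have "fst L = fst L'"
    proof (rule ccontr)
      assume "fst L \<noteq> fst L'"
      then show False using ledges_meet(1)[OF s(1) s2(1), of "fst z"] * s(2) s2(2) e by simp
    qed
    moreover have "snd L = snd L'"
    proof (rule ccontr)
      assume "snd L \<noteq> snd L'"
      then show False using ledges_meet(1)[OF s'(1) s3(1), of "fst z"] * s'(2) s3(2) e by simp
    qed
    ultimately show "L = L'" by (simp add: prod_eq_iff)
  qed
  then show ?thesis by (simp add: card_cartesian_product)
qed

lemma cells_empty_iff: "cells M = {} \<longleftrightarrow> boundary_ledges M = {}"
proof
  assume "cells M = {}"
  then have "domain M = {}" unfolding domain_def by simp
  then have "l = {}" if "l \<in> boundary_ledges M" for l using boundary_ledge_form[OF that] by (metis frontier_empty subset_empty)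
  moreover have "l \<noteq> {}" if k: "l \<in> boundary_ledges M" for l
  proof -
    obtain ax t a b where "a < b" "l = seg ax t a b" using boundary_ledge_form[OF k] by metis
    then have "pt ax a t \<in> l" by simp
    then show ?thesis by blast
  qed
  ultimately show "boundary_ledges M = {}" by blast
next
  assume "boundary_ledges M = {}"
  then have "frontier (domain M) = {}" using frontier_on_boundary_ledge by blast
  moreover have "compact (domain M)" unfolding domain_def using fin_cells cell_compact by (rule compact_Union)
  ultimately have "domain M = {}" using frontier_eq_empty[of "domain M"] not_compact_UNIV by metis
  then show "cells M = {}" using cell_nonempty unfolding domain_def by blast
qed

lemma gen_T_component_T:
  assumes "gt_connected (T_component M)" shows "gen_T_component (T_component M)"
proof -
  have fin: "finite (T_ledges M)" using finite_interior_ledges unfolding T_ledges_def by simp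
  have meet: "horizontal l \<noteq> horizontal l' \<and> l \<inter> l' \<subseteq> verts M \<and> vertical l \<noteq> vertical l'"
    if l: "l \<in> T_ledges M" "l' \<in> T_ledges M" "l \<noteq> l'" "l \<inter> l' \<noteq> {}" for l l'
  proof -
    obtain ax t a b where s: "is_ledge ax t a b" "l = seg ax t a b" using T_ledge_form[OF l(1)] by metis
    obtain ax' t' a' b' where s': "is_ledge ax' t' a' b'" "l' = seg ax' t' a' b'" using T_ledge_form[OF l(2)] by metis
    have "p \<in> verts M" "ax' = (\<not> ax)" if "p \<in> l" "p \<in> l'" for p
      using ledges_meet[OF s(1) s'(1)] that l(3) unfolding s(2) s'(2) by blast+
    then have "l \<inter> l' \<subseteq> verts M" "ax' = (\<not> ax)" using l(4) by blast+
    then show ?thesis using directed_seg[OF ledge_pos[OF s(1)]] directed_seg[OF ledge_pos[OF s'(1)]] s(2) s'(2) by simp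
  qed
  have ends: "endpoints l \<subseteq> verts M \<inter> l" if l: "l \<in> T_ledges M" for l
  proof -
    obtain ax t a b where s: "is_ledge ax t a b" "l = seg ax t a b" using T_ledge_form[OF l] by metis
    then show ?thesis using endpoints_ledge[OF s(1)] ledge_ends[OF s(1)] ledge_pos[OF s(1)] by auto
  qed
  show ?thesis
    unfolding gen_T_component_def gt_ledges_T
  proof (intro conjI)
    show "disjoint (hsegs (T_component M))" "disjoint (vsegs (T_component M))"
      unfolding disjoint_def T_component_def using meet by auto
    show "\<forall>l\<in>T_ledges M. \<forall>l'\<in>T_ledges M. l \<noteq> l' \<longrightarrow> l \<inter> l' \<subseteq> marks (T_component M) l \<inter> marks (T_component M) l'"
    proof (intro ballI impI)
      fix l l' assume "l \<in> T_ledges M" "l' \<in> T_ledges M" "l \<noteq> l'"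
      then have "l \<inter> l' \<subseteq> verts M" using meet[of l l'] by blast
      then show "l \<inter> l' \<subseteq> marks (T_component M) l \<inter> marks (T_component M) l'" by (auto simp: T_component_def)
    qed
    show "\<forall>l\<in>T_ledges M. finite (marks (T_component M) l) \<and> marks (T_component M) l \<subseteq> l \<and> endpoints l \<subseteq> marks (T_component M) l"
      using ends fin_verts by (simp add: T_component_def)
  qed (use fin assms in \<open>auto simp: T_component_def\<close>)
qed

end

section \<open>Structural isomorphism\<close>

text \<open>All five are expressed through the classes of l-edges and their incidences, which the isomorphism preserves;
that a mesh has no cells, for instance, means that it has no boundary l-edges.\<close>

lemma struct_iso_invariants:
  assumes M: "tmesh M" and N: "tmesh N" and iso: "struct_iso M N"
  shows "card (cross_cuts N) = card (cross_cuts M)" and "card (free_verts N) = card (free_verts M)"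
    and "cells N = {} \<longleftrightarrow> cells M = {}" and "struct_similar (T_component M) (T_component N)"
    and "gt_connected (T_component M) \<Longrightarrow> gt_connected (T_component N)"
proof -
  interpret M: T_mesh M by unfold_locales (rule M)
  interpret N: T_mesh N by unfold_locales (rule N)
  obtain \<alpha> where bij: "bij_betw \<alpha> (ledges M) (ledges N)"
    and B: "\<alpha> ` boundary_ledges M = boundary_ledges N" and C: "\<alpha> ` cross_cuts M = cross_cuts N"
    and R: "\<alpha> ` rays M = rays N" and T: "\<alpha> ` T_ledges M = T_ledges N"
    and meets': "\<forall>l\<in>ledges M. \<forall>l'\<in>ledges M. l \<inter> l' \<noteq> {} \<longleftrightarrow> \<alpha> l \<inter> \<alpha> l' \<noteq> {}"
    using iso[unfolded struct_iso_def] by (elim exE conjE) (rule that)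
  have meets: "\<And>l l'. l \<in> ledges M \<Longrightarrow> l' \<in> ledges M \<Longrightarrow> l \<inter> l' \<noteq> {} \<longleftrightarrow> \<alpha> l \<inter> \<alpha> l' \<noteq> {}"
    using meets' by blast
  have inj: "inj_on \<alpha> (ledges M)" and im: "\<alpha> ` ledges M = ledges N" using bij unfolding bij_betw_def by auto
  have sub: "boundary_ledges M \<subseteq> ledges M" "cross_cuts M \<subseteq> ledges M" "rays M \<subseteq> ledges M" "T_ledges M \<subseteq> ledges M"
    unfolding ledges_def cross_cuts_def rays_def T_ledges_def by auto
  have eq: "\<alpha> l = \<alpha> l' \<longleftrightarrow> l = l'" if "l \<in> ledges M" "l' \<in> ledges M" for l l'
    using inj that by (auto simp: inj_on_def)
  show "card (cross_cuts N) = card (cross_cuts M)"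
    using C card_image[OF inj_on_subset[OF inj sub(2)]] by simp
  show "cells N = {} \<longleftrightarrow> cells M = {}" unfolding M.cells_empty_iff N.cells_empty_iff using B by auto
  have bijT: "bij_betw \<alpha> (T_ledges M) (T_ledges N)" using T inj_on_subset[OF inj sub(4)] unfolding bij_betw_def by simp
  have CR: "\<alpha> ` (cross_cuts M \<union> rays M) = cross_cuts N \<union> rays N" using C R by blast
  have subCR: "cross_cuts M \<union> rays M \<subseteq> ledges M" using sub by blast
  have bdry: "(\<exists>b\<in>boundary_ledges N. b \<inter> \<alpha> l \<noteq> {} \<and> b \<inter> \<alpha> l' \<noteq> {}) \<longleftrightarrow> (\<exists>b\<in>boundary_ledges M. b \<inter> l \<noteq> {} \<and> b \<inter> l' \<noteq> {})"
    if "l \<in> ledges M" "l' \<in> ledges M" for l l'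
  proof -
    have m: "b \<inter> l \<noteq> {} \<longleftrightarrow> \<alpha> b \<inter> \<alpha> l \<noteq> {}" "b \<inter> l' \<noteq> {} \<longleftrightarrow> \<alpha> b \<inter> \<alpha> l' \<noteq> {}" if "b \<in> boundary_ledges M" for b
      using meets[of b l] meets[of b l'] \<open>l \<in> ledges M\<close> \<open>l' \<in> ledges M\<close> that sub(1) by blast+
    show ?thesis
    proof
      assume "\<exists>k\<in>boundary_ledges N. k \<inter> \<alpha> l \<noteq> {} \<and> k \<inter> \<alpha> l' \<noteq> {}"
      then obtain k where k: "k \<in> boundary_ledges N" "k \<inter> \<alpha> l \<noteq> {}" "k \<inter> \<alpha> l' \<noteq> {}" by blast
      then obtain b where "b \<in> boundary_ledges M" "k = \<alpha> b" unfolding B[symmetric] by (elim imageE)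
      then show "\<exists>b\<in>boundary_ledges M. b \<inter> l \<noteq> {} \<and> b \<inter> l' \<noteq> {}" using k m[of b] by (intro bexI[of _ b]) simp_all
    next
      assume "\<exists>b\<in>boundary_ledges M. b \<inter> l \<noteq> {} \<and> b \<inter> l' \<noteq> {}"
      then obtain b where b: "b \<in> boundary_ledges M" "b \<inter> l \<noteq> {}" "b \<inter> l' \<noteq> {}" by blast
      have "\<alpha> b \<in> boundary_ledges N" unfolding B[symmetric] using b(1) by (rule imageI)
      then show "\<exists>k\<in>boundary_ledges N. k \<inter> \<alpha> l \<noteq> {} \<and> k \<inter> \<alpha> l' \<noteq> {}" using b m[of b] by (intro bexI[of _ "\<alpha> b"]) simp_all
    qed
  qed
  have memCR: "\<alpha> l \<in> cross_cuts N \<union> rays N \<longleftrightarrow> l \<in> cross_cuts M \<union> rays M" if "l \<in> ledges M" for l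
    unfolding CR[symmetric] using inj_on_image_mem_iff[OF inj that subCR] .
  have pairs: "(\<alpha> l, \<alpha> l') \<in> crossing_pairs N \<longleftrightarrow> (l, l') \<in> crossing_pairs M" if L: "l \<in> ledges M" "l' \<in> ledges M" for l l'
    unfolding crossing_pairs_def mem_Collect_eq case_prod_conv bdry[OF L] meets[OF L, symmetric] eq[OF L] memCR[OF L(1)] memCR[OF L(2)] ..
  have "crossing_pairs N = map_prod \<alpha> \<alpha> ` crossing_pairs M"
  proof
    show "map_prod \<alpha> \<alpha> ` crossing_pairs M \<subseteq> crossing_pairs N"
    proof (clarsimp simp del: Un_iff)
      fix l l' assume p: "(l, l') \<in> crossing_pairs M"
      then have "l \<in> ledges M" "l' \<in> ledges M" using subCR unfolding crossing_pairs_def by blast+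
      then show "(\<alpha> l, \<alpha> l') \<in> crossing_pairs N" using pairs p by blast
    qed
    show "crossing_pairs N \<subseteq> map_prod \<alpha> \<alpha> ` crossing_pairs M"
    proof clarify
      fix k k' assume p: "(k, k') \<in> crossing_pairs N"
      then have "k \<in> cross_cuts N \<union> rays N" "k' \<in> cross_cuts N \<union> rays N" unfolding crossing_pairs_def by blast+
      then obtain l l' where l: "l \<in> cross_cuts M \<union> rays M" "k = \<alpha> l" "l' \<in> cross_cuts M \<union> rays M" "k' = \<alpha> l'"
        unfolding CR[symmetric] by blast
      then have L: "l \<in> ledges M" "l' \<in> ledges M" using subCR by blast+
      have "(l, l') \<in> crossing_pairs M" using p pairs[OF L] unfolding l(2,4) by blast
      then show "(k, k') \<in> map_prod \<alpha> \<alpha> ` crossing_pairs M" unfolding l(2,4) by (rule image_eqI[rotated]) simp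
    qed
  qed
  moreover have "inj_on (map_prod \<alpha> \<alpha>) (crossing_pairs M)"
  proof (rule inj_on_subset[OF map_prod_inj_on[OF inj inj]])
    show "crossing_pairs M \<subseteq> ledges M \<times> ledges M" using subCR unfolding crossing_pairs_def by blast
  qed
  ultimately have "card (crossing_pairs N) = card (crossing_pairs M)" by (simp add: card_image)
  then show "card (free_verts N) = card (free_verts M)"
    unfolding M.card_crossing_pairs N.card_crossing_pairs by simp
  have cardv: "card (verts M \<inter> l) = card (verts N \<inter> \<alpha> l)" if l: "l \<in> T_ledges M" for l
  proof -
    have lL: "l \<in> ledges M" using l sub(4) by blast
    have "{k \<in> ledges N. k \<noteq> \<alpha> l \<and> k \<inter> \<alpha> l \<noteq> {}} = \<alpha> ` {l' \<in> ledges M. l' \<noteq> l \<and> l' \<inter> l \<noteq> {}}"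
      unfolding im[symmetric] using meets[OF _ lL] eq[OF _ lL] by auto
    moreover have "inj_on \<alpha> {l' \<in> ledges M. l' \<noteq> l \<and> l' \<inter> l \<noteq> {}}" using inj by (rule inj_on_subset) blast
    moreover have "\<alpha> l \<in> T_ledges N" using l T by blast
    ultimately show ?thesis
      using M.card_verts_on_T_ledge[OF l] N.card_verts_on_T_ledge[of "\<alpha> l"] by (simp add: card_image)
  qed
  show "struct_similar (T_component M) (T_component N)"
    unfolding struct_similar_def M.gt_ledges_T N.gt_ledges_T
    using bijT cardv meets sub(4) by (intro exI[of _ \<alpha>]) (auto simp: T_component_def subset_iff)
  show "gt_connected (T_component N)" if conn: "gt_connected (T_component M)"
    unfolding gt_connected_def N.gt_ledges_T
  proof (intro ballI)
    fix k k' assume "k \<in> T_ledges N" "k' \<in> T_ledges N"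
    then obtain l l' where l: "l \<in> T_ledges M" "l' \<in> T_ledges M" "k = \<alpha> l" "k' = \<alpha> l'" unfolding T[symmetric] by blast
    then have "(l, l') \<in> {(a, b). a \<in> T_ledges M \<and> b \<in> T_ledges M \<and> a \<inter> b \<noteq> {}}\<^sup>*"
      using conn unfolding gt_connected_def M.gt_ledges_T by blast
    then have "(\<alpha> l, \<alpha> l') \<in> {(a, b). a \<in> T_ledges N \<and> b \<in> T_ledges N \<and> a \<inter> b \<noteq> {}}\<^sup>*"
    proof induction
      case (step x y)
      then have xy: "x \<in> T_ledges M" "y \<in> T_ledges M" "x \<inter> y \<noteq> {}" by auto
      then have "\<alpha> x \<inter> \<alpha> y \<noteq> {}" using meets[of x y] sub(4) by blast
      then have "(\<alpha> x, \<alpha> y) \<in> {(a, b). a \<in> T_ledges N \<and> b \<in> T_ledges N \<and> a \<inter> b \<noteq> {}}" using xy T by blast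
      then show ?case using step.IH by (rule rtrancl_into_rtrancl[rotated])
    qed simp
    then show "(k, k') \<in> {(a, b). a \<in> T_ledges N \<and> b \<in> T_ledges N \<and> a \<inter> b \<noteq> {}}\<^sup>*" using l by simp
  qed
qed

theorem theorem3p2:
  fixes d :: nat and M :: mesh
  assumes "d \<ge> 1"
    and "tmesh M"
    and "gt_connected (T_component M)"
    and "no_vanishable d M"
    and "abs_dim_stable d M"
  shows "dim_stable d M"
  unfolding dim_stable_def
proof (intro ballI)
  fix M1 M2 assume "M1 \<in> iso_class M" "M2 \<in> iso_class M"
  then have M1: "tmesh M1" "struct_iso M M1" and M2: "tmesh M2" "struct_iso M M2" unfolding iso_class_def by auto
  interpret M1: T_mesh M1 by unfold_locales (rule M1)
  interpret M2: T_mesh M2 by unfold_locales (rule M2)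
  note i1 = struct_iso_invariants[OF assms(2) M1] and i2 = struct_iso_invariants[OF assms(2) M2]
  have "T_component M1 \<in> similarity_class (T_component M)" "T_component M2 \<in> similarity_class (T_component M)"
    unfolding similarity_class_def
    using M1.gen_T_component_T M2.gen_T_component_T i1(4,5) i2(4,5) assms(3) by auto
  then have "dim (CVS d (T_component M1)) = dim (CVS d (T_component M2))"
    using assms(5) unfolding abs_dim_stable_def by blast
  then show "dim (spline_space d M1) = dim (spline_space d M2)"
    unfolding M1.dim_spline_space_formula[OF assms(1)] M2.dim_spline_space_formula[OF assms(1)]
    using i1(1-3) i2(1-3) by simp
qed

end
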